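(* Let $d,K,N\ge 1$ be integers and, for $k=1,\dots,K$, let $f_k:\mathbb{R}^{kd}\to\mathbb{R}$. For $\boldsymbol{x}_1,\dots,\boldsymbol{x}_k\in\mathbb{R}^d$ write $\bar{\boldsymbol{x}}_k=[\boldsymbol{x}_1^\top,\dots,\boldsymbol{x}_k^\top]^\top$, and let $\hat F(\bar{\boldsymbol{x}}_K)=\sum_{k=1}^K f_k(\bar{\boldsymbol{x}}_k)$. Assume: (A1) $f_1,\dots,f_K$ are convex; (A2) each $f_i$ is $L_i$-Lipschitz: $|f_i(\bar{\boldsymbol{x}}_i)-f_i(\bar{\boldsymbol{y}}_i)|\le L_i\|\bar{\boldsymbol{x}}_i-\bar{\boldsymbol{y}}_i\|_2$; (A3) with $\bar{\boldsymbol{\mu}}_K^*=[\boldsymbol{\mu}_1^{*\top},\dots,\boldsymbol{\mu}_K^{*\top}]^\top$ a minimizer of $\hat F$, the initialization satisfies $\sum_{k=1}^K\|\boldsymbol{\mu}_k^1-\boldsymbol{\mu}_k^*\|^2_{(\boldsymbol{\Sigma}_k^1)^{-1}}\le R$, $\underline{\nu}\boldsymbol{I}\preceq \bar{\boldsymbol{\Sigma}}_K^1\preceq\bar{\nu}\boldsymbol{I}$ for some $\bar\nu\ge\underline\nu>0$, and $\sum_{k=1}^K\|\boldsymbol{\mu}_k^*\|_2^2\le B$. Run the CASBO algorithm (described in the context) for $T$ iterations with $\beta_t=t\beta$ ($\beta>0$), $\alpha_t=\sqrt{t+1}\,\alpha$ ($\alpha>0$), $\nu>0$, $\gamma_t=\frac{\alpha\nu}{\beta\sqrt{t+1}}$,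 $\omega_t=1$, and with initial covariances satisfying $\|\boldsymbol{\Sigma}_k^1\|_2^{-1}\ge\frac{5}{3}\alpha\nu$ for all $k$. Then, writing $\bar{\boldsymbol{\mu}}_k^t=[\boldsymbol{\mu}_1^{t\top},\dots,\boldsymbol{\mu}_k^{t\top}]^\top$ and $\bar{\boldsymbol{\mu}}_k^*=[\boldsymbol{\mu}_1^{*\top},\dots,\boldsymbol{\mu}_k^{*\top}]^\top$, $$\frac1T\sum_{t=1}^T\sum_{k=1}^K\mathbb{E}\,f_k(\bar{\boldsymbol{\mu}}_k^t)-\sum_{k=1}^K f_k(\bar{\boldsymbol{\mu}}_k^* )\le\frac{\sum_{k=1}^K\|\boldsymbol{\mu}_k^1-\boldsymbol{\mu}_k^*\|^2_{(\boldsymbol{\Sigma}_k^1)^{-1}}}{2\beta T}+\frac{2\sqrt{T+1}\,C_1}{T}+\frac{4(T+1)^{1/4}C_2}{T}+\frac{\sqrt{T+2}\,C_3}{T}\le O\Big(\frac{d^2K^4}{\sqrt T}\Big),$$ where $C_1=\frac{3\beta\sum_{i=1}^K K L_i^2(id+1)^2}{2\alpha\nu}$, $C_2=\frac{\sum_{i=1}^K\sqrt3\, i d L_i}{\sqrt{\alpha\nu}}$, $C_3=\frac{\alpha\nu B}{\beta}$ (the $O(\cdot)$ treating $R,B,\alpha,\beta,\nu,L_i$ as constants).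
   Context: Notation: $\|\boldsymbol{x}\|_C^2=\langle \boldsymbol{x},C\boldsymbol{x}\rangle$ for positive semidefinite $C$; $\Sigma^{1/2}$ is the symmetric PSD square root; $\preceq$ is the Loewner order. $\bar{\boldsymbol{\mu}}_i^t=[\boldsymbol{\mu}_1^{t\top},\dots,\boldsymbol{\mu}_i^{t\top}]^\top$, $\bar{\boldsymbol{\Sigma}}_i^t=\mathrm{diag}(\boldsymbol{\Sigma}_1^t,\dots,\boldsymbol{\Sigma}_i^t)$ (block diagonal). CASBO algorithm (parameters $\beta_t,\alpha_t,\gamma_t,\omega_t,\nu$, batch size $N$): start from $\boldsymbol{\mu}_k^1\in\mathbb{R}^d$ and symmetric positive definite $\boldsymbol{\Sigma}_k^1\in\mathbb{R}^{d\times d}$, $k=1,\dots,K$ (default $\boldsymbol{\mu}_k^1=\boldsymbol 0$, $\boldsymbol\Sigma_k^1=\tau\boldsymbol I$). At iteration $t=1,\dots,T$: 1. For each $k$ and $j=1,\dots,N$ draw $\boldsymbol z_k^j\sim\mathcal N(\boldsymbol 0,\boldsymbol I_d)$ independently of everything else; set $\boldsymbol x_k^j=\boldsymbol\mu_k^t+(\boldsymbol\Sigma_k^t)^{1/2}\boldsymbol z_k^j$, $\bar{\boldsymbol z}_i^j=[\boldsymbol z_1^{j\top},\dots,\boldsymbol z_i^{j\top}]^\top$, and query $f_k(\bar{\boldsymbol x}_k^j)$. 2. For $i\ge k$ set $\hat g_{ik}^t=\frac1N\sum_{j=1}^N(\boldsymbol\Sigma_k^t)^{-1/2}\boldsymbol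 z_k^j\big(f_i(\bar{\boldsymbol\mu}_i^t+(\bar{\boldsymbol\Sigma}_i^t)^{1/2}\bar{\boldsymbol z}_i^j)-f_i(\bar{\boldsymbol\mu}_i^t)\big)$. 3. For each $k$: $s_k^j=\sum_{i=k}^K f_i(\bar{\boldsymbol x}_i^j)$, $s_k^{\max},s_k^{\min}$ the max/min over $j$; $\boldsymbol H_k^t=c_1\frac1N\sum_{j=1}^N\boldsymbol z_k^j\boldsymbol z_k^{j\top}\frac{s_k^j-s_k^{\min}}{s_k^{\max}-s_k^{\min}}+c_2\boldsymbol I$ with constants $c_1,c_2>0$ chosen such that (C1) $\boldsymbol H_k^t\preceq\frac1{\alpha_t}\big(\frac{\beta_{t+1}}{\beta_t}-\omega_t\big)\boldsymbol I+\frac{\beta_{t+1}\gamma_t}{\alpha_t}\boldsymbol\Sigma_k^t$ and (C2) $\nu\boldsymbol I\preceq\hat G_k^t:=(\boldsymbol\Sigma_k^t)^{-1/2}\boldsymbol H_k^t(\boldsymbol\Sigma_k^t)^{-1/2}$. 4. Update $\boldsymbol\mu_k^{t+1}=\boldsymbol\mu_k^t-\beta_t\boldsymbol\Sigma_k^t\big(\gamma_t\boldsymbol\mu_k^t+\sum_{i=k}^K\hat g_{ik}^t\big)$ and $(\boldsymbol\Sigma_k^{t+1})^{-1}=\omega_t(\boldsymbol\Sigma_k^t)^{-1}+\alpha_t\hat G_k^t$. *)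

theory Defs
  imports "HOL-Probability.Probability" "Jordan_Normal_Form.Matrix"
begin

definition vnorm :: "real vec \<Rightarrow> real" where
  "vnorm v = sqrt (scalar_prod v v)"

definition wnorm_sq :: "real mat \<Rightarrow> real vec \<Rightarrow> real" where
  "wnorm_sq C x = scalar_prod x (C *\<^sub>v x)"

definition psd_mat :: "nat \<Rightarrow> real mat \<Rightarrow> bool" where
  "psd_mat n A \<longleftrightarrow> A \<in> carrier_mat n n \<and> transpose_mat A = A \<and>
     (\<forall>x\<in>carrier_vec n. 0 \<le> scalar_prod x (A *\<^sub>v x))"

definition pd_mat :: "nat \<Rightarrow> real mat \<Rightarrow> bool" where
  "pd_mat n A \<longleftrightarrow> A \<in> carrier_mat n n \<and> transpose_mat A = A \<and>
     (\<forall>x\<in>carrier_vec n. x \<noteq> 0\<^sub>v n \<longrightarrow> 0 < scalar_prod x (A *\<^sub>v x))"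

definition loewner_le :: "nat \<Rightarrow> real mat \<Rightarrow> real mat \<Rightarrow> bool" where
  "loewner_le n A B \<longleftrightarrow> A \<in> carrier_mat n n \<and> B \<in> carrier_mat n n \<and>
     (\<forall>x\<in>carrier_vec n. 0 \<le> scalar_prod x ((B - A) *\<^sub>v x))"

definition sqrt_mat :: "nat \<Rightarrow> real mat \<Rightarrow> real mat" where
  "sqrt_mat n A = (THE S. psd_mat n S \<and> S * S = A)"

definition inv_mat :: "nat \<Rightarrow> real mat \<Rightarrow> real mat" where
  "inv_mat n A = (THE B. B \<in> carrier_mat n n \<and> A * B = 1\<^sub>m n \<and> B * A = 1\<^sub>m n)"

definition spec_norm :: "nat \<Rightarrow> real mat \<Rightarrow> real" where
  "spec_norm n A = Sup {vnorm (A *\<^sub>v x) | x. x \<in> carrier_vec n \<and> vnorm x = 1}"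

fun stack :: "(nat \<Rightarrow> 'a::zero vec) \<Rightarrow> nat \<Rightarrow> 'a vec" where
  "stack x 0 = vec 0 (\<lambda>_. 0)"
| "stack x (Suc k) = stack x k @\<^sub>v x (Suc k)"

fun bdiag :: "nat \<Rightarrow> (nat \<Rightarrow> real mat) \<Rightarrow> nat \<Rightarrow> real mat" where
  "bdiag d S 0 = 0\<^sub>m 0 0"
| "bdiag d S (Suc k) = four_block_mat (bdiag d S k) (0\<^sub>m (k * d) d) (0\<^sub>m d (k * d)) (S (Suc k))"

definition vsum :: "nat \<Rightarrow> ('b \<Rightarrow> real vec) \<Rightarrow> 'b set \<Rightarrow> real vec" where
  "vsum d g A = vec d (\<lambda>l. \<Sum>a\<in>A. g a $ l)"

definition convex_on_vec :: "nat \<Rightarrow> (real vec \<Rightarrow> real) \<Rightarrow> bool" where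
  "convex_on_vec n g \<longleftrightarrow> (\<forall>x\<in>carrier_vec n. \<forall>y\<in>carrier_vec n. \<forall>\<theta>::real.
      0 \<le> \<theta> \<longrightarrow> \<theta> \<le> 1 \<longrightarrow> g (\<theta> \<cdot>\<^sub>v x + (1 - \<theta>) \<cdot>\<^sub>v y) \<le> \<theta> * g x + (1 - \<theta>) * g y)"

text \<open>Throughout: mu k, Sig k are the current mean / covariance of block k;
  zt k j is the sample z_k^j of the current iteration;
  f i is f_i on R^(i d).\<close>

definition casbo_x :: "nat \<Rightarrow> (nat \<Rightarrow> real vec) \<Rightarrow> (nat \<Rightarrow> real mat) \<Rightarrow>
    (nat \<Rightarrow> nat \<Rightarrow> real vec) \<Rightarrow> nat \<Rightarrow> nat \<Rightarrow> real vec" where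
  "casbo_x d mu Sig zt k j = mu k + sqrt_mat d (Sig k) *\<^sub>v zt k j"

definition casbo_ghat :: "nat \<Rightarrow> nat \<Rightarrow> (nat \<Rightarrow> real vec \<Rightarrow> real) \<Rightarrow> (nat \<Rightarrow> real vec) \<Rightarrow>
    (nat \<Rightarrow> real mat) \<Rightarrow> (nat \<Rightarrow> nat \<Rightarrow> real vec) \<Rightarrow> nat \<Rightarrow> nat \<Rightarrow> real vec" where
  "casbo_ghat d N f mu Sig zt i k =
     (1 / real N) \<cdot>\<^sub>v vsum d (\<lambda>j. (f i (stack (\<lambda>m. casbo_x d mu Sig zt m j) i) - f i (stack mu i))
                          \<cdot>\<^sub>v (inv_mat d (sqrt_mat d (Sig k)) *\<^sub>v zt k j)) {1..N}"

definition casbo_s :: "nat \<Rightarrow> nat \<Rightarrow> (nat \<Rightarrow> real vec \<Rightarrow> real) \<Rightarrow> (nat \<Rightarrow> real vec) \<Rightarrow>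
    (nat \<Rightarrow> real mat) \<Rightarrow> (nat \<Rightarrow> nat \<Rightarrow> real vec) \<Rightarrow> nat \<Rightarrow> nat \<Rightarrow> real" where
  "casbo_s d K f mu Sig zt k j = (\<Sum>i\<in>{k..K}. f i (stack (\<lambda>m. casbo_x d mu Sig zt m j) i))"

text \<open>H_k^t for given constants c1, c2 (division by zero yields 0 in HOL).\<close>
definition casbo_H :: "nat \<Rightarrow> nat \<Rightarrow> nat \<Rightarrow> (nat \<Rightarrow> real vec \<Rightarrow> real) \<Rightarrow> (nat \<Rightarrow> real vec) \<Rightarrow>
    (nat \<Rightarrow> real mat) \<Rightarrow> (nat \<Rightarrow> nat \<Rightarrow> real vec) \<Rightarrow> real \<Rightarrow> real \<Rightarrow> nat \<Rightarrow> real mat" where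
  "casbo_H d K N f mu Sig zt c1 c2 k =
     (let s = casbo_s d K f mu Sig zt k;
          smax = Max (s ` {1..N}); smin = Min (s ` {1..N})
      in c1 \<cdot>\<^sub>m mat d d (\<lambda>(a, b). (1 / real N) *
              (\<Sum>j\<in>{1..N}. zt k j $ a * zt k j $ b * ((s j - smin) / (smax - smin))))
         + c2 \<cdot>\<^sub>m 1\<^sub>m d)"

definition casbo_G :: "nat \<Rightarrow> nat \<Rightarrow> nat \<Rightarrow> (nat \<Rightarrow> real vec \<Rightarrow> real) \<Rightarrow> (nat \<Rightarrow> real vec) \<Rightarrow>
    (nat \<Rightarrow> real mat) \<Rightarrow> (nat \<Rightarrow> nat \<Rightarrow> real vec) \<Rightarrow> real \<Rightarrow> real \<Rightarrow> nat \<Rightarrow> real mat" where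
  "casbo_G d K N f mu Sig zt c1 c2 k =
     inv_mat d (sqrt_mat d (Sig k)) * casbo_H d K N f mu Sig zt c1 c2 k * inv_mat d (sqrt_mat d (Sig k))"

definition casbo_step :: "nat \<Rightarrow> nat \<Rightarrow> nat \<Rightarrow> (nat \<Rightarrow> real vec \<Rightarrow> real) \<Rightarrow>
    (nat \<Rightarrow> real) \<Rightarrow> (nat \<Rightarrow> real) \<Rightarrow> (nat \<Rightarrow> real) \<Rightarrow> (nat \<Rightarrow> real) \<Rightarrow> nat \<Rightarrow>
    (nat \<Rightarrow> nat \<Rightarrow> real vec) \<Rightarrow> (nat \<Rightarrow> real) \<Rightarrow> (nat \<Rightarrow> real) \<Rightarrow>
    (nat \<Rightarrow> real vec) \<times> (nat \<Rightarrow> real mat) \<Rightarrow> (nat \<Rightarrow> real vec) \<times> (nat \<Rightarrow> real mat)" where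
  "casbo_step d K N f beta alpha gamma omega t zt c1 c2 st =
     (let mu = fst st; Sig = snd st in
      ((\<lambda>k. mu k - beta t \<cdot>\<^sub>v (Sig k *\<^sub>v (gamma t \<cdot>\<^sub>v mu k +
                 vsum d (\<lambda>i. casbo_ghat d N f mu Sig zt i k) {k..K}))),
       (\<lambda>k. inv_mat d (omega t \<cdot>\<^sub>m inv_mat d (Sig k) +
                 alpha t \<cdot>\<^sub>m casbo_G d K N f mu Sig zt (c1 k) (c2 k) k))))"

text \<open>casbo_state ... n is the pair (mu^t, Sigma^t) at iteration t = n + 1.
  z t k j is the sample z_k^j drawn at iteration t; c1 t k, c2 t k the constants used
  at iteration t for block k.\<close>
primrec casbo_state :: "nat \<Rightarrow> nat \<Rightarrow> nat \<Rightarrow> (nat \<Rightarrow> real vec \<Rightarrow> real) \<Rightarrow>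
    (nat \<Rightarrow> real) \<Rightarrow> (nat \<Rightarrow> real) \<Rightarrow> (nat \<Rightarrow> real) \<Rightarrow> (nat \<Rightarrow> real) \<Rightarrow>
    (nat \<Rightarrow> nat \<Rightarrow> nat \<Rightarrow> real vec) \<Rightarrow> (nat \<Rightarrow> nat \<Rightarrow> real) \<Rightarrow> (nat \<Rightarrow> nat \<Rightarrow> real) \<Rightarrow>
    (nat \<Rightarrow> real vec) \<Rightarrow> (nat \<Rightarrow> real mat) \<Rightarrow> nat \<Rightarrow> (nat \<Rightarrow> real vec) \<times> (nat \<Rightarrow> real mat)" where
  "casbo_state d K N f beta alpha gamma omega z c1 c2 mu1 Sig1 0 = (mu1, Sig1)"
| "casbo_state d K N f beta alpha gamma omega z c1 c2 mu1 Sig1 (Suc n) =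
     casbo_step d K N f beta alpha gamma omega (Suc n) (z (Suc n)) (c1 (Suc n)) (c2 (Suc n))
       (casbo_state d K N f beta alpha gamma omega z c1 c2 mu1 Sig1 n)"

text \<open>Scalar Gaussian sources Z (t,k,j,l) = l-th coordinate (0-based, l < d) of z_k^j at
  iteration t.\<close>
definition casbo_index :: "nat \<Rightarrow> nat \<Rightarrow> nat \<Rightarrow> nat \<Rightarrow> (nat \<times> nat \<times> nat \<times> nat) set" where
  "casbo_index T K N d = {1..T} \<times> {1..K} \<times> {1..N} \<times> {..<d}"

definition casbo_z :: "nat \<Rightarrow> (nat \<times> nat \<times> nat \<times> nat \<Rightarrow> 'w \<Rightarrow> real) \<Rightarrow> 'w \<Rightarrow>
    nat \<Rightarrow> nat \<Rightarrow> nat \<Rightarrow> real vec" where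
  "casbo_z d Z w t k j = vec d (\<lambda>l. Z (t, k, j, l) w)"

definition casbo_hist :: "(nat \<times> nat \<times> nat \<times> nat) set \<Rightarrow> (nat \<times> nat \<times> nat \<times> nat \<Rightarrow> 'w \<Rightarrow> real) \<Rightarrow>
    nat \<Rightarrow> 'w \<Rightarrow> (nat \<times> nat \<times> nat \<times> nat \<Rightarrow> real)" where
  "casbo_hist I Z t w = (\<lambda>i. if i \<in> I \<and> fst i \<le> t then Z i w else 0)"

text \<open>The whole CASBO run on a sample path w: the constants c1, c2 at iteration t for block k
  are (measurable) functions of the sample history up to iteration t.\<close>
definition casbo_run :: "nat \<Rightarrow> nat \<Rightarrow> nat \<Rightarrow> nat \<Rightarrow> (nat \<Rightarrow> real vec \<Rightarrow> real) \<Rightarrow>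
    (nat \<Rightarrow> real) \<Rightarrow> (nat \<Rightarrow> real) \<Rightarrow> (nat \<Rightarrow> real) \<Rightarrow> (nat \<Rightarrow> real) \<Rightarrow>
    (nat \<times> nat \<times> nat \<times> nat \<Rightarrow> 'w \<Rightarrow> real) \<Rightarrow>
    (nat \<Rightarrow> nat \<Rightarrow> (nat \<times> nat \<times> nat \<times> nat \<Rightarrow> real) \<Rightarrow> real) \<Rightarrow>
    (nat \<Rightarrow> nat \<Rightarrow> (nat \<times> nat \<times> nat \<times> nat \<Rightarrow> real) \<Rightarrow> real) \<Rightarrow>
    (nat \<Rightarrow> real vec) \<Rightarrow> (nat \<Rightarrow> real mat) \<Rightarrow> 'w \<Rightarrow> nat \<Rightarrow> (nat \<Rightarrow> real vec) \<times> (nat \<Rightarrow> real mat)" where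
  "casbo_run d K N T f beta alpha gamma omega Z c1 c2 mu1 Sig1 w =
     casbo_state d K N f beta alpha gamma omega (casbo_z d Z w)
       (\<lambda>t k. c1 t k (casbo_hist (casbo_index T K N d) Z t w))
       (\<lambda>t k. c2 t k (casbo_hist (casbo_index T K N d) Z t w)) mu1 Sig1"

definition casbo_bound :: "real \<Rightarrow> real \<Rightarrow> real \<Rightarrow> real \<Rightarrow> nat \<Rightarrow> nat \<Rightarrow> nat \<Rightarrow> (nat \<Rightarrow> real) \<Rightarrow> real \<Rightarrow> real" where
  "casbo_bound beta alpha nu B d K T L Q =
     (let C1 = 3 * beta * (\<Sum>i\<in>{1..K}. real K * (L i)\<^sup>2 * (real i * real d + 1)\<^sup>2) / (2 * alpha * nu);
          C2 = (\<Sum>i\<in>{1..K}. sqrt 3 * real i * real d * L i) / sqrt (alpha * nu);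
          C3 = alpha * nu * B / beta
      in Q / (2 * beta * real T) + 2 * sqrt (real T + 1) * C1 / real T
         + 4 * root 4 (real T + 1) * C2 / real T + sqrt (real T + 2) * C3 / real T)"

end

theory Submission
  imports Defs "Jordan_Normal_Form.Determinant"
begin

text \<open>
  Write \<open>x = \<mu>\<^sup>t - \<mu>\<^sup>*\<close> and \<open>V\<^sub>t = \<Sum>\<^sub>k \<parallel>x\<^sub>k\<parallel>\<^sup>2\<close> in the norm of the current precision
  matrices. One step changes \<open>V\<^sub>t / (2 \<beta>\<^sub>t)\<close> by the linear term \<open>- \<langle>x, g\<rangle>\<close>, by the regulariser
  \<open>\<gamma>\<^sub>t\<close>, and by a quadratic term in the gradient estimate \<open>g\<close>; condition (C1) is exactly what lets
  the precision matrix be updated at the price of \<open>\<gamma>\<^sub>t \<parallel>x\<parallel>\<^sup>2 / 2\<close>, which the regulariser pays for.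
  Condition (C2) forces the precision to grow like \<open>t\<^bsup>3/2\<^esup>\<close>, so the covariance, the smoothing bias
  and the variance of \<open>g\<close> shrink fast enough for the sums to telescope into the stated bound.

  In expectation \<open>g\<close> is the gradient of the Gaussian smoothing of the objective. For convex \<open>f\<close> the
  inequality \<open>E \<langle>x, g\<rangle> \<ge> f(\<mu>) - f(\<mu>\<^sup>*) - bias\<close> needs no differentiability: it follows from shifting
  the Gaussian, convexity along segments and dominated convergence. The conditional expectation given
  the history is taken by Fubini, since the fresh samples are independent of the current iterate.
\<close>

unbundle no vec_syntax
unbundle no inner_syntax

subsection \<open>Vectors and quadratic forms\<close>

lemma scalar_prod_self_eq_sum: "v \<bullet> v = (\<Sum>i<dim_vec v. (v $ i)\<^sup>2)" for v :: "real vec"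
  by (simp add: scalar_prod_def power2_eq_square atLeast0LessThan)

lemma scalar_prod_self_nonneg [simp]: "0 \<le> v \<bullet> v" for v :: "real vec"
  by (simp add: scalar_prod_self_eq_sum sum_nonneg)

lemma vnorm_nonneg [simp]: "0 \<le> vnorm v"
  by (simp add: vnorm_def)

lemma vnorm_sq: "(vnorm v)\<^sup>2 = v \<bullet> v"
  by (simp add: vnorm_def)

lemma vnorm_eq_L2_set: "vnorm v = L2_set (\<lambda>i. v $ i) {..<dim_vec v}"
  by (simp add: vnorm_def L2_set_def scalar_prod_self_eq_sum)

lemma abs_scalar_prod_le_vnorm:
  assumes "u \<in> carrier_vec n" "v \<in> carrier_vec n"
  shows "\<bar>u \<bullet> v\<bar> \<le> vnorm u * vnorm v"
proof -
  have "\<bar>u \<bullet> v\<bar> \<le> (\<Sum>i<n. \<bar>u $ i\<bar> * \<bar>v $ i\<bar>)"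
    using assms by (auto simp: scalar_prod_def atLeast0LessThan abs_mult[symmetric] intro!: sum_abs)
  also have "\<dots> \<le> vnorm u * vnorm v"
    using assms unfolding vnorm_eq_L2_set by (auto intro!: L2_set_mult_ineq)
  finally show ?thesis .
qed

lemma vnorm_triangle:
  assumes "u \<in> carrier_vec n" "v \<in> carrier_vec n"
  shows "vnorm (u + v) \<le> vnorm u + vnorm v"
proof -
  have "vnorm (u + v) = L2_set (\<lambda>i. u $ i + v $ i) {..<n}"
    unfolding vnorm_eq_L2_set using assms by (intro L2_set_cong) auto
  also have "\<dots> \<le> vnorm u + vnorm v"
    using assms unfolding vnorm_eq_L2_set by (metis L2_set_triangle_ineq carrier_vecD)
  finally show ?thesis .
qed

lemma vnorm_smult: "vnorm (a \<cdot>\<^sub>v v) = \<bar>a\<bar> * vnorm v"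
  by (simp add: vnorm_def real_sqrt_mult power2_eq_square[symmetric] flip: mult.assoc)

lemma abs_index_le_vnorm: "i < dim_vec v \<Longrightarrow> \<bar>v $ i\<bar> \<le> vnorm v"
proof -
  assume "i < dim_vec v"
  then have "(v $ i)\<^sup>2 \<le> v \<bullet> v"
    unfolding scalar_prod_self_eq_sum by (intro member_le_sum) auto
  then show ?thesis using real_sqrt_le_mono by (fastforce simp: vnorm_def)
qed

lemma vnorm_eq_0_iff: "v \<in> carrier_vec n \<Longrightarrow> vnorm v = 0 \<longleftrightarrow> v = 0\<^sub>v n"
  unfolding vnorm_eq_L2_set by (subst L2_set_eq_0_iff) (auto intro!: eq_vecI)

lemma vnorm_pos: "v \<in> carrier_vec n \<Longrightarrow> v \<noteq> 0\<^sub>v n \<Longrightarrow> 0 < vnorm v"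
  using vnorm_eq_0_iff[of v n] vnorm_nonneg[of v] by linarith

lemma vnorm_zero [simp]: "vnorm (0\<^sub>v n) = 0"
  using vnorm_eq_0_iff[of "0\<^sub>v n" n] by simp

lemma vnorm_minus_commute:
  "u \<in> carrier_vec n \<Longrightarrow> v \<in> carrier_vec n \<Longrightarrow> vnorm (u - v) = vnorm (v - u)"
  unfolding vnorm_eq_L2_set L2_set_def
  by (auto intro!: arg_cong[of _ _ sqrt] sum.cong simp: power2_commute)

lemma symmetric_scalar_prod_swap:
  fixes A :: "real mat"
  assumes "A \<in> carrier_mat n n" "transpose_mat A = A" "x \<in> carrier_vec n" "y \<in> carrier_vec n"
  shows "x \<bullet> (A *\<^sub>v y) = (A *\<^sub>v x) \<bullet> y"
  using transpose_vec_mult_scalar[of A n n y x] assms by simp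

lemma wnorm_sq_diff:
  assumes "A \<in> carrier_mat n n" "transpose_mat A = A" "x \<in> carrier_vec n" "y \<in> carrier_vec n"
  shows "wnorm_sq A (x - s \<cdot>\<^sub>v y) = wnorm_sq A x - 2 * s * (y \<bullet> (A *\<^sub>v x)) + s\<^sup>2 * wnorm_sq A y"
proof -
  have c: "A *\<^sub>v x \<in> carrier_vec n" "A *\<^sub>v y \<in> carrier_vec n" using assms by auto
  have "A *\<^sub>v (x - s \<cdot>\<^sub>v y) = A *\<^sub>v x - s \<cdot>\<^sub>v (A *\<^sub>v y)"
    using assms by (simp add: mult_minus_distrib_mat_vec mult_mat_vec)
  moreover have "x \<bullet> (A *\<^sub>v y) = y \<bullet> (A *\<^sub>v x)"
    using assms by (metis c(1) comm_scalar_prod symmetric_scalar_prod_swap)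
  ultimately show ?thesis
    using assms c
    by (simp add: wnorm_sq_def minus_scalar_prod_distrib[of _ n] scalar_prod_minus_distrib[of _ n]
        power2_eq_square algebra_simps)
qed

lemma psd_matD:
  assumes "psd_mat n A"
  shows "A \<in> carrier_mat n n" "transpose_mat A = A" "x \<in> carrier_vec n \<Longrightarrow> 0 \<le> wnorm_sq A x"
  using assms by (auto simp: psd_mat_def wnorm_sq_def)

lemma pd_matD:
  assumes "pd_mat n A"
  shows "A \<in> carrier_mat n n" "transpose_mat A = A"
    "x \<in> carrier_vec n \<Longrightarrow> x \<noteq> 0\<^sub>v n \<Longrightarrow> 0 < wnorm_sq A x"
  using assms by (auto simp: pd_mat_def wnorm_sq_def)

lemma pd_imp_psd: "pd_mat n A \<Longrightarrow> psd_mat n A"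
  unfolding pd_mat_def psd_mat_def
  by (metis less_eq_real_def scalar_prod_left_zero mult_mat_vec_carrier zero_carrier_vec)

lemma psd_Cauchy_Schwarz:
  assumes A: "psd_mat n A" and xy: "x \<in> carrier_vec n" "y \<in> carrier_vec n"
  shows "(y \<bullet> (A *\<^sub>v x))\<^sup>2 \<le> wnorm_sq A x * wnorm_sq A y"
proof -
  note D = psd_matD[OF A]
  let ?a = "wnorm_sq A x" and ?b = "y \<bullet> (A *\<^sub>v x)" and ?c = "wnorm_sq A y"
  have q: "0 \<le> ?a - 2 * s * ?b + s\<^sup>2 * ?c" for s
    using D(3)[of "x - s \<cdot>\<^sub>v y"] xy by (simp add: wnorm_sq_diff[OF D(1,2) xy])
  show ?thesis
  proof (cases "?c = 0")
    case True
    have "?b = 0"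
    proof (rule ccontr)
      assume b: "?b \<noteq> 0"
      show False using q[of "(?a + 1) / (2 * ?b)"] b by (simp add: True)
    qed
    then show ?thesis by (simp add: True)
  next
    case False
    then have c: "?c > 0" using D(3)[OF xy(2)] by simp
    have "0 \<le> (?a - 2 * (?b / ?c) * ?b + (?b / ?c)\<^sup>2 * ?c) * ?c"
      using q[of "?b / ?c"] c by simp
    also have "\<dots> = ?a * ?c - ?b\<^sup>2"
      using c by (simp add: field_simps power2_eq_square)
    finally show ?thesis by simp
  qed
qed

lemma psd_vnorm_sq_le:
  assumes A: "psd_mat n A" and x: "x \<in> carrier_vec n"
    and c: "\<And>y. y \<in> carrier_vec n \<Longrightarrow> wnorm_sq A y \<le> c * (vnorm y)\<^sup>2"
  shows "(vnorm (A *\<^sub>v x))\<^sup>2 \<le> c * wnorm_sq A x"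
proof -
  note D = psd_matD[OF A]
  let ?y = "A *\<^sub>v x"
  have y: "?y \<in> carrier_vec n" using D(1) x by auto
  have "((vnorm ?y)\<^sup>2)\<^sup>2 \<le> wnorm_sq A x * wnorm_sq A ?y"
    using psd_Cauchy_Schwarz[OF A x y] by (simp add: vnorm_sq)
  also have "\<dots> \<le> wnorm_sq A x * (c * (vnorm ?y)\<^sup>2)"
    using D(3)[OF x] c[OF y] by (intro mult_left_mono)
  finally have *: "(vnorm ?y)\<^sup>2 * (vnorm ?y)\<^sup>2 \<le> (c * wnorm_sq A x) * (vnorm ?y)\<^sup>2"
    by (simp add: power2_eq_square algebra_simps)
  show ?thesis
  proof (cases "vnorm ?y = 0")
    case True
    then have "?y = 0\<^sub>v n" using y vnorm_eq_0_iff by blast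
    then have "wnorm_sq A x = 0" using x by (simp add: wnorm_sq_def)
    then show ?thesis using True by simp
  next
    case False
    then have "0 < (vnorm ?y)\<^sup>2" by simp
    with * show ?thesis by (rule mult_right_le_imp_le)
  qed
qed

definition mat_bound :: "real mat \<Rightarrow> real" where
  "mat_bound A = 1 + (\<Sum>i<dim_row A. \<Sum>j<dim_col A. \<bar>A $$ (i, j)\<bar>)"

lemma mat_bound_ge_1: "1 \<le> mat_bound A"
  by (simp add: mat_bound_def sum_nonneg)

lemma abs_scalar_prod_mult_mat_vec_le:
  assumes A: "A \<in> carrier_mat n n" and xy: "x \<in> carrier_vec n" "y \<in> carrier_vec n"
  shows "\<bar>x \<bullet> (A *\<^sub>v y)\<bar> \<le> mat_bound A * vnorm x * vnorm y"
proof -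
  have "x \<bullet> (A *\<^sub>v y) = (\<Sum>i<n. \<Sum>j<n. x $ i * (A $$ (i, j) * y $ j))"
    using A xy by (simp add: scalar_prod_def atLeast0LessThan sum_distrib_left)
  also have "\<bar>\<dots>\<bar> \<le> (\<Sum>i<n. \<Sum>j<n. \<bar>x $ i * (A $$ (i, j) * y $ j)\<bar>)"
    by (rule order_trans[OF sum_abs sum_mono[OF sum_abs]])
  also have "\<dots> \<le> (\<Sum>i<n. \<Sum>j<n. \<bar>A $$ (i, j)\<bar> * (vnorm x * vnorm y))"
  proof (intro sum_mono)
    fix i j assume ij: "i \<in> {..<n}" "j \<in> {..<n}"
    have "\<bar>x $ i\<bar> * \<bar>y $ j\<bar> \<le> vnorm x * vnorm y"
      using ij xy by (intro mult_mono abs_index_le_vnorm) auto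
    then have "\<bar>A $$ (i, j)\<bar> * (\<bar>x $ i\<bar> * \<bar>y $ j\<bar>) \<le> \<bar>A $$ (i, j)\<bar> * (vnorm x * vnorm y)"
      by (intro mult_left_mono) auto
    then show "\<bar>x $ i * (A $$ (i, j) * y $ j)\<bar> \<le> \<bar>A $$ (i, j)\<bar> * (vnorm x * vnorm y)"
      by (simp add: abs_mult mult_ac)
  qed
  also have "\<dots> = (\<Sum>i<n. \<Sum>j<n. \<bar>A $$ (i, j)\<bar>) * (vnorm x * vnorm y)"
    by (simp add: sum_distrib_right)
  also have "\<dots> \<le> mat_bound A * (vnorm x * vnorm y)"
    using A by (intro mult_right_mono) (auto simp: mat_bound_def)
  finally show ?thesis by (simp add: mult_ac)
qed

lemma vnorm_mult_mat_vec_le_mat_bound: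
  assumes A: "A \<in> carrier_mat n n" and x: "x \<in> carrier_vec n"
  shows "vnorm (A *\<^sub>v x) \<le> mat_bound A * vnorm x"
proof -
  have y: "A *\<^sub>v x \<in> carrier_vec n" using A x by auto
  have "vnorm (A *\<^sub>v x) * vnorm (A *\<^sub>v x) \<le> (mat_bound A * vnorm x) * vnorm (A *\<^sub>v x)"
    using abs_scalar_prod_mult_mat_vec_le[OF A y x]
    by (simp add: vnorm_sq[symmetric] power2_eq_square mult_ac)
  moreover have "0 \<le> mat_bound A * vnorm x"
    using mat_bound_ge_1[of A] by simp
  ultimately show ?thesis
    by (metis mult_le_cancel_right vnorm_nonneg order.strict_iff_order linorder_not_le)
qed

lemma wnorm_sq_le_mat_bound:
  assumes A: "A \<in> carrier_mat n n" and x: "x \<in> carrier_vec n"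
  shows "wnorm_sq A x \<le> mat_bound A * (vnorm x)\<^sup>2"
  using abs_scalar_prod_mult_mat_vec_le[OF A x x] by (simp add: wnorm_sq_def power2_eq_square mult_ac)

subsection \<open>Inverses\<close>

lemma inv_mat_eqI:
  assumes "A \<in> carrier_mat n n" "B \<in> carrier_mat n n" "A * B = 1\<^sub>m n" "B * A = 1\<^sub>m n"
  shows "inv_mat n A = B"
  unfolding inv_mat_def
proof (rule the_equality)
  fix C assume C: "C \<in> carrier_mat n n \<and> A * C = 1\<^sub>m n \<and> C * A = 1\<^sub>m n"
  have "C = C * (A * B)" using C assms by (metis right_mult_one_mat)
  also have "\<dots> = (C * A) * B" using C assms by (metis assoc_mult_mat)
  also have "\<dots> = B" using C assms by simp
  finally show "C = B" .
qed (use assms in auto)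

lemma pd_det_nonzero:
  assumes "pd_mat n A" shows "det A \<noteq> 0"
proof
  assume "det A = 0"
  then obtain v where v: "v \<in> carrier_vec n" "v \<noteq> 0\<^sub>v n" "A *\<^sub>v v = 0\<^sub>v n"
    using det_0_iff_vec_prod_zero_field[OF pd_matD(1)[OF assms]] by blast
  then show False using pd_matD(3)[OF assms v(1,2)] by (simp add: wnorm_sq_def)
qed

lemma inv_mat_eq_adj_mat:
  assumes A: "A \<in> carrier_mat n n" and d: "det A \<noteq> 0"
  shows "inv_mat n A = (1 / det A) \<cdot>\<^sub>m adj_mat A"
proof (rule inv_mat_eqI[OF A])
  note a = adj_mat[OF A]
  show "(1 / det A) \<cdot>\<^sub>m adj_mat A \<in> carrier_mat n n" using a by simp
  show "A * ((1 / det A) \<cdot>\<^sub>m adj_mat A) = 1\<^sub>m n"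
    using a A d by (subst mult_smult_distrib[OF A a(1)]) (auto intro!: eq_matI)
  show "((1 / det A) \<cdot>\<^sub>m adj_mat A) * A = 1\<^sub>m n"
    using a A d by (subst mult_smult_assoc_mat[OF a(1) A]) (auto intro!: eq_matI)
qed

lemma pd_inv_mat:
  assumes "pd_mat n A"
  shows "inv_mat n A \<in> carrier_mat n n" "A * inv_mat n A = 1\<^sub>m n" "inv_mat n A * A = 1\<^sub>m n"
proof -
  note A = pd_matD(1)[OF assms] and d = pd_det_nonzero[OF assms]
  note a = adj_mat[OF A] and e = inv_mat_eq_adj_mat[OF A d]
  show "inv_mat n A \<in> carrier_mat n n" using a e by simp
  show "A * inv_mat n A = 1\<^sub>m n" unfolding e
    using a A d by (subst mult_smult_distrib[OF A a(1)]) (auto intro!: eq_matI)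
  show "inv_mat n A * A = 1\<^sub>m n" unfolding e
    using a A d by (subst mult_smult_assoc_mat[OF a(1) A]) (auto intro!: eq_matI)
qed

lemma pd_inv_mat_mult_vec:
  assumes "pd_mat n A" "x \<in> carrier_vec n"
  shows "A *\<^sub>v (inv_mat n A *\<^sub>v x) = x" "inv_mat n A *\<^sub>v (A *\<^sub>v x) = x"
  using assms pd_inv_mat[OF assms(1)] pd_matD(1)[OF assms(1)]
  by (simp_all flip: assoc_mult_mat_vec)

lemma inv_mat_transpose:
  assumes "pd_mat n A" shows "transpose_mat (inv_mat n A) = inv_mat n A"
proof -
  note A = pd_matD(1,2)[OF assms] and I = pd_inv_mat[OF assms]
  have "inv_mat n A = transpose_mat (inv_mat n A)"
    by (rule inv_mat_eqI) (use A I in \<open>auto simp: transpose_mult[symmetric] \<close>,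
      (metis A I transpose_mult transpose_one)+)
  then show ?thesis by simp
qed

lemma pd_inv_mat_pd:
  assumes "pd_mat n A" shows "pd_mat n (inv_mat n A)"
  unfolding pd_mat_def
proof (intro conjI ballI impI)
  note A = pd_matD[OF assms] and I = pd_inv_mat[OF assms]
  show "inv_mat n A \<in> carrier_mat n n" "transpose_mat (inv_mat n A) = inv_mat n A"
    using I inv_mat_transpose[OF assms] by auto
  fix x :: "real vec" assume x: "x \<in> carrier_vec n" "x \<noteq> 0\<^sub>v n"
  let ?y = "inv_mat n A *\<^sub>v x"
  have y: "?y \<in> carrier_vec n" "A *\<^sub>v ?y = x"
    using I x pd_inv_mat_mult_vec[OF assms x(1)] by auto
  have "A *\<^sub>v 0\<^sub>v n = 0\<^sub>v n" using A(1) by (auto intro!: eq_vecI)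
  then have "?y \<noteq> 0\<^sub>v n" using y x by metis
  then have "0 < wnorm_sq A ?y" using A(3) y by blast
  also have "wnorm_sq A ?y = x \<bullet> ?y" using y x by (simp add: wnorm_sq_def comm_scalar_prod)
  finally show "0 < x \<bullet> (inv_mat n A *\<^sub>v x)" .
qed

lemma inv_mat_inv_mat: "pd_mat n A \<Longrightarrow> inv_mat n (inv_mat n A) = A"
  by (rule inv_mat_eqI) (auto simp: pd_inv_mat pd_matD)

lemma pd_lower_bound:
  assumes "pd_mat n A"
  obtains m where "0 < m" "\<And>x. x \<in> carrier_vec n \<Longrightarrow> m * (vnorm x)\<^sup>2 \<le> wnorm_sq A x"
proof
  note A = pd_matD[OF assms] and I = pd_inv_mat[OF assms]
  let ?c = "mat_bound A" and ?c' = "mat_bound (inv_mat n A)"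
  have c: "?c > 0" "?c' > 0" using mat_bound_ge_1[of A] mat_bound_ge_1[of "inv_mat n A"] by auto
  then show "0 < 1 / (?c * ?c'\<^sup>2)" by simp
  fix x :: "real vec" assume x: "x \<in> carrier_vec n"
  have "vnorm x \<le> ?c' * vnorm (A *\<^sub>v x)"
    using vnorm_mult_mat_vec_le_mat_bound[OF I(1), of "A *\<^sub>v x"] x A(1)
      pd_inv_mat_mult_vec[OF assms x] by simp
  then have "(vnorm x)\<^sup>2 \<le> ?c'\<^sup>2 * (vnorm (A *\<^sub>v x))\<^sup>2"
    unfolding power_mult_distrib[symmetric] by (intro power_mono) auto
  also have "\<dots> \<le> ?c'\<^sup>2 * (?c * wnorm_sq A x)"
    using psd_vnorm_sq_le[OF pd_imp_psd[OF assms] x wnorm_sq_le_mat_bound[OF A(1)]]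
    by (intro mult_left_mono) auto
  finally show "1 / (?c * ?c'\<^sup>2) * (vnorm x)\<^sup>2 \<le> wnorm_sq A x"
    using c by (simp add: field_simps)
qed

subsection \<open>Gaussian product measures\<close>

definition lipschitz_vec :: "nat \<Rightarrow> (real vec \<Rightarrow> real) \<Rightarrow> real \<Rightarrow> bool" where
  "lipschitz_vec n g C \<longleftrightarrow>
     (\<forall>x\<in>carrier_vec n. \<forall>y\<in>carrier_vec n. \<bar>g x - g y\<bar> \<le> C * vnorm (x - y))"

lemma vnorm_le_sum_abs: "vnorm (vec n y) \<le> (\<Sum>i<n. \<bar>y i\<bar>)"
proof -
  have "vnorm (vec n y) = L2_set y {..<n}"
    unfolding vnorm_eq_L2_set by (intro L2_set_cong) auto
  then show ?thesis using L2_set_le_sum_abs[of y "{..<n}"] by simp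
qed

lemma lipschitz_vec_continuous:
  assumes "lipschitz_vec n g C"
  shows "continuous_on UNIV (\<lambda>y::nat \<Rightarrow> real. g (vec n y))"
  unfolding continuous_on_sequentially comp_def
proof (intro allI ballI impI; elim conjE)
  fix X and a :: "nat \<Rightarrow> real" assume X: "X \<longlonglongrightarrow> a"
  have X': "(\<lambda>k. X k i) \<longlonglongrightarrow> a i" for i
    using continuous_on_tendsto_compose[OF continuous_on_product_coordinates[of i] X] by simp
  have b: "norm (g (vec n (X k)) - g (vec n a)) \<le> \<bar>C\<bar> * (\<Sum>i<n. \<bar>X k i - a i\<bar>)" for k
  proof -
    have "norm (g (vec n (X k)) - g (vec n a)) \<le> C * vnorm (vec n (X k) - vec n a)"
      using assms by (auto simp: lipschitz_vec_def)
    also have "\<dots> \<le> \<bar>C\<bar> * vnorm (vec n (X k) - vec n a)" by (intro mult_right_mono) auto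
    also have "vec n (X k) - vec n a = vec n (\<lambda>i. X k i - a i)" by auto
    also have "\<bar>C\<bar> * vnorm \<dots> \<le> \<bar>C\<bar> * (\<Sum>i<n. \<bar>X k i - a i\<bar>)"
      by (intro mult_left_mono vnorm_le_sum_abs) auto
    finally show ?thesis .
  qed
  have "(\<lambda>k. \<bar>C\<bar> * (\<Sum>i<n. \<bar>X k i - a i\<bar>)) \<longlonglongrightarrow> \<bar>C\<bar> * (\<Sum>i<n. \<bar>a i - a i\<bar>)"
    by (intro tendsto_intros X')
  then have "(\<lambda>k. \<bar>C\<bar> * (\<Sum>i<n. \<bar>X k i - a i\<bar>)) \<longlonglongrightarrow> 0" by simp
  then have "(\<lambda>k. g (vec n (X k)) - g (vec n a)) \<longlonglongrightarrow> 0"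
    by (rule Lim_null_comparison[rotated]) (use b in auto)
  then show "(\<lambda>k. g (vec n (X k))) \<longlonglongrightarrow> g (vec n a)" by (simp add: LIM_zero_iff)
qed

lemma lipschitz_vec_measurable:
  assumes g: "lipschitz_vec n g C"
    and c: "\<And>w. w \<in> space M \<Longrightarrow> v w \<in> carrier_vec n"
    and m: "\<And>l. l < n \<Longrightarrow> (\<lambda>w. v w $ l) \<in> borel_measurable M"
  shows "(\<lambda>w. g (v w)) \<in> borel_measurable M"
proof -
  have "(\<lambda>w l. if l < n then v w $ l else 0) \<in> borel_measurable M"
  proof (rule measurable_coordinatewise_then_product)
    show "(\<lambda>w. if l < n then v w $ l else 0) \<in> borel_measurable M" for l
      using m[of l] by (cases "l < n") auto
  qed
  then have "(\<lambda>w. g (vec n (\<lambda>l. if l < n then v w $ l else 0))) \<in> borel_measurable M"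
    using borel_measurable_continuous_onI[OF lipschitz_vec_continuous[OF g]] by (rule measurable_compose)
  moreover have "g (vec n (\<lambda>l. if l < n then v w $ l else 0)) = g (v w)" if "w \<in> space M" for w
    using c[OF that] by (intro arg_cong[of _ _ g] eq_vecI) auto
  ultimately show ?thesis by (simp cong: measurable_cong)
qed

lemma distr_PiM_coordinatewise:
  assumes I: "finite I" and Q: "prob_space Q" and T: "\<And>i. i \<in> I \<Longrightarrow> T i \<in> Q \<rightarrow>\<^sub>M Q"
  shows "distr (PiM I (\<lambda>_. Q)) (PiM I (\<lambda>_. Q)) (\<lambda>y. \<lambda>i\<in>I. T i (y i)) =
    PiM I (\<lambda>i. distr Q Q (if i \<in> I then T i else (\<lambda>x. x)))"
proof -
  interpret Q: prob_space Q by fact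
  define N where "N = (\<lambda>i. distr Q Q (if i \<in> I then T i else (\<lambda>x. x)))"
  have "prob_space (N i)" for i
    unfolding N_def by (rule Q.prob_space_distr) (use T in auto)
  then interpret N: product_sigma_finite N
    by (intro product_sigma_finite.intro prob_space_imp_sigma_finite)
  interpret QQ: product_sigma_finite "\<lambda>_. Q"
    by (intro product_sigma_finite.intro prob_space_imp_sigma_finite Q)
  have m: "(\<lambda>y. \<lambda>i\<in>I. T i (y i)) \<in> PiM I (\<lambda>_. Q) \<rightarrow>\<^sub>M PiM I (\<lambda>_. Q)"
    by (intro measurable_restrict measurable_compose[OF measurable_component_singleton] T)
  have "distr (PiM I (\<lambda>_. Q)) (PiM I (\<lambda>_. Q)) (\<lambda>y. \<lambda>i\<in>I. T i (y i)) = PiM I N"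
  proof (rule N.PiM_eqI[OF I])
    show "sets (distr (PiM I (\<lambda>_. Q)) (PiM I (\<lambda>_. Q)) (\<lambda>y. \<lambda>i\<in>I. T i (y i))) = sets (PiM I N)"
      unfolding sets_distr by (rule sets_PiM_cong) (auto simp: N_def)
    fix A assume A: "\<And>i. i \<in> I \<Longrightarrow> A i \<in> sets (N i)"
    then have A': "A i \<in> sets Q" if "i \<in> I" for i using that by (auto simp: N_def)
    have "emeasure (distr (PiM I (\<lambda>_. Q)) (PiM I (\<lambda>_. Q)) (\<lambda>y. \<lambda>i\<in>I. T i (y i))) (Pi\<^sub>E I A)
      = emeasure (PiM I (\<lambda>_. Q)) ((\<lambda>y. \<lambda>i\<in>I. T i (y i)) -` Pi\<^sub>E I A \<inter> space (PiM I (\<lambda>_. Q)))"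
      using A' by (intro emeasure_distr m sets_PiM_I_finite I) auto
    also have "(\<lambda>y. \<lambda>i\<in>I. T i (y i)) -` Pi\<^sub>E I A \<inter> space (PiM I (\<lambda>_. Q)) = Pi\<^sub>E I (\<lambda>i. T i -` A i \<inter> space Q)"
      by (auto simp: space_PiM PiE_iff)
    also have "emeasure (PiM I (\<lambda>_. Q)) \<dots> = (\<Prod>i\<in>I. emeasure Q (T i -` A i \<inter> space Q))"
      using A' T by (intro QQ.emeasure_PiM I) (auto intro: measurable_sets)
    also have "\<dots> = (\<Prod>i\<in>I. emeasure (N i) (A i))"
      using A' T by (intro prod.cong) (auto simp: N_def emeasure_distr)
    finally show "emeasure (distr (PiM I (\<lambda>_. Q)) (PiM I (\<lambda>_. Q)) (\<lambda>y. \<lambda>i\<in>I. T i (y i))) (Pi\<^sub>E I A)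
      = (\<Prod>i\<in>I. emeasure (N i) (A i))" .
  qed
  then show ?thesis by (simp add: N_def)
qed

lemma density_PiM_prod:
  fixes w :: "'i \<Rightarrow> 'a \<Rightarrow> ennreal"
  assumes I: "finite I" and Q: "prob_space Q" and w: "\<And>i. w i \<in> borel_measurable Q"
    and p: "\<And>i. prob_space (density Q (w i))"
  shows "density (PiM I (\<lambda>_. Q)) (\<lambda>y. \<Prod>i\<in>I. w i (y i)) = PiM I (\<lambda>i. density Q (w i))"
proof -
  interpret Q: prob_space Q by fact
  interpret N: product_sigma_finite "\<lambda>i. density Q (w i)"
    by (intro product_sigma_finite.intro prob_space_imp_sigma_finite p)
  interpret QQ: product_sigma_finite "\<lambda>_. Q"
    by (intro product_sigma_finite.intro prob_space_imp_sigma_finite Q)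
  note w[measurable]
  show ?thesis
  proof (rule N.PiM_eqI[OF I])
    show "sets (density (PiM I (\<lambda>_. Q)) (\<lambda>y. \<Prod>i\<in>I. w i (y i))) = sets (PiM I (\<lambda>i. density Q (w i)))"
      unfolding sets_density by (rule sets_PiM_cong) auto
    fix A assume "\<And>i. i \<in> I \<Longrightarrow> A i \<in> sets (density Q (w i))"
    then have A: "A i \<in> sets Q" if "i \<in> I" for i using that by auto
    have "emeasure (density (PiM I (\<lambda>_. Q)) (\<lambda>y. \<Prod>i\<in>I. w i (y i))) (Pi\<^sub>E I A) =
      (\<integral>\<^sup>+y. (\<Prod>i\<in>I. w i (y i)) * indicator (Pi\<^sub>E I A) y \<partial>PiM I (\<lambda>_. Q))"
      using A by (intro emeasure_density sets_PiM_I_finite I) auto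
    also have "\<dots> = (\<integral>\<^sup>+y. (\<Prod>i\<in>I. w i (y i) * indicator (A i) (y i)) \<partial>PiM I (\<lambda>_. Q))"
    proof (rule nn_integral_cong)
      fix y assume "y \<in> space (PiM I (\<lambda>_. Q))"
      then have "indicator (Pi\<^sub>E I A) y = (\<Prod>i\<in>I. indicator (A i) (y i) :: ennreal)"
        using I by (auto simp: space_PiM PiE_iff indicator_def prod_eq_1_iff)
      then show "(\<Prod>i\<in>I. w i (y i)) * indicator (Pi\<^sub>E I A) y = (\<Prod>i\<in>I. w i (y i) * indicator (A i) (y i))"
        by (simp add: prod.distrib)
    qed
    also have "\<dots> = (\<Prod>i\<in>I. \<integral>\<^sup>+x. w i x * indicator (A i) x \<partial>Q)"
      using A by (intro QQ.product_nn_integral_prod I) auto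
    also have "\<dots> = (\<Prod>i\<in>I. emeasure (density Q (w i)) (A i))"
      using A by (intro prod.cong) (auto simp: emeasure_density)
    finally show "emeasure (density (PiM I (\<lambda>_. Q)) (\<lambda>y. \<Prod>i\<in>I. w i (y i))) (Pi\<^sub>E I A) =
      (\<Prod>i\<in>I. emeasure (density Q (w i)) (A i))" .
  qed
qed

abbreviation std_normal :: "real measure" where
  "std_normal \<equiv> density lborel (\<lambda>x. ennreal (std_normal_density x))"

abbreviation gaussian :: "'i set \<Rightarrow> ('i \<Rightarrow> real) measure" where
  "gaussian I \<equiv> PiM I (\<lambda>_. std_normal)"

lemma prob_space_std_normal: "prob_space std_normal"
  using prob_space_normal_density[of 1 0] by simp

interpretation std_normal: prob_space std_normal
  by (rule prob_space_std_normal)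

interpretation gaussian: product_sigma_finite "\<lambda>_. std_normal"
  by (intro product_sigma_finite.intro prob_space_imp_sigma_finite prob_space_std_normal)

lemma prob_space_gaussian: "prob_space (gaussian I)"
  by (intro prob_space_PiM prob_space_std_normal)

lemma std_normal_density_mult_exp:
  "std_normal_density x * exp (c * x) = exp (c\<^sup>2 / 2) * normal_density c 1 x"
  by (simp add: normal_density_def exp_add[symmetric] power2_eq_square field_simps)

lemma integrable_std_normal_exp: "integrable std_normal (\<lambda>x. exp (c * \<bar>x\<bar>))"
proof (rule Bochner_Integration.integrable_bound)
  have "integrable std_normal (\<lambda>x. exp (a * x))" for a
    by (subst integrable_density) (auto simp: std_normal_density_mult_exp)
  from this[of c] this[of "- c"]
  show "integrable std_normal (\<lambda>x. exp (c * x) + exp (- c * x))" by (rule Bochner_Integration.integrable_add)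
  show "AE x in std_normal. norm (exp (c * \<bar>x\<bar>)) \<le> norm (exp (c * x) + exp (- c * x))"
  proof (intro AE_I2)
    fix x :: real
    have "norm (exp (c * \<bar>x\<bar>)) \<le> exp (c * x) + exp (- c * x)" by (auto simp: abs_if)
    then show "norm (exp (c * \<bar>x\<bar>)) \<le> norm (exp (c * x) + exp (- c * x))" by simp
  qed
qed simp

lemma integrable_gaussian_exp:
  assumes "finite I"
  shows "integrable (gaussian I) (\<lambda>y. exp (c * (\<Sum>i\<in>I. \<bar>y i\<bar>)))"
proof -
  have "integrable (gaussian I) (\<lambda>y. \<Prod>i\<in>I. exp (c * \<bar>y i\<bar>))"
    by (intro gaussian.product_integrable_prod assms integrable_std_normal_exp)
  then show ?thesis using assms by (simp add: exp_sum sum_distrib_left)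
qed

lemma integrable_gaussian_bound:
  assumes "finite I" "h \<in> borel_measurable (gaussian I)"
    and "\<And>y. \<bar>h y\<bar> \<le> K * exp (c * (\<Sum>i\<in>I. \<bar>y i\<bar>))"
  shows "integrable (gaussian I) h"
proof (rule Bochner_Integration.integrable_bound)
  show "integrable (gaussian I) (\<lambda>y. K * exp (c * (\<Sum>i\<in>I. \<bar>y i\<bar>)))"
    by (intro integrable_mult_right integrable_gaussian_exp assms)
  show "AE y in gaussian I. norm (h y) \<le> norm (K * exp (c * (\<Sum>i\<in>I. \<bar>y i\<bar>)))"
    unfolding real_norm_def by (intro AE_I2 order_trans[OF assms(3) abs_ge_self])
qed fact

lemma distr_std_normal_affine:
  assumes "\<bar>a\<bar> = 1"
  shows "distr std_normal std_normal (\<lambda>x. b + a * x) = density lborel (\<lambda>x. ennreal (normal_density b 1 x))"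
proof -
  have "distributed std_normal lborel (\<lambda>x. x) std_normal_density"
    by (simp add: distributed_def distr_id2)
  from std_normal.normal_density_affine[OF this, of a b] assms
  have "distr std_normal lborel (\<lambda>x. b + a * x) = density lborel (\<lambda>x. ennreal (normal_density b 1 x))"
    by (auto simp: distributed_def)
  then show ?thesis by (simp cong: distr_cong)
qed

lemma density_std_normal_exp:
  "density std_normal (\<lambda>x. ennreal (exp (b * x - b\<^sup>2 / 2))) = density lborel (\<lambda>x. ennreal (normal_density b 1 x))"
proof -
  have "std_normal_density x * exp (b * x - b\<^sup>2 / 2) = normal_density b 1 x" for x
    by (simp add: exp_diff std_normal_density_mult_exp)
  then show ?thesis
    by (subst density_density_eq) (auto simp: ennreal_mult[symmetric] intro!: density_cong)
qed

lemma gaussian_shift: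
  assumes "finite I"
  shows "distr (gaussian I) (gaussian I) (\<lambda>y. \<lambda>i\<in>I. u i + y i) =
    density (gaussian I) (\<lambda>y. ennreal (exp ((\<Sum>i\<in>I. u i * y i) - (\<Sum>i\<in>I. (u i)\<^sup>2) / 2)))"
proof -
  have "distr (gaussian I) (gaussian I) (\<lambda>y. \<lambda>i\<in>I. u i + y i) =
     PiM I (\<lambda>i. distr std_normal std_normal (if i \<in> I then (\<lambda>x. u i + x) else (\<lambda>x. x)))"
    by (intro distr_PiM_coordinatewise assms prob_space_std_normal) auto
  also have "\<dots> = PiM I (\<lambda>i. density std_normal (\<lambda>x. ennreal (exp (u i * x - (u i)\<^sup>2 / 2))))"
    using distr_std_normal_affine[of 1] by (intro PiM_cong refl) (auto simp: density_std_normal_exp)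
  also have "\<dots> = density (gaussian I) (\<lambda>y. \<Prod>i\<in>I. ennreal (exp (u i * y i - (u i)\<^sup>2 / 2)))"
    by (intro density_PiM_prod[symmetric] assms prob_space_std_normal)
       (auto simp: density_std_normal_exp prob_space_normal_density)
  also have "\<dots> = density (gaussian I) (\<lambda>y. ennreal (exp ((\<Sum>i\<in>I. u i * y i) - (\<Sum>i\<in>I. (u i)\<^sup>2) / 2)))"
    using assms by (intro arg_cong2[of _ _ _ _ density] refl ext)
      (simp add: prod_ennreal exp_sum[symmetric] sum_subtractf sum_divide_distrib)
  finally show ?thesis .
qed

lemma gaussian_uminus:
  assumes "finite I"
  shows "distr (gaussian I) (gaussian I) (\<lambda>y. \<lambda>i\<in>I. - y i) = gaussian I"
proof -
  have "distr (gaussian I) (gaussian I) (\<lambda>y. \<lambda>i\<in>I. - y i) =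
     PiM I (\<lambda>i. distr std_normal std_normal (if i \<in> I then (\<lambda>x. - x) else (\<lambda>x. x)))"
    by (intro distr_PiM_coordinatewise assms prob_space_std_normal) auto
  also have "\<dots> = gaussian I"
    using distr_std_normal_affine[of "-1" 0] by (intro PiM_cong refl) auto
  finally show ?thesis .
qed

lemma abs_exp_minus_one_le: "\<bar>exp x - 1\<bar> \<le> \<bar>x\<bar> * exp \<bar>x\<bar>" for x :: real
proof (cases "0 \<le> x")
  case True
  have "exp x - 1 = exp x * (1 - exp (- x))" by (simp add: exp_minus field_simps)
  also have "\<dots> \<le> exp x * x"
    using exp_ge_add_one_self[of "- x"] by (intro mult_left_mono) auto
  finally show ?thesis using True by (simp add: mult.commute)
next
  case False
  have "1 - exp x \<le> - x" using exp_ge_add_one_self[of x] by linarith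
  also have "\<dots> \<le> \<bar>x\<bar> * exp \<bar>x\<bar>" using False by (simp add: mult_le_cancel_left1)
  finally show ?thesis using False by simp
qed

lemma lipschitz_vec_growth:
  assumes "lipschitz_vec n g C"
  shows "\<bar>g (vec n y)\<bar> \<le> (\<bar>g (0\<^sub>v n)\<bar> + \<bar>C\<bar>) * exp (\<Sum>i<n. \<bar>y i\<bar>)"
proof -
  let ?s = "\<Sum>i<n. \<bar>y i\<bar>"
  have s: "0 \<le> ?s" by (simp add: sum_nonneg)
  then have e: "1 \<le> exp ?s" "?s \<le> exp ?s" using exp_ge_add_one_self[of ?s] by linarith+
  have "\<bar>g (vec n y) - g (0\<^sub>v n)\<bar> \<le> C * vnorm (vec n y - 0\<^sub>v n)"
    using assms unfolding lipschitz_vec_def by (metis vec_carrier zero_carrier_vec)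
  also have "vec n y - 0\<^sub>v n = vec n y" by auto
  also have "C * vnorm (vec n y) \<le> \<bar>C\<bar> * vnorm (vec n y)" by (intro mult_right_mono) auto
  also have "\<dots> \<le> \<bar>C\<bar> * exp ?s"
    using vnorm_le_sum_abs[of n y] e by (intro mult_left_mono) auto
  finally have "\<bar>g (vec n y)\<bar> \<le> \<bar>g (0\<^sub>v n)\<bar> + \<bar>C\<bar> * exp ?s" by linarith
  also have "\<bar>g (0\<^sub>v n)\<bar> \<le> \<bar>g (0\<^sub>v n)\<bar> * exp ?s" using e by (simp add: mult_le_cancel_left1)
  finally show ?thesis by (simp add: algebra_simps)
qed

lemma lipschitz_vec_measurable_gaussian:
  assumes "lipschitz_vec n g C"
  shows "(\<lambda>y. g (vec n y)) \<in> borel_measurable (gaussian {..<n})"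
  by (rule lipschitz_vec_measurable[OF assms]) auto

lemma lipschitz_vec_shift:
  assumes "lipschitz_vec n g C" "u \<in> carrier_vec n"
  shows "lipschitz_vec n (\<lambda>v. g (v + u)) C"
  unfolding lipschitz_vec_def
proof (intro ballI)
  fix x y :: "real vec" assume xy: "x \<in> carrier_vec n" "y \<in> carrier_vec n"
  have "(x + u) - (y + u) = x - y" using xy assms(2) by auto
  then show "\<bar>g (x + u) - g (y + u)\<bar> \<le> C * vnorm (x - y)"
    using assms xy unfolding lipschitz_vec_def by (metis add_carrier_vec)
qed

lemma integrable_gaussian_lipschitz:
  assumes "lipschitz_vec n g C"
  shows "integrable (gaussian {..<n}) (\<lambda>y. g (vec n y))"
  by (rule integrable_gaussian_bound[where c = 1])
     (use lipschitz_vec_growth[OF assms] lipschitz_vec_measurable_gaussian[OF assms] in auto)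

lemma integral_gaussian_shift:
  assumes g: "lipschitz_vec n g C" and u: "u \<in> carrier_vec n"
  shows "(\<integral>y. g (vec n y + u) \<partial>gaussian {..<n}) =
    (\<integral>y. exp (u \<bullet> vec n y - u \<bullet> u / 2) * g (vec n y) \<partial>gaussian {..<n})"
proof -
  let ?G = "gaussian {..<n}"
  note m = lipschitz_vec_measurable_gaussian[OF g]
  have "(\<integral>y. g (vec n y + u) \<partial>?G) = (\<integral>y. g (vec n (\<lambda>i\<in>{..<n}. u $ i + y i)) \<partial>?G)"
    using u by (intro Bochner_Integration.integral_cong refl arg_cong[of _ _ g]) auto
  also have "\<dots> = (\<integral>y. g (vec n y) \<partial>distr ?G ?G (\<lambda>y. \<lambda>i\<in>{..<n}. u $ i + y i))"
    by (intro integral_distr[symmetric] measurable_restrict m) simp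
  also have "\<dots> = (\<integral>y. exp ((\<Sum>i<n. u $ i * y i) - (\<Sum>i<n. (u $ i)\<^sup>2) / 2) * g (vec n y) \<partial>?G)"
    using m by (subst gaussian_shift) (auto simp: integral_density)
  also have "\<dots> = (\<integral>y. exp (u \<bullet> vec n y - u \<bullet> u / 2) * g (vec n y) \<partial>?G)"
    using u by (intro Bochner_Integration.integral_cong refl) 
      (auto simp: scalar_prod_def atLeast0LessThan power2_eq_square)
  finally show ?thesis .
qed

text \<open>Convexity along the segment from \<open>z\<close> to \<open>z + u\<close> bounds the difference quotients of
  \<open>e \<mapsto> E g(z + e u)\<close> by \<open>E g(z + u) - E g(z)\<close>; moving the shift into the density, the
  quotients converge to \<open>E (u \<bullet> z) g(z)\<close>.\<close>

lemma gaussian_convex_gradient: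
  assumes conv: "convex_on_vec n g" and g: "lipschitz_vec n g C" and u: "u \<in> carrier_vec n"
  shows "integrable (gaussian {..<n}) (\<lambda>y. g (vec n y) * (u \<bullet> vec n y))"
    and "(\<integral>y. g (vec n y) * (u \<bullet> vec n y) \<partial>gaussian {..<n}) \<le>
      (\<integral>y. g (vec n y + u) \<partial>gaussian {..<n}) - (\<integral>y. g (vec n y) \<partial>gaussian {..<n})"
proof -
  let ?G = "gaussian {..<n}"
  note m[measurable] = lipschitz_vec_measurable_gaussian[OF g]
  define b where "b = u \<bullet> u / 2"
  have b: "0 \<le> b" by (simp add: b_def)
  define U where "U = vnorm u"
  define K where "K = \<bar>g (0\<^sub>v n)\<bar> + \<bar>C\<bar>"
  have K: "0 \<le> K" by (simp add: K_def)
  define a where "a = (\<lambda>y. u \<bullet> vec n y)"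
  define e where "e = (\<lambda>k. 1 / real (Suc k))"
  have e: "0 < e k" "e k \<le> 1" for k by (auto simp: e_def)
  have a_meas[measurable]: "a \<in> borel_measurable ?G"
  proof -
    have "a = (\<lambda>y. \<Sum>i<n. u $ i * y i)" 
      by (auto simp: a_def scalar_prod_def atLeast0LessThan fun_eq_iff)
    then show ?thesis by simp
  qed
  have a_le: "\<bar>a y\<bar> \<le> U * (\<Sum>i<n. \<bar>y i\<bar>)" for y
  proof -
    have "\<bar>a y\<bar> \<le> U * vnorm (vec n y)" unfolding a_def U_def using u by (intro abs_scalar_prod_le_vnorm) auto
    also have "\<dots> \<le> U * (\<Sum>i<n. \<bar>y i\<bar>)" by (intro mult_left_mono vnorm_le_sum_abs) (auto simp: U_def)
    finally show ?thesis .
  qed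
  define s where "s = (\<lambda>k y. g (vec n y) * ((exp (e k * a y - (e k)\<^sup>2 * b) - 1) / e k))"
  define w where "w = (\<lambda>y. K * exp (2 * b) * exp ((1 + 2 * U) * (\<Sum>i<n. \<bar>y i\<bar>)))"
  have lim: "(\<lambda>k. s k y) \<longlonglongrightarrow> g (vec n y) * a y" for y
  proof -
    have "((\<lambda>x. exp (x * a y - x\<^sup>2 * b)) has_field_derivative a y) (at 0)"
      by (auto intro!: derivative_eq_intros)
    then have "((\<lambda>h. (exp (h * a y - h\<^sup>2 * b) - 1) / h) \<longlongrightarrow> a y) (at 0)"
      by (simp add: has_field_derivative_iff)
    moreover have "filterlim e (at 0) sequentially"
      unfolding filterlim_at using LIMSEQ_inverse_real_of_nat e(1)
      by (auto simp: e_def inverse_eq_divide)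
    ultimately have "(\<lambda>k. (exp (e k * a y - (e k)\<^sup>2 * b) - 1) / e k) \<longlonglongrightarrow> a y"
      by (rule filterlim_compose)
    then show ?thesis unfolding s_def by (intro tendsto_intros)
  qed
  have bound: "norm (s k y) \<le> w y" for k y
  proof -
    let ?x = "e k * a y - (e k)\<^sup>2 * b" and ?t = "\<bar>a y\<bar> + b" and ?S = "\<Sum>i<n. \<bar>y i\<bar>"
    have x1: "\<bar>?x\<bar> \<le> e k * ?t"
    proof -
      have "\<bar>?x\<bar> \<le> e k * \<bar>a y\<bar> + e k * (e k * b)"
        using e[of k] b abs_triangle_ineq4[of "e k * a y" "(e k)\<^sup>2 * b"]
        by (simp add: abs_mult power2_eq_square mult.assoc)
      also have "e k * (e k * b) \<le> e k * b" using e[of k] b by (intro mult_left_mono mult_left_le_one_le) auto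
      finally show ?thesis by (simp add: algebra_simps)
    qed
    have t0: "0 \<le> ?t" using b by simp
    have x2: "\<bar>?x\<bar> \<le> ?t" using x1 e[of k] t0 mult_left_le_one_le[of ?t "e k"] by linarith
    have "\<bar>(exp ?x - 1) / e k\<bar> \<le> \<bar>?x\<bar> * exp \<bar>?x\<bar> / e k"
      using abs_exp_minus_one_le[of ?x] e[of k] by (simp add: divide_right_mono)
    also have "\<dots> \<le> (e k * ?t) * exp ?t / e k"
      using x1 x2 e[of k] t0 by (intro divide_right_mono mult_mono) auto
    also have "\<dots> = ?t * exp ?t" using e(1)[of k] by simp
    also have "\<dots> \<le> exp ?t * exp ?t"
    proof (rule mult_right_mono)
      show "?t \<le> exp ?t" using exp_ge_add_one_self[of ?t] by linarith
    qed simp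
    also have "\<dots> = exp (2 * \<bar>a y\<bar> + 2 * b)" by (simp add: exp_add[symmetric])
    also have "\<dots> \<le> exp (2 * (U * ?S) + 2 * b)" using a_le[of y] by simp
    finally have *: "\<bar>(exp ?x - 1) / e k\<bar> \<le> exp (2 * (U * ?S) + 2 * b)" .
    have "norm (s k y) = \<bar>g (vec n y)\<bar> * \<bar>(exp ?x - 1) / e k\<bar>" by (simp add: s_def abs_mult)
    also have "\<dots> \<le> (K * exp ?S) * exp (2 * (U * ?S) + 2 * b)"
      using lipschitz_vec_growth[OF g, of y] * K unfolding K_def by (intro mult_mono) auto
    also have "\<dots> = w y" by (simp add: w_def exp_add[symmetric] algebra_simps)
    finally show ?thesis .
  qed
  have w: "integrable ?G w"
    unfolding w_def by (intro integrable_mult_right integrable_gaussian_exp) auto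
  have sm: "s k \<in> borel_measurable ?G" for k unfolding s_def by measurable
  note DC = sm w AE_I2[OF lim] AE_I2[OF bound]
  have "integrable ?G (\<lambda>y. g (vec n y) * a y)"
    by (rule integrable_dominated_convergence[OF _ DC]) measurable
  then show "integrable ?G (\<lambda>y. g (vec n y) * (u \<bullet> vec n y))" by (simp add: a_def)
  have conv_lim: "(\<lambda>k. integral\<^sup>L ?G (s k)) \<longlonglongrightarrow> (\<integral>y. g (vec n y) * a y \<partial>?G)"
    by (rule integral_dominated_convergence[OF _ DC]) measurable
  have s_int: "integrable ?G (s k)" for k
    by (rule integrable_dominated_convergence2[OF _ DC]) measurable
  have le: "integral\<^sup>L ?G (s k) \<le> (\<integral>y. g (vec n y + u) \<partial>?G) - (\<integral>y. g (vec n y) \<partial>?G)" for k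
  proof -
    let ?e = "e k"
    have eu: "?e \<cdot>\<^sub>v u \<in> carrier_vec n" using u by simp
    note i1 = integrable_gaussian_lipschitz[OF g]
      and i2 = integrable_gaussian_lipschitz[OF lipschitz_vec_shift[OF g u]]
      and i3 = integrable_gaussian_lipschitz[OF lipschitz_vec_shift[OF g eu]]
    have "(\<integral>y. g (vec n y + ?e \<cdot>\<^sub>v u) \<partial>?G) \<le> (\<integral>y. ?e * g (vec n y + u) + (1 - ?e) * g (vec n y) \<partial>?G)"
    proof (rule integral_mono[OF i3])
      show "integrable ?G (\<lambda>y. ?e * g (vec n y + u) + (1 - ?e) * g (vec n y))"
        using i1 i2 by simp
      fix y
      have "vec n y + ?e \<cdot>\<^sub>v u = ?e \<cdot>\<^sub>v (vec n y + u) + (1 - ?e) \<cdot>\<^sub>v vec n y"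
        using u by (intro eq_vecI) (auto simp: algebra_simps)
      then show "g (vec n y + ?e \<cdot>\<^sub>v u) \<le> ?e * g (vec n y + u) + (1 - ?e) * g (vec n y)"
        using conv u e[of k] by (auto simp: convex_on_vec_def)
    qed
    also have "\<dots> = ?e * (\<integral>y. g (vec n y + u) \<partial>?G) + (1 - ?e) * (\<integral>y. g (vec n y) \<partial>?G)"
      using i1 i2 by simp
    finally have 1: "(\<integral>y. g (vec n y + ?e \<cdot>\<^sub>v u) \<partial>?G) - (\<integral>y. g (vec n y) \<partial>?G) \<le>
        ?e * ((\<integral>y. g (vec n y + u) \<partial>?G) - (\<integral>y. g (vec n y) \<partial>?G))" by (simp add: algebra_simps)
    have ws: "exp (?e * a y - ?e\<^sup>2 * b) * g (vec n y) = ?e * s k y + g (vec n y)" for y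
      using e(1)[of k] by (simp add: s_def field_simps)
    have "(\<integral>y. g (vec n y + ?e \<cdot>\<^sub>v u) \<partial>?G) = (\<integral>y. exp (?e * a y - ?e\<^sup>2 * b) * g (vec n y) \<partial>?G)"
      unfolding integral_gaussian_shift[OF g eu] using u
      by (simp add: a_def b_def power2_eq_square mult.assoc)
    also have "\<dots> = ?e * integral\<^sup>L ?G (s k) + (\<integral>y. g (vec n y) \<partial>?G)"
      unfolding ws using s_int i1 by simp
    finally have "?e * integral\<^sup>L ?G (s k) \<le> ?e * ((\<integral>y. g (vec n y + u) \<partial>?G) - (\<integral>y. g (vec n y) \<partial>?G))"
      using 1 by simp
    then show ?thesis using e(1)[of k] by simp
  qed
  show "(\<integral>y. g (vec n y) * (u \<bullet> vec n y) \<partial>?G) \<le> (\<integral>y. g (vec n y + u) \<partial>?G) - (\<integral>y. g (vec n y) \<partial>?G)"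
    using LIMSEQ_le_const2[OF conv_lim] le by (auto simp: a_def)
qed

lemma gaussian_Jensen:
  assumes conv: "convex_on_vec n g" and g: "lipschitz_vec n g C"
  shows "g (0\<^sub>v n) \<le> (\<integral>y. g (vec n y) \<partial>gaussian {..<n})"
proof -
  let ?G = "gaussian {..<n}"
  note m[measurable] = lipschitz_vec_measurable_gaussian[OF g]
  note i = integrable_gaussian_lipschitz[OF g]
  interpret prob_space ?G by (rule prob_space_gaussian)
  have t: "(\<lambda>y. \<lambda>i\<in>{..<n}. - y i) \<in> ?G \<rightarrow>\<^sub>M ?G" by measurable
  have i': "integrable ?G (\<lambda>y. g (vec n (\<lambda>i\<in>{..<n}. - y i)))"
    using integrable_distr_eq[OF t m] gaussian_uminus[of "{..<n}"] i by simp
  have e: "(\<integral>y. g (vec n (\<lambda>i\<in>{..<n}. - y i)) \<partial>?G) = (\<integral>y. g (vec n y) \<partial>?G)"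
    using integral_distr[OF t m] gaussian_uminus[of "{..<n}"] by simp
  have "g (0\<^sub>v n) \<le> (1 / 2) * g (vec n y) + (1 - 1 / 2) * g (vec n (\<lambda>i\<in>{..<n}. - y i))" for y
  proof -
    have "0\<^sub>v n = (1 / 2) \<cdot>\<^sub>v vec n y + (1 - 1 / 2) \<cdot>\<^sub>v vec n (\<lambda>i\<in>{..<n}. - y i)"
      by (intro eq_vecI) auto
    then show ?thesis
      using conv[unfolded convex_on_vec_def, rule_format, of "vec n y" "vec n (\<lambda>i\<in>{..<n}. - y i)" "1 / 2"] by simp
  qed
  then have "(\<integral>y. g (0\<^sub>v n) \<partial>?G) \<le> (\<integral>y. (1 / 2) * g (vec n y) + (1 - 1 / 2) * g (vec n (\<lambda>i\<in>{..<n}. - y i)) \<partial>?G)"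
    using i i' by (intro integral_mono) auto
  also have "\<dots> = (\<integral>y. g (vec n y) \<partial>?G)" using i i' e by simp
  finally show ?thesis by (simp add: prob_space)
qed

lemma gaussian_even_moment:
  assumes "finite I"
  shows "integrable (gaussian I) (\<lambda>y. \<Prod>i\<in>I. y i ^ (2 * c i))"
    and "(\<integral>y. (\<Prod>i\<in>I. y i ^ (2 * c i)) \<partial>gaussian I) = (\<Prod>i\<in>I. fact (2 * c i) / (2 ^ c i * fact (c i)))"
proof -
  have i: "integrable std_normal (\<lambda>x. x ^ (2 * k))" for k
    using integrable_std_normal_moment[of "2 * k"] by (subst integrable_density) auto
  have v: "(\<integral>x. x ^ (2 * k) \<partial>std_normal) = fact (2 * k) / (2 ^ k * fact k)" for k
    using integral_std_normal_moment_even[of k] by (subst integral_density) auto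
  show "integrable (gaussian I) (\<lambda>y. \<Prod>i\<in>I. y i ^ (2 * c i))"
    by (intro gaussian.product_integrable_prod assms i)
  show "(\<integral>y. (\<Prod>i\<in>I. y i ^ (2 * c i)) \<partial>gaussian I) = (\<Prod>i\<in>I. fact (2 * c i) / (2 ^ c i * fact (c i)))"
    by (subst gaussian.product_integral_prod[OF assms i]) (simp add: v)
qed

lemma gaussian_second_moment:
  assumes "finite I" "i \<in> I"
  shows "integrable (gaussian I) (\<lambda>y. (y i)\<^sup>2)" "(\<integral>y. (y i)\<^sup>2 \<partial>gaussian I) = 1"
proof -
  let ?c = "\<lambda>m. of_bool (m = i) :: nat"
  have e: "(\<Prod>m\<in>I. y m ^ (2 * ?c m)) = (y i)\<^sup>2" for y :: "'a \<Rightarrow> real"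
    using assms by (subst prod.cong[OF refl, where h = "\<lambda>m. if m = i then (y m)\<^sup>2 else 1"]) auto
  have f: "(\<Prod>m\<in>I. fact (2 * ?c m) / (2 ^ ?c m * fact (?c m))) = (1::real)"
    by (intro prod.neutral) (auto simp: fact_numeral)
  show "integrable (gaussian I) (\<lambda>y. (y i)\<^sup>2)" "(\<integral>y. (y i)\<^sup>2 \<partial>gaussian I) = 1"
    using gaussian_even_moment[OF assms(1), of ?c] unfolding e f by auto
qed

lemma gaussian_fourth_moment:
  assumes "finite I" "i \<in> I" "j \<in> I"
  shows "integrable (gaussian I) (\<lambda>y. (y i)\<^sup>2 * (y j)\<^sup>2)"
    "(\<integral>y. (y i)\<^sup>2 * (y j)\<^sup>2 \<partial>gaussian I) = (if i = j then 3 else 1)"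
proof -
  let ?c = "\<lambda>m. of_bool (m = i) + of_bool (m = j) :: nat"
  have e: "(\<Prod>m\<in>I. y m ^ (2 * ?c m)) = (y i)\<^sup>2 * (y j)\<^sup>2" for y :: "'a \<Rightarrow> real"
  proof -
    have "(\<Prod>m\<in>I. y m ^ (2 * ?c m)) =
        (\<Prod>m\<in>I. (if m = i then (y m)\<^sup>2 else 1) * (if m = j then (y m)\<^sup>2 else 1))"
      by (intro prod.cong) (auto simp: power2_eq_square power4_eq_xxxx)
    then show ?thesis using assms by (simp add: prod.distrib)
  qed
  have f: "(\<Prod>m\<in>I. fact (2 * ?c m) / (2 ^ ?c m * fact (?c m))) = (if i = j then 3 else 1 :: real)"
  proof -
    have "(\<Prod>m\<in>I. fact (2 * ?c m) / (2 ^ ?c m * fact (?c m))) =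
        (\<Prod>m\<in>I. if m = i then (if i = j then 3 else 1) else 1 :: real)"
      by (intro prod.cong) (auto simp: fact_numeral)
    then show ?thesis using assms by simp
  qed
  show "integrable (gaussian I) (\<lambda>y. (y i)\<^sup>2 * (y j)\<^sup>2)"
    "(\<integral>y. (y i)\<^sup>2 * (y j)\<^sup>2 \<partial>gaussian I) = (if i = j then 3 else 1)"
    using gaussian_even_moment[OF assms(1), of ?c] unfolding e f by auto
qed

lemma vnorm_sq_vec: "(vnorm (vec n y))\<^sup>2 = (\<Sum>i<n. (y i)\<^sup>2)"
  by (simp add: vnorm_sq scalar_prod_self_eq_sum)

lemma gaussian_vnorm_sq:
  "integrable (gaussian {..<n}) (\<lambda>y. (vnorm (vec n y))\<^sup>2)"
  "(\<integral>y. (vnorm (vec n y))\<^sup>2 \<partial>gaussian {..<n}) = real n"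
  unfolding vnorm_sq_vec using gaussian_second_moment[of "{..<n}"]
  by (auto simp: Bochner_Integration.integral_sum)

lemma gaussian_vnorm_fourth:
  "integrable (gaussian {..<n}) (\<lambda>y. (vnorm (vec n y)) ^ 4)"
  "(\<integral>y. (vnorm (vec n y)) ^ 4 \<partial>gaussian {..<n}) \<le> (real n + 1)\<^sup>2"
proof -
  let ?G = "gaussian {..<n}"
  have e: "(vnorm (vec n y)) ^ 4 = (\<Sum>i<n. \<Sum>j<n. (y i)\<^sup>2 * (y j)\<^sup>2)" for y
  proof -
    have "(vnorm (vec n y)) ^ 4 = ((vnorm (vec n y))\<^sup>2)\<^sup>2" by simp
    then show ?thesis by (simp only: vnorm_sq_vec power2_eq_square[of "sum _ _"] sum_product)
  qed
  note m = gaussian_fourth_moment[of "{..<n}"]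
  show "integrable ?G (\<lambda>y. (vnorm (vec n y)) ^ 4)" unfolding e using m by (intro Bochner_Integration.integrable_sum) auto
  have "(\<integral>y. (vnorm (vec n y)) ^ 4 \<partial>?G) = (\<Sum>i<n. \<Sum>j<n. if i = j then 3 else 1)"
  proof -
    have "(\<integral>y. (vnorm (vec n y)) ^ 4 \<partial>?G) = (\<Sum>i<n. \<integral>y. (\<Sum>j<n. (y i)\<^sup>2 * (y j)\<^sup>2) \<partial>?G)"
      unfolding e using m
      by (intro Bochner_Integration.integral_sum Bochner_Integration.integrable_sum) auto
    also have "\<dots> = (\<Sum>i<n. \<Sum>j<n. if i = j then 3 else 1)"
      using m by (intro sum.cong refl) (simp add: Bochner_Integration.integral_sum)
    finally show ?thesis .
  qed
  also have "\<dots> = (\<Sum>i<n. \<Sum>j<n. (if i = j then 2 else 0) + 1)" by (intro sum.cong) auto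
  also have "\<dots> = (\<Sum>i<n. 2 + real n)" by (intro sum.cong) (auto simp: sum.distrib)
  also have "\<dots> \<le> (real n + 1)\<^sup>2" by (simp add: power2_eq_square algebra_simps)
  finally show "(\<integral>y. (vnorm (vec n y)) ^ 4 \<partial>?G) \<le> (real n + 1)\<^sup>2" .
qed

lemma gaussian_vnorm:
  assumes "1 \<le> n"
  shows "integrable (gaussian {..<n}) (\<lambda>y. vnorm (vec n y))"
    "(\<integral>y. vnorm (vec n y) \<partial>gaussian {..<n}) \<le> real n"
proof -
  let ?G = "gaussian {..<n}"
  interpret prob_space ?G by (rule prob_space_gaussian)
  have L: "lipschitz_vec n vnorm 1"
    unfolding lipschitz_vec_def
  proof (intro ballI)
    fix x y :: "real vec" assume xy: "x \<in> carrier_vec n" "y \<in> carrier_vec n"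
    have "(x - y) + y = x" "(y - x) + x = y" using xy by auto
    then have "vnorm x \<le> vnorm (x - y) + vnorm y" "vnorm y \<le> vnorm (y - x) + vnorm x"
      using xy by (metis minus_carrier_vec vnorm_triangle)+
    then show "\<bar>vnorm x - vnorm y\<bar> \<le> 1 * vnorm (x - y)"
      using vnorm_minus_commute[OF xy] by linarith
  qed
  show i: "integrable ?G (\<lambda>y. vnorm (vec n y))" by (rule integrable_gaussian_lipschitz[OF L])
  have "(\<integral>y. vnorm (vec n y) \<partial>?G) \<le> (\<integral>y. (1 + (vnorm (vec n y))\<^sup>2) / 2 \<partial>?G)"
  proof (intro integral_mono i)
    show "integrable ?G (\<lambda>y. (1 + (vnorm (vec n y))\<^sup>2) / 2)" using gaussian_vnorm_sq(1)[of n] by simp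
    show "vnorm (vec n y) \<le> (1 + (vnorm (vec n y))\<^sup>2) / 2" for y
      using sum_squares_bound[of 1 "vnorm (vec n y)"] by simp
  qed
  also have "\<dots> = (1 + real n) / 2" using gaussian_vnorm_sq[of n] by (simp add: prob_space)
  also have "\<dots> \<le> real n" using assms by simp
  finally show "(\<integral>y. vnorm (vec n y) \<partial>?G) \<le> real n" .
qed

lemma gaussian_smoothed_gradient:
  assumes n: "1 \<le> n" and conv: "convex_on_vec n f" and f: "lipschitz_vec n f C" and C: "0 \<le> C"
    and m: "m \<in> carrier_vec n" "ms \<in> carrier_vec n" and a: "a \<in> carrier_vec n"
    and D: "D \<in> carrier_mat n n" "D *\<^sub>v a = m - ms"
    and rho: "\<And>z. z \<in> carrier_vec n \<Longrightarrow> vnorm (D *\<^sub>v z) \<le> rho * vnorm z"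
  shows "f m - f ms - C * rho * real n \<le>
    (\<integral>y. (f (m + D *\<^sub>v vec n y) - f m) * (a \<bullet> vec n y) \<partial>gaussian {..<n})"
proof -
  let ?G = "gaussian {..<n}"
  interpret prob_space ?G by (rule prob_space_gaussian)
  define g where "g = (\<lambda>v. f (m + D *\<^sub>v v) - f m)"
  have gconv: "convex_on_vec n g"
    unfolding convex_on_vec_def
  proof (intro ballI allI impI)
    fix x y :: "real vec" and \<theta> :: real
    assume xy: "x \<in> carrier_vec n" "y \<in> carrier_vec n" and t: "0 \<le> \<theta>" "\<theta> \<le> 1"
    have "m + D *\<^sub>v (\<theta> \<cdot>\<^sub>v x + (1 - \<theta>) \<cdot>\<^sub>v y) = \<theta> \<cdot>\<^sub>v (m + D *\<^sub>v x) + (1 - \<theta>) \<cdot>\<^sub>v (m + D *\<^sub>v y)"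
    proof -
      have "D *\<^sub>v (\<theta> \<cdot>\<^sub>v x + (1 - \<theta>) \<cdot>\<^sub>v y) = \<theta> \<cdot>\<^sub>v (D *\<^sub>v x) + (1 - \<theta>) \<cdot>\<^sub>v (D *\<^sub>v y)"
        using D xy by (simp add: mult_add_distrib_mat_vec[of _ n n] mult_mat_vec[of _ n n])
      then show ?thesis
        using m D xy by (intro eq_vecI) (auto simp: algebra_simps)
    qed
    then have "f (m + D *\<^sub>v (\<theta> \<cdot>\<^sub>v x + (1 - \<theta>) \<cdot>\<^sub>v y)) \<le> \<theta> * f (m + D *\<^sub>v x) + (1 - \<theta>) * f (m + D *\<^sub>v y)"
      using conv t m D xy by (simp add: convex_on_vec_def)
    then show "g (\<theta> \<cdot>\<^sub>v x + (1 - \<theta>) \<cdot>\<^sub>v y) \<le> \<theta> * g x + (1 - \<theta>) * g y"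
      by (simp add: g_def algebra_simps)
  qed
  have fle: "f (p + D *\<^sub>v x) - f p \<le> C * rho * vnorm x" if "p \<in> carrier_vec n" "x \<in> carrier_vec n" for p x
  proof -
    have "\<bar>f (p + D *\<^sub>v x) - f p\<bar> \<le> C * vnorm (p + D *\<^sub>v x - p)"
      using f D that by (auto simp: lipschitz_vec_def)
    also have "p + D *\<^sub>v x - p = D *\<^sub>v x" using D that by auto
    also have "C * vnorm (D *\<^sub>v x) \<le> C * (rho * vnorm x)" by (intro mult_left_mono rho that C)
    finally show ?thesis by simp
  qed
  have gL: "lipschitz_vec n g (C * rho)"
    unfolding lipschitz_vec_def
  proof (intro ballI)
    fix x y :: "real vec" assume xy: "x \<in> carrier_vec n" "y \<in> carrier_vec n"
    have "\<bar>g x - g y\<bar> \<le> C * vnorm ((m + D *\<^sub>v x) - (m + D *\<^sub>v y))"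
      using f D m xy by (auto simp: lipschitz_vec_def g_def)
    also have "(m + D *\<^sub>v x) - (m + D *\<^sub>v y) = D *\<^sub>v (x - y)"
      using D m xy by (subst mult_minus_distrib_mat_vec[of _ n n]) auto
    also have "C * vnorm (D *\<^sub>v (x - y)) \<le> C * (rho * vnorm (x - y))"
      using xy by (intro mult_left_mono rho C) auto
    finally show "\<bar>g x - g y\<bar> \<le> C * rho * vnorm (x - y)" by simp
  qed
  have u: "- a \<in> carrier_vec n" using a by simp
  have gu: "g (vec n y + - a) \<le> (f ms - f m) + C * rho * vnorm (vec n y)" for y
  proof -
    have "D *\<^sub>v (vec n y + - a) = D *\<^sub>v vec n y - (m - ms)"
    proof -
      have "vec n y + - a = vec n y - a" using a by (intro eq_vecI) auto
      then show ?thesis using D a by (simp add: mult_minus_distrib_mat_vec[of _ n n])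
    qed
    then have "m + D *\<^sub>v (vec n y + - a) = ms + D *\<^sub>v vec n y"
      using m D by (intro eq_vecI) auto
    then show ?thesis using fle[OF m(2), of "vec n y"] by (simp add: g_def)
  qed
  have "(\<integral>y. g (vec n y) * (- a \<bullet> vec n y) \<partial>?G) \<le> (\<integral>y. g (vec n y + - a) \<partial>?G) - (\<integral>y. g (vec n y) \<partial>?G)"
    by (rule gaussian_convex_gradient(2)[OF gconv gL u])
  also have "(\<integral>y. g (vec n y + - a) \<partial>?G) \<le> (\<integral>y. (f ms - f m) + C * rho * vnorm (vec n y) \<partial>?G)"
    using gu gaussian_vnorm[OF n]
    by (intro integral_mono integrable_gaussian_lipschitz[OF lipschitz_vec_shift[OF gL u]]) auto
  also have "\<dots> = (f ms - f m) + C * rho * (\<integral>y. vnorm (vec n y) \<partial>?G)"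
    using gaussian_vnorm[OF n] by (simp add: prob_space)
  also have "\<dots> \<le> (f ms - f m) + C * rho * real n"
  proof -
    have "0 \<le> rho"
    proof -
      have "vnorm (unit_vec n 0) = 1" using n by (simp add: vnorm_def)
      then show ?thesis
        using rho[of "unit_vec n 0"] by (metis mult.right_neutral order_trans unit_vec_carrier vnorm_nonneg)
    qed
    then show ?thesis using gaussian_vnorm(2)[OF n] C by (intro add_left_mono mult_left_mono) auto
  qed
  finally have up: "(\<integral>y. g (vec n y) * (- a \<bullet> vec n y) \<partial>?G) \<le>
      f ms - f m + C * rho * real n - (\<integral>y. g (vec n y) \<partial>?G)" by simp
  have "(\<integral>y. g (vec n y) \<partial>?G) \<ge> 0"
  proof -
    have "m + D *\<^sub>v 0\<^sub>v n = m" using D m by (intro eq_vecI) auto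
    then show ?thesis using gaussian_Jensen[OF gconv gL] by (simp add: g_def)
  qed
  with up have "(\<integral>y. g (vec n y) * (- a \<bullet> vec n y) \<partial>?G) \<le> f ms - f m + C * rho * real n"
    by linarith
  moreover have "(\<integral>y. g (vec n y) * (- a \<bullet> vec n y) \<partial>?G) = - (\<integral>y. g (vec n y) * (a \<bullet> vec n y) \<partial>?G)"
    using a by (simp flip: Bochner_Integration.integral_minus)
  ultimately show ?thesis by (simp add: g_def)
qed

subsection \<open>Square roots\<close>

definition op_le :: "nat \<Rightarrow> real mat \<Rightarrow> real \<Rightarrow> bool" where
  "op_le n A c \<longleftrightarrow> A \<in> carrier_mat n n \<and> (\<forall>x\<in>carrier_vec n. vnorm (A *\<^sub>v x) \<le> c * vnorm x)"

lemma op_leD: "op_le n A c \<Longrightarrow> A \<in> carrier_mat n n"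
  "op_le n A c \<Longrightarrow> x \<in> carrier_vec n \<Longrightarrow> vnorm (A *\<^sub>v x) \<le> c * vnorm x"
  by (auto simp: op_le_def)

lemma op_le_add: "op_le n A a \<Longrightarrow> op_le n B b \<Longrightarrow> op_le n (A + B) (a + b)"
  unfolding op_le_def
proof (intro conjI ballI; elim conjE)
  fix x :: "real vec"
  assume A: "A \<in> carrier_mat n n" "\<forall>x\<in>carrier_vec n. vnorm (A *\<^sub>v x) \<le> a * vnorm x"
    and B: "B \<in> carrier_mat n n" "\<forall>x\<in>carrier_vec n. vnorm (B *\<^sub>v x) \<le> b * vnorm x"
    and x: "x \<in> carrier_vec n"
  have "vnorm ((A + B) *\<^sub>v x) \<le> vnorm (A *\<^sub>v x) + vnorm (B *\<^sub>v x)"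
    using A B x by (simp add: add_mult_distrib_mat_vec[of _ n n] vnorm_triangle[of _ n])
  then show "vnorm ((A + B) *\<^sub>v x) \<le> (a + b) * vnorm x"
    using A B x by (force simp: algebra_simps)
qed auto

lemma op_le_mult:
  assumes A: "op_le n A a" and B: "op_le n B b" and a: "0 \<le> a"
  shows "op_le n (A * B) (a * b)"
  unfolding op_le_def
proof (intro conjI ballI)
  show "A * B \<in> carrier_mat n n" using A B by (auto simp: op_le_def)
  fix x :: "real vec" assume x: "x \<in> carrier_vec n"
  have "vnorm ((A * B) *\<^sub>v x) \<le> a * vnorm (B *\<^sub>v x)"
    using op_leD(2)[OF A, of "B *\<^sub>v x"] op_leD(1)[OF A] op_leD(1)[OF B] x by simp
  also have "\<dots> \<le> a * (b * vnorm x)"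
    using op_leD(2)[OF B x] a by (rule mult_left_mono)
  finally show "vnorm ((A * B) *\<^sub>v x) \<le> a * b * vnorm x" by (simp add: mult_ac)
qed

lemma op_le_smult:
  assumes "op_le n A a" "0 \<le> s"
  shows "op_le n (s \<cdot>\<^sub>m A) (s * a)"
  unfolding op_le_def
proof (intro conjI ballI)
  show "s \<cdot>\<^sub>m A \<in> carrier_mat n n" using assms by (auto simp: op_le_def)
  fix x :: "real vec" assume x: "x \<in> carrier_vec n"
  have "(s \<cdot>\<^sub>m A) *\<^sub>v x = s \<cdot>\<^sub>v (A *\<^sub>v x)"
    using op_leD(1)[OF assms(1)] x by (intro eq_vecI) (auto simp: scalar_prod_def sum_distrib_left mult_ac)
  then show "vnorm ((s \<cdot>\<^sub>m A) *\<^sub>v x) \<le> s * a * vnorm x"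
    using op_leD(2)[OF assms(1) x] assms(2) by (simp add: vnorm_smult mult_left_mono mult.assoc)
qed

lemma op_le_entry:
  assumes A: "op_le n A a" and ij: "i < n" "j < n"
  shows "\<bar>A $$ (i, j)\<bar> \<le> a"
proof -
  have c: "A \<in> carrier_mat n n" using A by (auto simp: op_le_def)
  have "\<bar>A $$ (i, j)\<bar> = \<bar>(A *\<^sub>v unit_vec n j) $ i\<bar>"
    using c ij by simp
  also have "\<dots> \<le> vnorm (A *\<^sub>v unit_vec n j)"
    using c ij by (intro abs_index_le_vnorm) auto
  also have "\<dots> \<le> a * vnorm (unit_vec n j)" using A by (auto simp: op_le_def)
  also have "vnorm (unit_vec n j) = 1" using ij by (simp add: vnorm_def)
  finally show ?thesis by simp
qed

text \<open>With \<open>X = 1 - A / c\<close> the fixed point \<open>B = (X + B\<^sup>2) / 2\<close> satisfies \<open>(1 - B)\<^sup>2 = A / c\<close>; the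
  iteration from \<open>0\<close> is a contraction in operator norm. It is polynomial in the entries of \<open>A\<close>,
  which is what makes the square root measurable.\<close>

primrec sqrt_iter :: "nat \<Rightarrow> real mat \<Rightarrow> nat \<Rightarrow> real mat" where
  "sqrt_iter n X 0 = 0\<^sub>m n n"
| "sqrt_iter n X (Suc k) = (1 / 2) \<cdot>\<^sub>m (X + sqrt_iter n X k * sqrt_iter n X k)"

lemma sqrt_iter_carrier: "X \<in> carrier_mat n n \<Longrightarrow> sqrt_iter n X k \<in> carrier_mat n n"
  by (induction k) auto

lemma sqrt_iter_transpose:
  "X \<in> carrier_mat n n \<Longrightarrow> transpose_mat X = X \<Longrightarrow>
   transpose_mat (sqrt_iter n X k) = sqrt_iter n X k"
proof (induction k)
  case (Suc k)
  note c = sqrt_iter_carrier[OF Suc.prems(1), of k]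
  have t: "transpose_mat ((1 / 2) \<cdot>\<^sub>m M) = (1 / 2) \<cdot>\<^sub>m transpose_mat M" for M :: "real mat"
    by (auto intro!: eq_matI)
  show ?case using Suc c
    by (simp add: t transpose_add[of _ n n] transpose_mult[of _ n n _ n])
qed simp

lemma sqrt_iter_op_le:
  assumes X: "op_le n X q" and q: "0 \<le> q" and b: "0 \<le> b" "q + b\<^sup>2 = 2 * b"
  shows "op_le n (sqrt_iter n X k) b"
proof (induction k)
  case 0
  have "0\<^sub>m n n *\<^sub>v x = 0\<^sub>v n" if "x \<in> carrier_vec n" for x :: "real vec"
    using that by (intro eq_vecI) auto
  then show ?case using b by (auto simp: op_le_def)
next
  case (Suc k)
  have "op_le n ((1 / 2) \<cdot>\<^sub>m (X + sqrt_iter n X k * sqrt_iter n X k)) (1 / 2 * (q + b * b))"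
    using b by (intro op_le_smult op_le_add op_le_mult X Suc) auto
  then show ?case using b by (simp add: power2_eq_square)
qed

lemma sqrt_iter_diff_op_le:
  assumes X: "op_le n X q" and q: "0 \<le> q" and b: "0 \<le> b" "q + b\<^sup>2 = 2 * b"
  shows "op_le n (sqrt_iter n X (Suc k) - sqrt_iter n X k) (b ^ k * b)"
proof (induction k)
  case 0
  have "sqrt_iter n X (Suc 0) - sqrt_iter n X 0 = sqrt_iter n X (Suc 0)"
    using op_leD(1)[OF X] by (auto intro!: eq_matI)
  then show ?case using sqrt_iter_op_le[OF assms, of "Suc 0"] by simp
next
  case (Suc k)
  let ?B = "sqrt_iter n X (Suc k)" and ?C = "sqrt_iter n X k"
  note c = sqrt_iter_carrier[OF op_leD(1)[OF X]]
  have "?B * (?B - ?C) + (?B - ?C) * ?C = ?B * ?B - ?C * ?C"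
  proof -
    have B: "?B \<in> carrier_mat n n" and C: "?C \<in> carrier_mat n n" using c by blast+
    have "?B * (?B - ?C) = ?B * ?B - ?B * ?C" "(?B - ?C) * ?C = ?B * ?C - ?C * ?C"
      using mult_minus_distrib_mat[OF B B C] minus_mult_distrib_mat[OF B C C] by blast+
    moreover have "?B * ?B \<in> carrier_mat n n" "?B * ?C \<in> carrier_mat n n" "?C * ?C \<in> carrier_mat n n"
      using B C by (metis mult_carrier_mat)+
    ultimately show ?thesis by (auto intro!: eq_matI)
  qed
  moreover have "sqrt_iter n X (Suc (Suc k)) - ?B = (1 / 2) \<cdot>\<^sub>m (?B * ?B - ?C * ?C)"
  proof -
    have c2: "?B * ?B \<in> carrier_mat n n" "?C * ?C \<in> carrier_mat n n"
      using c by (metis mult_carrier_mat)+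
    have "sqrt_iter n X (Suc (Suc k)) - ?B = (1 / 2) \<cdot>\<^sub>m (X + ?B * ?B) - (1 / 2) \<cdot>\<^sub>m (X + ?C * ?C)"
      by (rule arg_cong2[of _ _ _ _ "(-)"]; rule sqrt_iter.simps(2))
    also have "\<dots> = (1 / 2) \<cdot>\<^sub>m (P - Q)" if "P = ?B * ?B" "Q = ?C * ?C" for P Q
      unfolding that[symmetric] using c2[folded that] op_leD(1)[OF X]
      by (intro eq_matI) (auto simp: algebra_simps)
    finally show ?thesis by blast
  qed
  moreover have "op_le n ((1 / 2) \<cdot>\<^sub>m (?B * (?B - ?C) + (?B - ?C) * ?C))
      (1 / 2 * (b * (b ^ k * b) + (b ^ k * b) * b))"
    using b sqrt_iter_op_le[OF assms] Suc
    by (intro op_le_smult op_le_add op_le_mult) (auto simp del: sqrt_iter.simps)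
  ultimately show ?case by (simp add: algebra_simps)
qed

lemma sqrt_iter_convergent:
  assumes X: "op_le n X q" and q: "0 \<le> q" and b: "0 \<le> b" "b < 1" "q + b\<^sup>2 = 2 * b"
    and ij: "i < n" "j < n"
  shows "convergent (\<lambda>k. sqrt_iter n X k $$ (i, j))"
proof -
  note c = sqrt_iter_carrier[OF op_leD(1)[OF X]]
  let ?d = "\<lambda>k. sqrt_iter n X (Suc k) $$ (i, j) - sqrt_iter n X k $$ (i, j)"
  have "norm (?d k) \<le> b ^ k * b" for k
  proof -
    have "?d k = (sqrt_iter n X (Suc k) - sqrt_iter n X k) $$ (i, j)"
      using c[of k] c[of "Suc k"] ij by auto
    then show ?thesis using op_le_entry[OF sqrt_iter_diff_op_le[OF X q b(1,3)] ij, of k] by auto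
  qed
  moreover have "summable (\<lambda>k. b ^ k * b)"
    using b by (intro summable_mult2 summable_geometric) auto
  ultimately have "summable ?d" by (rule summable_comparison_test'[rotated])
  then have "convergent (\<lambda>k. \<Sum>m<k. ?d m)" by (simp add: summable_iff_convergent)
  moreover have "(\<Sum>m<k. ?d m) = sqrt_iter n X k $$ (i, j)" for k
    using ij by (subst sum_lessThan_telescope) simp
  ultimately show ?thesis by simp
qed

definition sqrt_approx :: "nat \<Rightarrow> real mat \<Rightarrow> nat \<Rightarrow> real mat" where
  "sqrt_approx n A k =
     sqrt (mat_bound A) \<cdot>\<^sub>m (1\<^sub>m n - sqrt_iter n (1\<^sub>m n - (1 / mat_bound A) \<cdot>\<^sub>m A) k)"

lemma sqrt_approx_tendsto_pd_root:
  assumes A: "pd_mat n A"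
  shows "\<exists>S. pd_mat n S \<and> S * S = A \<and> 
     (\<forall>i<n. \<forall>j<n. (\<lambda>k. sqrt_approx n A k $$ (i, j)) \<longlonglongrightarrow> S $$ (i, j))"
proof -
  note D = pd_matD[OF A]
  define c where "c = mat_bound A"
  have c: "c \<ge> 1" using mat_bound_ge_1 by (simp add: c_def)
  define X where "X = 1\<^sub>m n - (1 / c) \<cdot>\<^sub>m A"
  have Xc: "X \<in> carrier_mat n n" using D(1) by (auto simp: X_def)
  have "transpose_mat ((1 / c) \<cdot>\<^sub>m A) = (1 / c) \<cdot>\<^sub>m transpose_mat A" by (auto intro!: eq_matI)
  then have Xt: "transpose_mat X = X"
    using D(1,2) by (simp add: X_def transpose_minus[of _ n n])
  have Xw: "wnorm_sq X x = (vnorm x)\<^sup>2 - wnorm_sq A x / c" if x: "x \<in> carrier_vec n" for x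
  proof -
    have "X *\<^sub>v x = x - (1 / c) \<cdot>\<^sub>v (A *\<^sub>v x)"
      unfolding X_def using D(1) x
      by (subst minus_mult_distrib_mat_vec[of _ n n])
         (auto intro!: eq_vecI simp: scalar_prod_def sum_distrib_left mult_ac sum_divide_distrib)
    then show ?thesis
      using D(1) x by (simp add: wnorm_sq_def vnorm_sq scalar_prod_minus_distrib[of _ n])
  qed
  obtain m where m: "0 < m" "\<And>x. x \<in> carrier_vec n \<Longrightarrow> m * (vnorm x)\<^sup>2 \<le> wnorm_sq A x"
    using pd_lower_bound[OF A] by blast
  define q where "q = max 0 (1 - m / c)"
  have q: "0 \<le> q" "q < 1" using m c by (auto simp: q_def)
  have Xpsd: "psd_mat n X"
    unfolding psd_mat_def
  proof (intro conjI ballI Xc Xt)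
    fix x :: "real vec" assume x: "x \<in> carrier_vec n"
    have "wnorm_sq A x / c \<le> (vnorm x)\<^sup>2"
      using wnorm_sq_le_mat_bound[OF D(1) x] c by (simp add: c_def divide_le_eq mult.commute)
    then show "0 \<le> x \<bullet> (X *\<^sub>v x)" using Xw[OF x] by (simp add: wnorm_sq_def)
  qed
  have Xq: "wnorm_sq X x \<le> q * (vnorm x)\<^sup>2" if x: "x \<in> carrier_vec n" for x
  proof -
    have "wnorm_sq X x \<le> (vnorm x)\<^sup>2 - m * (vnorm x)\<^sup>2 / c"
      using Xw[OF x] divide_right_mono[OF m(2)[OF x], of c] c by simp
    also have "\<dots> = (1 - m / c) * (vnorm x)\<^sup>2" by (simp add: algebra_simps)
    also have "\<dots> \<le> q * (vnorm x)\<^sup>2" by (intro mult_right_mono) (auto simp: q_def)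
    finally show ?thesis .
  qed
  have Xop: "op_le n X q"
    unfolding op_le_def
  proof (intro conjI ballI Xc)
    fix x :: "real vec" assume x: "x \<in> carrier_vec n"
    have "(vnorm (X *\<^sub>v x))\<^sup>2 \<le> q * wnorm_sq X x"
      by (rule psd_vnorm_sq_le[OF Xpsd x Xq])
    also have "\<dots> \<le> q * (q * (vnorm x)\<^sup>2)" using Xq[OF x] q by (intro mult_left_mono) auto
    finally have "(vnorm (X *\<^sub>v x))\<^sup>2 \<le> (q * vnorm x)\<^sup>2" by (simp add: power2_eq_square mult_ac)
    then show "vnorm (X *\<^sub>v x) \<le> q * vnorm x" by (rule power2_le_imp_le) (use q in simp)
  qed
  define b where "b = 1 - sqrt (1 - q)"
  have b: "0 \<le> b" "b < 1" "q + b\<^sup>2 = 2 * b"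
    using q by (auto simp: b_def power2_diff)
  define Bk where "Bk = sqrt_iter n X"
  have Bk: "Bk k \<in> carrier_mat n n" "transpose_mat (Bk k) = Bk k" "op_le n (Bk k) b" for k
    using sqrt_iter_carrier[OF Xc] sqrt_iter_transpose[OF Xc Xt] sqrt_iter_op_le[OF Xop q(1) b(1,3)]
    by (auto simp: Bk_def)
  define B where "B = mat n n (\<lambda>(i, j). lim (\<lambda>k. Bk k $$ (i, j)))"
  have Bc: "B \<in> carrier_mat n n" by (simp add: B_def)
  have lim: "(\<lambda>k. Bk k $$ (i, j)) \<longlonglongrightarrow> B $$ (i, j)" if "i < n" "j < n" for i j
    using sqrt_iter_convergent[OF Xop q(1) b that] that
    by (simp add: B_def Bk_def convergent_LIMSEQ_iff)
  have Bt: "transpose_mat B = B"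
  proof (rule eq_matI)
    fix i j assume "i < dim_row B" "j < dim_col B"
    then have ij: "i < n" "j < n" using Bc by auto
    have "Bk k $$ (i, j) = Bk k $$ (j, i)" for k
      using Bk(1,2)[of k] ij by (metis carrier_matD index_transpose_mat(1))
    then have "B $$ (j, i) = B $$ (i, j)"
      using LIMSEQ_unique[OF lim[of i j]] lim[of j i] ij by simp
    then show "transpose_mat B $$ (i, j) = B $$ (i, j)" using ij Bc by simp
  qed (use Bc in auto)
  have Bfix: "2 * B $$ (i, j) = X $$ (i, j) + (B * B) $$ (i, j)" if ij: "i < n" "j < n" for i j
  proof (rule LIMSEQ_unique)
    show "(\<lambda>k. 2 * Bk (Suc k) $$ (i, j)) \<longlonglongrightarrow> 2 * B $$ (i, j)"
      by (intro tendsto_intros LIMSEQ_Suc[of "\<lambda>k. Bk k $$ (i, j)"] lim ij)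
    have "2 * Bk (Suc k) $$ (i, j) = X $$ (i, j) + (\<Sum>l<n. Bk k $$ (i, l) * Bk k $$ (l, j))" for k
      using ij Xc Bk(1)[of k] by (simp add: Bk_def scalar_prod_def atLeast0LessThan)
    moreover have "(\<lambda>k. X $$ (i, j) + (\<Sum>l<n. Bk k $$ (i, l) * Bk k $$ (l, j)))
      \<longlonglongrightarrow> X $$ (i, j) + (\<Sum>l<n. B $$ (i, l) * B $$ (l, j))"
      by (intro tendsto_intros lim ij) auto
    ultimately show "(\<lambda>k. 2 * Bk (Suc k) $$ (i, j)) \<longlonglongrightarrow> X $$ (i, j) + (B * B) $$ (i, j)"
      using ij Bc by (simp add: scalar_prod_def atLeast0LessThan)
  qed
  have Bw: "wnorm_sq B x \<le> b * (vnorm x)\<^sup>2" if x: "x \<in> carrier_vec n" for x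
  proof (rule LIMSEQ_le_const2)
    have e: "wnorm_sq C x = (\<Sum>i<n. \<Sum>j<n. x $ i * (C $$ (i, j) * x $ j))" if "C \<in> carrier_mat n n" for C
      using that x by (simp add: wnorm_sq_def scalar_prod_def atLeast0LessThan sum_distrib_left)
    show "(\<lambda>k. wnorm_sq (Bk k) x) \<longlonglongrightarrow> wnorm_sq B x"
      unfolding e[OF Bk(1)] e[OF Bc] by (intro tendsto_intros lim) auto
    have "wnorm_sq (Bk k) x \<le> b * (vnorm x)\<^sup>2" for k
    proof -
      have "wnorm_sq (Bk k) x \<le> vnorm x * vnorm (Bk k *\<^sub>v x)"
        using abs_scalar_prod_le_vnorm[of x n "Bk k *\<^sub>v x"] Bk(1)[of k] x
        by (auto simp: wnorm_sq_def)
      also have "\<dots> \<le> vnorm x * (b * vnorm x)"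
        by (intro mult_left_mono op_leD(2)[OF Bk(3)] x) auto
      finally show ?thesis by (simp add: power2_eq_square mult_ac)
    qed
    then show "\<exists>N. \<forall>k\<ge>N. wnorm_sq (Bk k) x \<le> b * (vnorm x)\<^sup>2" by blast
  qed
  define S where "S = sqrt c \<cdot>\<^sub>m (1\<^sub>m n - B)"
  have Sc: "S \<in> carrier_mat n n" using Bc by (auto simp: S_def)
  show ?thesis
  proof (intro exI[of _ S] conjI allI impI)
    show "pd_mat n S"
      unfolding pd_mat_def
    proof (intro conjI ballI impI Sc)
      have "B $$ (i, j) = B $$ (j, i)" if "i < n" "j < n" for i j
        using Bt Bc that by (metis carrier_matD index_transpose_mat(1))
      then show "transpose_mat S = S"
        using Bc by (auto simp: S_def intro!: eq_matI)
      fix x :: "real vec" assume x: "x \<in> carrier_vec n" "x \<noteq> 0\<^sub>v n"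
      have "S *\<^sub>v x = sqrt c \<cdot>\<^sub>v (x - B *\<^sub>v x)"
      proof -
        have "S *\<^sub>v x = sqrt c \<cdot>\<^sub>v ((1\<^sub>m n - B) *\<^sub>v x)"
          using x Bc by (auto intro!: eq_vecI simp: S_def scalar_prod_def sum_distrib_left mult_ac)
        then show ?thesis using x Bc by (simp add: minus_mult_distrib_mat_vec[of _ n n])
      qed
      then have "x \<bullet> (S *\<^sub>v x) = sqrt c * ((vnorm x)\<^sup>2 - wnorm_sq B x)"
        using x Bc by (simp add: vnorm_sq wnorm_sq_def scalar_prod_minus_distrib[of _ n])
      moreover have "wnorm_sq B x < (vnorm x)\<^sup>2"
      proof -
        have "0 < vnorm x" using vnorm_pos x by blast
        then have "b * (vnorm x)\<^sup>2 < 1 * (vnorm x)\<^sup>2" using b by (intro mult_strict_right_mono) auto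
        then show ?thesis using Bw[OF x(1)] by simp
      qed
      ultimately show "0 < x \<bullet> (S *\<^sub>v x)" using c by simp
    qed
    show "S * S = A"
    proof -
      have BB: "B * B \<in> carrier_mat n n" using Bc by auto
      have "S * S = c \<cdot>\<^sub>m ((1\<^sub>m n - B) * (1\<^sub>m n - B))"
      proof -
        have E: "1\<^sub>m n - B \<in> carrier_mat n n" using Bc by auto
        show ?thesis
          unfolding S_def mult_smult_assoc_mat[OF E smult_carrier_mat[OF E]] mult_smult_distrib[OF E E]
          using c by (intro eq_matI) (auto simp: mult.assoc[symmetric])
      qed
      also have "(1\<^sub>m n - B) * (1\<^sub>m n - B) = (1\<^sub>m n - B) - (B - B * B)"
        using Bc by (subst minus_mult_distrib_mat[of _ n n _ _ n])
           (auto simp: mult_minus_distrib_mat[of _ n n _ n])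
      also have "c \<cdot>\<^sub>m \<dots> = A"
      proof (rule eq_matI)
        fix i j assume "i < dim_row A" "j < dim_col A"
        then have ij: "i < n" "j < n" using D(1) by auto
        have "(c \<cdot>\<^sub>m (1\<^sub>m n - B - (B - P))) $$ (i, j)
            = c * (1\<^sub>m n $$ (i, j) - 2 * B $$ (i, j) + P $$ (i, j))" if "P \<in> carrier_mat n n" for P
          using ij Bc that by (simp add: algebra_simps)
        from this[OF BB] have "(c \<cdot>\<^sub>m (1\<^sub>m n - B - (B - B * B))) $$ (i, j)
            = c * (1\<^sub>m n $$ (i, j) - 2 * B $$ (i, j) + (B * B) $$ (i, j))" .
        also have "\<dots> = c * (1\<^sub>m n $$ (i, j) - X $$ (i, j))" using Bfix[OF ij] by simp
        also have "\<dots> = A $$ (i, j)" using ij D(1) c by (simp add: X_def)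
        finally show "(c \<cdot>\<^sub>m (1\<^sub>m n - B - (B - B * B))) $$ (i, j) = A $$ (i, j)" .
      qed (use D(1) Bc BB in auto)
      finally show ?thesis .
    qed
    fix i j assume ij: "i < n" "j < n"
    have "sqrt_approx n A k $$ (i, j) = sqrt c * (1\<^sub>m n $$ (i, j) - Bk k $$ (i, j))" for k
      using Bk(1)[of k] ij by (simp add: sqrt_approx_def c_def X_def Bk_def)
    moreover have "(\<lambda>k. sqrt c * (1\<^sub>m n $$ (i, j) - Bk k $$ (i, j))) \<longlonglongrightarrow> sqrt c * (1\<^sub>m n $$ (i, j) - B $$ (i, j))"
      by (intro tendsto_intros lim ij)
    ultimately show "(\<lambda>k. sqrt_approx n A k $$ (i, j)) \<longlonglongrightarrow> S $$ (i, j)"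
      using ij Bc by (simp add: S_def)
  qed
qed

lemma trace_mult_comm:
  fixes A B :: "real mat"
  assumes "A \<in> carrier_mat n n" "B \<in> carrier_mat n n"
  shows "(\<Sum>i<n. (A * B) $$ (i, i)) = (\<Sum>i<n. (B * A) $$ (i, i))"
proof -
  have "(\<Sum>i<n. (A * B) $$ (i, i)) = (\<Sum>i<n. \<Sum>j<n. A $$ (i, j) * B $$ (j, i))"
    using assms by (simp add: scalar_prod_def atLeast0LessThan)
  also have "\<dots> = (\<Sum>j<n. \<Sum>i<n. A $$ (i, j) * B $$ (j, i))" by (rule sum.swap)
  also have "\<dots> = (\<Sum>i<n. (B * A) $$ (i, i))"
    using assms by (simp add: scalar_prod_def atLeast0LessThan mult.commute)
  finally show ?thesis .
qed

text \<open>With \<open>D = S - R\<close> one has \<open>D S + R D = 0\<close>, so \<open>D S D\<close> and \<open>D R D\<close> have opposite traces,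
  although both are positive semidefinite.\<close>

lemma psd_root_unique:
  assumes S: "pd_mat n S" and R: "psd_mat n R" and eq: "R * R = S * S"
  shows "R = S"
proof -
  note DS = pd_matD[OF S] and DR = psd_matD[OF R]
  define D where "D = S - R"
  have Dc: "D \<in> carrier_mat n n" using DS DR by (auto simp: D_def)
  have Dt: "transpose_mat D = D"
    unfolding D_def using DS(1,2) DR(1,2) by (subst transpose_minus[of _ n n]) auto
  have SS: "S * S \<in> carrier_mat n n" "R * S \<in> carrier_mat n n" using DS DR by auto
  have "D * S = S * S - R * S" "R * D = R * S - R * R"
    using minus_mult_distrib_mat[OF DS(1) DR(1) DS(1)] mult_minus_distrib_mat[OF DR(1) DS(1) DR(1)]
    by (auto simp: D_def)
  moreover have "P - Q + (Q - P) = 0\<^sub>m n n" if "P \<in> carrier_mat n n" "Q \<in> carrier_mat n n" for P Q :: "real mat"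
    using that by (intro eq_matI) auto
  ultimately have 0: "D * S + R * D = 0\<^sub>m n n" using SS eq by simp
  have diag: "(D * Q * D) $$ (i, i) = wnorm_sq Q (col D i)" if "i < n" "Q \<in> carrier_mat n n" for Q i
  proof -
    have "(D * Q * D) $$ (i, i) = (D * (Q * D)) $$ (i, i)"
      using assoc_mult_mat[OF Dc that(2) Dc] by simp
    also have "\<dots> = row D i \<bullet> col (Q * D) i" using that Dc by simp
    also have "col (Q * D) i = Q *\<^sub>v col D i" using that Dc by (intro eq_vecI) auto
    also have "row D i = col D i" using Dt Dc that by (metis carrier_matD(2) row_transpose)
    finally show ?thesis by (simp add: wnorm_sq_def)
  qed
  have "0 = (\<Sum>i<n. ((D * S + R * D) * D) $$ (i, i))"
    unfolding 0 using Dc by simp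
  also have "(D * S + R * D) * D = D * S * D + (R * D) * D"
    using Dc DS(1) DR(1) by (simp add: add_mult_distrib_mat[of _ n n])
  also have "(\<Sum>i<n. (D * S * D + (R * D) * D) $$ (i, i)) =
      (\<Sum>i<n. (D * S * D) $$ (i, i)) + (\<Sum>i<n. ((R * D) * D) $$ (i, i))"
    using Dc DS(1) DR(1) by (simp add: sum.distrib)
  also have "(\<Sum>i<n. ((R * D) * D) $$ (i, i)) = (\<Sum>i<n. (D * (R * D)) $$ (i, i))"
    using Dc DR(1) by (intro trace_mult_comm) auto
  also have "D * (R * D) = D * R * D" using assoc_mult_mat[OF Dc DR(1) Dc] by simp
  also have "(\<Sum>i<n. (D * S * D) $$ (i, i)) + (\<Sum>i<n. (D * R * D) $$ (i, i)) =
      (\<Sum>i<n. wnorm_sq S (col D i)) + (\<Sum>i<n. wnorm_sq R (col D i))"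
    using DS(1) DR(1) by (auto intro!: arg_cong2[of _ _ _ _ "(+)"] sum.cong simp only: diag lessThan_iff)
  finally have "(\<Sum>i<n. wnorm_sq S (col D i)) + (\<Sum>i<n. wnorm_sq R (col D i)) = 0" by simp
  moreover have "0 \<le> (\<Sum>i<n. wnorm_sq R (col D i))"
    using Dc by (intro sum_nonneg DR(3)) auto
  moreover have nn: "0 \<le> wnorm_sq S (col D i)" if "i < n" for i
    using Dc that by (intro psd_matD(3)[OF pd_imp_psd[OF S]]) auto
  moreover have "0 \<le> (\<Sum>i<n. wnorm_sq S (col D i))" using nn by (intro sum_nonneg) auto
  ultimately have "(\<Sum>i<n. wnorm_sq S (col D i)) = 0" by linarith
  then have z: "wnorm_sq S (col D i) = 0" if "i < n" for i
    using nn that by (subst (asm) sum_nonneg_eq_0_iff) auto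
  have "col D i = 0\<^sub>v n" if "i < n" for i
  proof (rule ccontr)
    assume "col D i \<noteq> 0\<^sub>v n"
    moreover have "col D i \<in> carrier_vec n" using Dc by auto
    ultimately show False using DS(3) z[OF that] by force
  qed
  then have "D $$ (j, i) = 0" if "i < n" "j < n" for i j
    using that Dc by (metis carrier_matD index_col index_zero_vec(1))
  then show ?thesis
    using DS(1) DR(1) by (intro eq_matI) (auto simp: D_def)
qed

lemma pd_sqrt_mat:
  assumes A: "pd_mat n A"
  shows "pd_mat n (sqrt_mat n A)" "sqrt_mat n A * sqrt_mat n A = A"
    "\<And>i j. i < n \<Longrightarrow> j < n \<Longrightarrow> (\<lambda>k. sqrt_approx n A k $$ (i, j)) \<longlonglongrightarrow> sqrt_mat n A $$ (i, j)"
proof -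
  obtain S where S: "pd_mat n S" "S * S = A" 
     "\<forall>i<n. \<forall>j<n. (\<lambda>k. sqrt_approx n A k $$ (i, j)) \<longlonglongrightarrow> S $$ (i, j)"
    using sqrt_approx_tendsto_pd_root[OF A] by blast
  have "sqrt_mat n A = S"
    unfolding sqrt_mat_def
  proof (rule the_equality)
    show "psd_mat n S \<and> S * S = A" using S pd_imp_psd by blast
    show "R = S" if "psd_mat n R \<and> R * R = A" for R
      using psd_root_unique[OF S(1)] S(2) that by blast
  qed
  then show "pd_mat n (sqrt_mat n A)" "sqrt_mat n A * sqrt_mat n A = A"
    "\<And>i j. i < n \<Longrightarrow> j < n \<Longrightarrow> (\<lambda>k. sqrt_approx n A k $$ (i, j)) \<longlonglongrightarrow> sqrt_mat n A $$ (i, j)"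
    using S by auto
qed

subsection \<open>Covariance and precision matrices\<close>

lemma pd_sqrt_inv:
  assumes "pd_mat n A" and x: "x \<in> carrier_vec n"
  defines "S \<equiv> sqrt_mat n A" and "R \<equiv> inv_mat n (sqrt_mat n A)"
  shows "S *\<^sub>v (R *\<^sub>v x) = x" "wnorm_sq A (R *\<^sub>v x) = x \<bullet> x"
    "wnorm_sq (inv_mat n A) x = (R *\<^sub>v x) \<bullet> (R *\<^sub>v x)"
    "(vnorm (S *\<^sub>v x))\<^sup>2 = wnorm_sq A x"
proof -
  note S = pd_sqrt_mat(1,2)[OF assms(1), folded S_def]
  note DS = pd_matD[OF S(1)] and I = pd_inv_mat[OF S(1), folded S_def, unfolded S_def, folded R_def S_def]
  note Rt = inv_mat_transpose[OF S(1)]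
  have Rt': "transpose_mat R = R" using Rt by (simp add: R_def S_def)
  have SR: "S *\<^sub>v (R *\<^sub>v x) = x" if "x \<in> carrier_vec n" for x :: "real vec"
    using pd_inv_mat_mult_vec[OF S(1) that] by (simp add: R_def S_def)
  show "S *\<^sub>v (R *\<^sub>v x) = x" by (rule SR[OF x])
  have Rc: "R \<in> carrier_mat n n" using I by (simp add: R_def S_def)
  have Rx: "R *\<^sub>v x \<in> carrier_vec n" using Rc x by auto
  have nS: "(vnorm (S *\<^sub>v y))\<^sup>2 = wnorm_sq A y" if y: "y \<in> carrier_vec n" for y
  proof -
    have "wnorm_sq A y = y \<bullet> (S *\<^sub>v (S *\<^sub>v y))"
      unfolding wnorm_sq_def S(2)[symmetric] using DS(1) y by simp
    also have "\<dots> = (S *\<^sub>v y) \<bullet> (S *\<^sub>v y)"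
      using DS(1) y by (intro symmetric_scalar_prod_swap[OF DS(1,2)]) auto
    finally show ?thesis by (simp add: vnorm_sq)
  qed
  show "(vnorm (S *\<^sub>v x))\<^sup>2 = wnorm_sq A x" by (rule nS[OF x])
  show "wnorm_sq A (R *\<^sub>v x) = x \<bullet> x" using nS[OF Rx] SR[OF x] by (simp add: vnorm_sq)
  have i2: "R * S = 1\<^sub>m n" "S * R = 1\<^sub>m n"
    using pd_inv_mat[OF S(1)] by (simp_all add: R_def S_def)
  have "inv_mat n A = R * R"
  proof (rule inv_mat_eqI)
    show "A \<in> carrier_mat n n" using assms(1) pd_matD by blast
    show "R * R \<in> carrier_mat n n" using Rc by auto
    have "(S * S) * (R * R) = S * ((S * R) * R)"
      using DS(1) Rc by (simp add: assoc_mult_mat[of _ n n _ n _ n])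
    also have "\<dots> = 1\<^sub>m n" using i2 Rc by simp
    finally show "A * (R * R) = 1\<^sub>m n" using S(2) by simp
    have "(R * R) * (S * S) = R * ((R * S) * S)"
      using DS(1) Rc by (simp add: assoc_mult_mat[of _ n n _ n _ n])
    also have "\<dots> = 1\<^sub>m n" using i2 DS(1) by simp
    finally show "(R * R) * A = 1\<^sub>m n" using S(2) by simp
  qed
  then have "wnorm_sq (inv_mat n A) x = x \<bullet> (R *\<^sub>v (R *\<^sub>v x))"
    using Rc x by (simp add: wnorm_sq_def)
  also have "\<dots> = (R *\<^sub>v x) \<bullet> (R *\<^sub>v x)"
    by (rule symmetric_scalar_prod_swap[OF Rc Rt' x Rx])
  finally show "wnorm_sq (inv_mat n A) x = (R *\<^sub>v x) \<bullet> (R *\<^sub>v x)" .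
qed

lemma pd_sqrt_inv_props:
  assumes "pd_mat n A"
  shows "sqrt_mat n A \<in> carrier_mat n n" "inv_mat n (sqrt_mat n A) \<in> carrier_mat n n"
    "transpose_mat (inv_mat n (sqrt_mat n A)) = inv_mat n (sqrt_mat n A)"
  using pd_sqrt_mat(1)[OF assms] pd_matD pd_inv_mat inv_mat_transpose by blast+

lemma precision_ge_imp_covariance_le:
  assumes A: "pd_mat n A" and p: "0 < p"
    and le: "\<And>x. x \<in> carrier_vec n \<Longrightarrow> p * (vnorm x)\<^sup>2 \<le> wnorm_sq (inv_mat n A) x"
    and x: "x \<in> carrier_vec n"
  shows "wnorm_sq A x \<le> (vnorm x)\<^sup>2 / p"
proof -
  let ?y = "A *\<^sub>v x"
  have y: "?y \<in> carrier_vec n" using pd_matD[OF A] x by auto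
  have "wnorm_sq (inv_mat n A) ?y = wnorm_sq A x"
    using pd_inv_mat_mult_vec[OF A x] comm_scalar_prod[OF y x] by (simp add: wnorm_sq_def)
  then have 1: "p * (vnorm ?y)\<^sup>2 \<le> wnorm_sq A x" using le[OF y] by simp
  have 2: "wnorm_sq A x \<le> vnorm x * vnorm ?y"
    using abs_scalar_prod_le_vnorm[OF x y] by (simp add: wnorm_sq_def)
  have "p * vnorm ?y \<le> vnorm x"
  proof (cases "vnorm ?y = 0")
    case False
    then have "0 < vnorm ?y" using vnorm_nonneg[of ?y] by linarith
    moreover have "(p * vnorm ?y) * vnorm ?y \<le> vnorm x * vnorm ?y"
      using 1 2 by (simp add: power2_eq_square)
    ultimately show ?thesis by simp
  qed simp
  then have "vnorm x * (p * vnorm ?y) \<le> vnorm x * vnorm x" by (intro mult_left_mono) auto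
  then show ?thesis using 2 p by (simp add: power2_eq_square field_simps) (smt (verit) mult.commute mult_left_mono)
qed

lemma spec_norm_imp_precision_ge:
  assumes A: "pd_mat n A" and c: "0 < c" "c \<le> 1 / spec_norm n A" and x: "x \<in> carrier_vec n"
  shows "c * (vnorm x)\<^sup>2 \<le> wnorm_sq (inv_mat n A) x"
proof -
  let ?s = "spec_norm n A"
  have s: "0 < ?s" using c by (metis less_le_trans zero_less_divide_1_iff)
  have "bdd_above {vnorm (A *\<^sub>v x) | x. x \<in> carrier_vec n \<and> vnorm x = 1}"
    unfolding bdd_above_def
    using vnorm_mult_mat_vec_le_mat_bound[OF pd_matD(1)[OF A]] by (intro exI[of _ "mat_bound A"]) force
  then have unit: "vnorm (A *\<^sub>v x) \<le> ?s" if "x \<in> carrier_vec n" "vnorm x = 1" for x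
    unfolding spec_norm_def using that by (intro cSup_upper) auto
  have sv: "vnorm (A *\<^sub>v x) \<le> ?s * vnorm x" if x: "x \<in> carrier_vec n" for x
  proof (cases "vnorm x = 0")
    case True
    then show ?thesis using vnorm_mult_mat_vec_le_mat_bound[OF pd_matD(1)[OF A] x] by simp
  next
    case False
    then have pos: "0 < vnorm x" using vnorm_nonneg[of x] by linarith
    let ?u = "(1 / vnorm x) \<cdot>\<^sub>v x"
    have "vnorm (A *\<^sub>v ?u) \<le> ?s" using x pos by (intro unit) (auto simp: vnorm_smult)
    moreover have "A *\<^sub>v ?u = (1 / vnorm x) \<cdot>\<^sub>v (A *\<^sub>v x)" by (rule mult_mat_vec[OF pd_matD(1)[OF A] x])
    ultimately show ?thesis using pos by (simp add: vnorm_smult divide_le_eq)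
  qed
  have sw: "wnorm_sq A y \<le> ?s * (vnorm y)\<^sup>2" if y: "y \<in> carrier_vec n" for y
  proof -
    have "wnorm_sq A y \<le> vnorm y * vnorm (A *\<^sub>v y)"
      using abs_scalar_prod_le_vnorm[OF y, of "A *\<^sub>v y"] pd_matD[OF A] y by (simp add: wnorm_sq_def)
    also have "\<dots> \<le> vnorm y * (?s * vnorm y)" by (intro mult_left_mono sv y) auto
    finally show ?thesis by (simp add: power2_eq_square mult_ac)
  qed
  let ?y = "inv_mat n A *\<^sub>v x"
  have y: "?y \<in> carrier_vec n" using pd_inv_mat[OF A] x by auto
  have Ay: "A *\<^sub>v ?y = x" by (rule pd_inv_mat_mult_vec[OF A x])
  have "(vnorm x)\<^sup>2 \<le> ?s * wnorm_sq A ?y"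
    using psd_vnorm_sq_le[OF pd_imp_psd[OF A] y sw] Ay by simp
  also have "wnorm_sq A ?y = wnorm_sq (inv_mat n A) x"
    unfolding wnorm_sq_def Ay by (rule comm_scalar_prod[OF y x])
  finally have *: "(vnorm x)\<^sup>2 \<le> ?s * wnorm_sq (inv_mat n A) x" .
  have "c * (vnorm x)\<^sup>2 \<le> 1 / ?s * (vnorm x)\<^sup>2" using c by (intro mult_right_mono) auto
  also have "\<dots> \<le> wnorm_sq (inv_mat n A) x" using * s by (simp add: field_simps)
  finally show ?thesis .
qed

lemma psd_Young:
  assumes A: "psd_mat n A" and xy: "x \<in> carrier_vec n" "y \<in> carrier_vec n" and t: "0 < t"
  shows "wnorm_sq A (s \<cdot>\<^sub>v x + y) \<le> (1 + t) * s\<^sup>2 * wnorm_sq A x + (1 + 1 / t) * wnorm_sq A y"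
proof -
  note D = psd_matD[OF A]
  have e: "s \<cdot>\<^sub>v x + y = y - (- s) \<cdot>\<^sub>v x" using xy by (intro eq_vecI) auto
  have 1: "wnorm_sq A (s \<cdot>\<^sub>v x + y) = wnorm_sq A y + 2 * s * (x \<bullet> (A *\<^sub>v y)) + s\<^sup>2 * wnorm_sq A x"
    unfolding e wnorm_sq_diff[OF D(1,2) xy(2,1)] by simp
  have "0 \<le> wnorm_sq A (y - (s * t) \<cdot>\<^sub>v x)" using xy by (intro D(3)) auto
  also have "\<dots> = wnorm_sq A y - 2 * (s * t) * (x \<bullet> (A *\<^sub>v y)) + (s * t)\<^sup>2 * wnorm_sq A x"
    by (rule wnorm_sq_diff[OF D(1,2) xy(2,1)])
  finally have "2 * s * (x \<bullet> (A *\<^sub>v y)) \<le> wnorm_sq A y / t + t * s\<^sup>2 * wnorm_sq A x"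
    using t by (simp add: field_simps power2_eq_square)
  then show ?thesis unfolding 1 by (simp add: algebra_simps)
qed

lemma covariance_step_expand:
  assumes A: "pd_mat n A" and xv: "x \<in> carrier_vec n" "v \<in> carrier_vec n"
  shows "wnorm_sq (inv_mat n A) (x - b \<cdot>\<^sub>v (A *\<^sub>v v)) =
    wnorm_sq (inv_mat n A) x - 2 * b * (x \<bullet> v) + b\<^sup>2 * wnorm_sq A v"
proof -
  note P = pd_matD(1,2)[OF pd_inv_mat_pd[OF A]]
  have y: "A *\<^sub>v v \<in> carrier_vec n" using pd_matD[OF A] xv by auto
  have Px: "inv_mat n A *\<^sub>v x \<in> carrier_vec n" using P xv by auto
  have "(A *\<^sub>v v) \<bullet> (inv_mat n A *\<^sub>v x) = v \<bullet> (A *\<^sub>v (inv_mat n A *\<^sub>v x))"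
    using symmetric_scalar_prod_swap[OF pd_matD(1,2)[OF A] xv(2) Px] by simp
  also have "\<dots> = x \<bullet> v" using pd_inv_mat_mult_vec[OF A xv(1)] comm_scalar_prod[OF xv] by simp
  finally have 1: "(A *\<^sub>v v) \<bullet> (inv_mat n A *\<^sub>v x) = x \<bullet> v" .
  have "wnorm_sq (inv_mat n A) (A *\<^sub>v v) = wnorm_sq A v"
    using pd_inv_mat_mult_vec[OF A xv(2)] comm_scalar_prod[OF y xv(2)] by (simp add: wnorm_sq_def)
  then show ?thesis unfolding wnorm_sq_diff[OF P xv(1) y] 1 by simp
qed

lemma vnorm_sq_minus:
  assumes "x \<in> carrier_vec n" "y \<in> carrier_vec n"
  shows "(vnorm (x - y))\<^sup>2 = (vnorm x)\<^sup>2 - 2 * (x \<bullet> y) + (vnorm y)\<^sup>2"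
  using assms comm_scalar_prod[OF assms]
  by (simp add: vnorm_sq minus_scalar_prod_distrib[of _ n] scalar_prod_minus_distrib[of _ n])

lemma vnorm_sq_minus_le:
  assumes "x \<in> carrier_vec n" "y \<in> carrier_vec n" "0 < c"
  shows "(vnorm (x - y))\<^sup>2 \<le> (1 + c) * (vnorm x)\<^sup>2 + (1 + 1 / c) * (vnorm y)\<^sup>2"
proof -
  have "- (x \<bullet> y) \<le> vnorm x * vnorm y" using abs_scalar_prod_le_vnorm[OF assms(1,2)] by simp
  moreover have "2 * (vnorm x * vnorm y) \<le> c * (vnorm x)\<^sup>2 + (vnorm y)\<^sup>2 / c"
  proof -
    have "0 \<le> (c * vnorm x - vnorm y)\<^sup>2" by simp
    then show ?thesis using assms(3) by (simp add: field_simps power2_eq_square)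
  qed
  ultimately show ?thesis unfolding vnorm_sq_minus[OF assms(1,2)] by (simp add: algebra_simps)
qed

subsection \<open>Stacked vectors\<close>

lemma stack_carrier: "(\<And>k. 1 \<le> k \<Longrightarrow> k \<le> i \<Longrightarrow> x k \<in> carrier_vec d) \<Longrightarrow> stack x i \<in> carrier_vec (i * d)"
proof (induction i)
  case (Suc i)
  have "stack x i \<in> carrier_vec (i * d)" "x (Suc i) \<in> carrier_vec d" using Suc by auto
  then show ?case by (simp add: add.commute) (metis add.commute append_carrier_vec)
qed simp

lemma stack_cong: "(\<And>k. 1 \<le> k \<Longrightarrow> k \<le> i \<Longrightarrow> x k = y k) \<Longrightarrow> stack x i = stack y i"
  by (induction i) auto

lemma stack_index:
  assumes "\<And>k. 1 \<le> k \<Longrightarrow> k \<le> i \<Longrightarrow> x k \<in> carrier_vec d" "m < i * d"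
  shows "stack x i $ m = x (m div d + 1) $ (m mod d)"
  using assms
proof (induction i)
  case (Suc i)
  have c: "stack x i \<in> carrier_vec (i * d)" "x (Suc i) \<in> carrier_vec d" using Suc.prems by (auto intro: stack_carrier)
  have d: "0 < d" using Suc.prems(2) by (cases d) auto
  show ?case
  proof (cases "m < i * d")
    case True
    then show ?thesis using Suc c by simp
  next
    case False
    then have q: "m div d = i"
      using Suc.prems(2) d by (intro div_nat_eqI) (auto simp: mult.commute)
    then have "m mod d = m - i * d" by (simp add: modulo_nat_def)
    then show ?thesis using Suc.prems(2) c False q by auto
  qed
qed simp

lemma stack_of_vec:
  assumes "v \<in> carrier_vec (i * d)"
  shows "v = stack (\<lambda>k. vec d (\<lambda>l. v $ ((k - 1) * d + l))) i"
proof (rule eq_vecI)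
  have c: "stack (\<lambda>k. vec d (\<lambda>l. v $ ((k - 1) * d + l))) i \<in> carrier_vec (i * d)"
    by (rule stack_carrier) auto
  then show "dim_vec v = dim_vec (stack (\<lambda>k. vec d (\<lambda>l. v $ ((k - 1) * d + l))) i)"
    using assms by auto
  fix m assume "m < dim_vec (stack (\<lambda>k. vec d (\<lambda>l. v $ ((k - 1) * d + l))) i)"
  then have m: "m < i * d" using c by auto
  then have "0 < d" by (cases d) auto
  then show "v $ m = stack (\<lambda>k. vec d (\<lambda>l. v $ ((k - 1) * d + l))) i $ m"
    using m by (subst stack_index[where d = d]) auto
qed

lemma stack_minus:
  assumes "\<And>k. 1 \<le> k \<Longrightarrow> k \<le> i \<Longrightarrow> x k \<in> carrier_vec d \<and> y k \<in> carrier_vec d"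
  shows "stack (\<lambda>k. x k - y k) i = stack x i - stack y i"
proof (rule eq_vecI)
  have c: "stack x i \<in> carrier_vec (i * d)" "stack y i \<in> carrier_vec (i * d)"
    "stack (\<lambda>k. x k - y k) i \<in> carrier_vec (i * d)"
    using assms by (auto intro!: stack_carrier)
  then show "dim_vec (stack (\<lambda>k. x k - y k) i) = dim_vec (stack x i - stack y i)" by auto
  fix m assume "m < dim_vec (stack x i - stack y i)"
  then have m: "m < i * d" using c by auto
  then have d: "0 < d" by (cases d) auto
  have k: "1 \<le> m div d + 1" "m div d + 1 \<le> i" using m d by (auto simp: less_mult_imp_div_less Suc_le_eq)
  have dim: "dim_vec (x (Suc (m div d))) = d" "dim_vec (y (Suc (m div d))) = d" using assms[OF k] by auto
  show "stack (\<lambda>k. x k - y k) i $ m = (stack x i - stack y i) $ m"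
    using m c assms dim d by (auto simp: stack_index[where d = d])
qed

lemma stack_add:
  assumes "\<And>k. 1 \<le> k \<Longrightarrow> k \<le> i \<Longrightarrow> x k \<in> carrier_vec d \<and> y k \<in> carrier_vec d"
  shows "stack (\<lambda>k. x k + y k) i = stack x i + stack y i"
proof (rule eq_vecI)
  have c: "stack x i \<in> carrier_vec (i * d)" "stack y i \<in> carrier_vec (i * d)"
    "stack (\<lambda>k. x k + y k) i \<in> carrier_vec (i * d)"
    using assms by (auto intro!: stack_carrier)
  then show "dim_vec (stack (\<lambda>k. x k + y k) i) = dim_vec (stack x i + stack y i)" by auto
  fix m assume "m < dim_vec (stack x i + stack y i)"
  then have m: "m < i * d" using c by auto
  then have d: "0 < d" by (cases d) auto
  have k: "1 \<le> m div d + 1" "m div d + 1 \<le> i" using m d by (auto simp: less_mult_imp_div_less Suc_le_eq)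
  have dim: "dim_vec (x (Suc (m div d))) = d" "dim_vec (y (Suc (m div d))) = d" using assms[OF k] by auto
  show "stack (\<lambda>k. x k + y k) i $ m = (stack x i + stack y i) $ m"
    using m c assms dim d by (auto simp: stack_index[where d = d])
qed

lemma stack_scalar_prod:
  fixes x y :: "nat \<Rightarrow> real vec"
  assumes "\<And>k. 1 \<le> k \<Longrightarrow> k \<le> i \<Longrightarrow> x k \<in> carrier_vec d \<and> y k \<in> carrier_vec d"
  shows "stack x i \<bullet> stack y i = (\<Sum>k\<in>{1..i}. x k \<bullet> y k)"
  using assms
proof (induction i)
  case (Suc i)
  have "stack x (Suc i) \<bullet> stack y (Suc i) = stack x i \<bullet> stack y i + x (Suc i) \<bullet> y (Suc i)"
    using Suc.prems by (simp, intro scalar_prod_append[of _ "i * d" _ d]) (auto intro!: stack_carrier)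
  then show ?case using Suc by simp
qed (simp add: scalar_prod_def)

lemma vnorm_sq_stack:
  assumes "\<And>k. 1 \<le> k \<Longrightarrow> k \<le> i \<Longrightarrow> x k \<in> carrier_vec d"
  shows "(vnorm (stack x i))\<^sup>2 = (\<Sum>k\<in>{1..i}. (vnorm (x k))\<^sup>2)"
  unfolding vnorm_sq by (rule stack_scalar_prod) (use assms in auto)

lemma bdiag_carrier:
  "(\<And>k. 1 \<le> k \<Longrightarrow> k \<le> i \<Longrightarrow> S k \<in> carrier_mat d d) \<Longrightarrow> bdiag d S i \<in> carrier_mat (i * d) (i * d)"
proof (induction i)
  case (Suc i)
  have "bdiag d S i \<in> carrier_mat (i * d) (i * d)" "S (Suc i) \<in> carrier_mat d d" using Suc by auto
  then show ?case using four_block_carrier_mat[of "bdiag d S i" "i * d" "i * d" "S (Suc i)" d d]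
    by (simp add: add.commute)
qed simp

lemma bdiag_mult_stack:
  assumes "\<And>k. 1 \<le> k \<Longrightarrow> k \<le> i \<Longrightarrow> S k \<in> carrier_mat d d \<and> x k \<in> carrier_vec d"
  shows "bdiag d S i *\<^sub>v stack x i = stack (\<lambda>k. S k *\<^sub>v x k) i"
  using assms
proof (induction i)
  case (Suc i)
  have c: "bdiag d S i \<in> carrier_mat (i * d) (i * d)" "stack x i \<in> carrier_vec (i * d)"
      "S (Suc i) \<in> carrier_mat d d" "x (Suc i) \<in> carrier_vec d"
    using Suc.prems by (auto intro!: stack_carrier bdiag_carrier)
  have "bdiag d S (Suc i) *\<^sub>v stack x (Suc i) =
    (bdiag d S i *\<^sub>v stack x i + 0\<^sub>m (i * d) d *\<^sub>v x (Suc i)) @\<^sub>v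
      (0\<^sub>m d (i * d) *\<^sub>v stack x i + S (Suc i) *\<^sub>v x (Suc i))"
    using c by (simp, intro four_block_mat_mult_vec) auto
  also have "0\<^sub>m (i * d) d *\<^sub>v x (Suc i) = 0\<^sub>v (i * d)" using c by (intro eq_vecI) auto
  also have "0\<^sub>m d (i * d) *\<^sub>v stack x i = 0\<^sub>v d" using c by (intro eq_vecI) auto
  also have "bdiag d S i *\<^sub>v stack x i = stack (\<lambda>k. S k *\<^sub>v x k) i" using Suc by simp
  also have "\<dots> + 0\<^sub>v (i * d) = \<dots>"
    using Suc.prems by (intro right_zero_vec stack_carrier) (auto intro!: mult_mat_vec_carrier[of _ d d])
  finally show ?case using c by simp
qed (auto intro!: eq_vecI)

lemma vnorm_bdiag_le:
  assumes S: "\<And>k. 1 \<le> k \<Longrightarrow> k \<le> i \<Longrightarrow> S k \<in> carrier_mat d d" and r: "0 \<le> r"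
    and le: "\<And>k x. 1 \<le> k \<Longrightarrow> k \<le> i \<Longrightarrow> x \<in> carrier_vec d \<Longrightarrow> vnorm (S k *\<^sub>v x) \<le> r * vnorm x"
    and v: "v \<in> carrier_vec (i * d)"
  shows "vnorm (bdiag d S i *\<^sub>v v) \<le> r * vnorm v"
proof (rule power2_le_imp_le)
  define x where "x = (\<lambda>k. vec d (\<lambda>l. v $ ((k - 1) * d + l)))"
  have x: "x k \<in> carrier_vec d" for k by (simp add: x_def)
  have vx: "v = stack x i" using stack_of_vec[OF v] by (simp add: x_def)
  have "(vnorm (bdiag d S i *\<^sub>v v))\<^sup>2 = (\<Sum>k\<in>{1..i}. (vnorm (S k *\<^sub>v x k))\<^sup>2)"
  proof -
    have "bdiag d S i *\<^sub>v v = stack (\<lambda>k. S k *\<^sub>v x k) i"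
      unfolding vx using S x by (intro bdiag_mult_stack) auto
    then show ?thesis
      using S x by (auto intro!: vnorm_sq_stack[where d = d] mult_mat_vec_carrier[of _ d d] simp del: One_nat_def)
  qed
  also have "\<dots> \<le> (\<Sum>k\<in>{1..i}. (r * vnorm (x k))\<^sup>2)"
    using le x by (intro sum_mono power_mono) auto
  also have "\<dots> = (r * vnorm v)\<^sup>2"
    unfolding vx power_mult_distrib using x by (simp add: vnorm_sq_stack[where d = d] sum_distrib_left)
  finally show "(vnorm (bdiag d S i *\<^sub>v v))\<^sup>2 \<le> (r * vnorm v)\<^sup>2" .
qed (use r in simp)

subsection \<open>The scalar recursion\<close>

lemma cube_ge_tangent: "a ^ 3 + 3 * a\<^sup>2 * (x - a) \<le> x ^ 3" if "0 \<le> a" "0 \<le> x" for a x :: real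
proof -
  have "x ^ 3 - (a ^ 3 + 3 * a\<^sup>2 * (x - a)) = (x - a)\<^sup>2 * (x + 2 * a)"
    by (simp add: power2_eq_square power3_eq_cube algebra_simps)
  also have "\<dots> \<ge> 0" using that by simp
  finally show ?thesis by simp
qed

lemma sqrt_Suc_diff_ge: "1 / (2 * sqrt (x + 1)) \<le> sqrt (x + 1) - sqrt x" if "0 \<le> x" for x :: real
proof -
  have p: "0 < sqrt (x + 1)" using that by simp
  have "1 = (sqrt (x + 1) - sqrt x) * (sqrt (x + 1) + sqrt x)"
    using that by (simp add: algebra_simps)
  also have "\<dots> \<le> (sqrt (x + 1) - sqrt x) * (2 * sqrt (x + 1))"
    using that by (intro mult_left_mono) auto
  finally show ?thesis using p by (simp add: field_simps)
qed

lemma descent_weight_bound: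
  fixes t :: nat assumes t: "2 \<le> t"
  shows "7 / 8 * (sqrt (real t + 1) / sqrt (real t) - 1) +
    3 / 2 * real t / (sqrt (real t + 1) * (real t * sqrt (real t) + 3)) \<le> 1 / 2"
proof (cases "t = 2")
  case True
  have s2: "1.4142 \<le> sqrt 2" by (rule real_le_rsqrt) (simp add: power2_eq_square)
  have s3: "1.732 \<le> sqrt 3" by (rule real_le_rsqrt) (simp add: power2_eq_square)
  have "sqrt 3 / sqrt 2 = sqrt (3 / 2)" by (simp add: real_sqrt_divide)
  also have "\<dots> \<le> 1.2248" by (rule real_le_lsqrt) (simp_all add: power2_eq_square)
  finally have a: "sqrt 3 / sqrt 2 \<le> 1.2248" .
  have "1.732 * (2 * 1.4142 + 3) \<le> sqrt 3 * (2 * sqrt 2 + 3)" using s2 s3 by (intro mult_mono) auto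
  then have "3 / (sqrt 3 * (2 * sqrt 2 + 3)) \<le> 3 / (1.732 * (2 * 1.4142 + 3))"
    by (intro divide_left_mono) auto
  then have b: "3 / (sqrt 3 * (2 * sqrt 2 + 3)) \<le> 0.2973" by simp
  have fin: "7 / 8 * (A - 1) + C \<le> 1 / 2" if "A \<le> 1.2248" "C \<le> 0.2973" for A C :: real
    using that by (simp add: field_simps)
  have eqs: "sqrt (real t + 1) / sqrt (real t) = sqrt 3 / sqrt 2"
    "3 / 2 * real t / (sqrt (real t + 1) * (real t * sqrt (real t) + 3)) = 3 / (sqrt 3 * (2 * sqrt 2 + 3))"
    using True by simp_all
  show ?thesis unfolding eqs by (rule fin[OF a b])
next
  case False
  then have t3: "3 \<le> real t" using t by simp
  define x where "x = sqrt (real t)"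
  have x2: "x\<^sup>2 = real t" by (simp add: x_def)
  have x: "1.7 \<le> x" unfolding x_def using t3 by (intro real_le_rsqrt) (simp add: power2_eq_square)
  have "sqrt (real t + 1) / sqrt (real t) = sqrt (1 + 1 / real t)"
    using t3 by (simp add: real_sqrt_divide[symmetric] field_simps)
  also have "\<dots> \<le> 1 + 1 / (2 * real t)"
    using t3 by (intro real_le_lsqrt) (simp_all add: power2_eq_square field_simps)
  also have "\<dots> \<le> 1 + 1 / 6" using t3 by (simp add: field_simps)
  finally have a: "sqrt (real t + 1) / sqrt (real t) - 1 \<le> 1 / 6" by simp
  have "3 / 2 * real t / (sqrt (real t + 1) * (real t * sqrt (real t) + 3)) \<le>
      3 / 2 * real t / (x * (x ^ 3 + 3))"
  proof (rule divide_left_mono)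
    show "x * (x ^ 3 + 3) \<le> sqrt (real t + 1) * (real t * sqrt (real t) + 3)"
    proof (rule mult_mono)
      show "x \<le> sqrt (real t + 1)" by (simp add: x_def)
      show "x ^ 3 + 3 \<le> real t * sqrt (real t) + 3" by (simp add: x_def power3_eq_cube)
    qed (use x in auto)
    have "0 < sqrt (real t + 1) * (real t * sqrt (real t) + 3)"
      by (intro mult_pos_pos add_nonneg_pos) auto
    moreover have "0 < x * (x ^ 3 + 3)" using x by (intro mult_pos_pos add_pos_pos) auto
    ultimately show "0 < sqrt (real t + 1) * (real t * sqrt (real t) + 3) * (x * (x ^ 3 + 3))"
      by (rule mult_pos_pos)
  qed simp
  also have "\<dots> = 3 / 2 * x / (x ^ 3 + 3)"
    using x by (simp add: x2[symmetric] power2_eq_square)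
  also have "\<dots> \<le> 7 / 20"
  proof -
    have "0 < x ^ 3 + 3" using x by (intro add_pos_pos) auto
    moreover have "1.7 ^ 3 + 3 * 1.7\<^sup>2 * (x - 1.7) \<le> x ^ 3" using x by (intro cube_ge_tangent) auto
    then have "867 / 100 * x - 9826 / 1000 \<le> x ^ 3" by (simp add: power2_eq_square power3_eq_cube field_simps)
    then have "3 / 2 * x \<le> 7 / 20 * (x ^ 3 + 3)" using x by (simp add: field_simps)
    ultimately show ?thesis by (simp add: pos_divide_le_eq)
  qed
  finally have b: "3 / 2 * real t / (sqrt (real t + 1) * (real t * sqrt (real t) + 3)) \<le> 7 / 20" .
  have "7 / 8 * A + C \<le> 1 / 2" if "A \<le> 1 / 6" "C \<le> 7 / 20" for A C :: real
    using that by (simp add: field_simps)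
  from this[OF a b] show ?thesis .
qed

text \<open>The Young parameter \<open>th t\<close> is chosen such that \<open>h t\<close> enters with weight exactly
  \<open>3 beta / (2 an sqrt t)\<close>; this spends the whole surplus \<open>+ 1\<close> in \<open>lam t\<close> and leaves just enough
  room at \<open>t = 2\<close> to absorb the \<open>Mm\<close>-part of \<open>D t\<close>. The precision update \<open>V\<close> stops before \<open>T\<close>, so
  that no uncompensated \<open>D\<close>-term survives at the end.\<close>

lemma descent_telescope:
  fixes V W D Mm G h :: "nat \<Rightarrow> real" and beta an B :: real and T :: nat
  defines "b \<equiv> \<lambda>t. real t * beta" and "g \<equiv> \<lambda>t. an / (beta * sqrt (real t + 1))"
    and "lam \<equiv> \<lambda>t. 1 / (an * (2 / 3 * (real t * sqrt (real t)) + 1))"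
    and "th \<equiv> \<lambda>t. real t * sqrt (real t) / (real t * sqrt (real t) + 3)"
  assumes T: "1 \<le> T" and pos: "0 < beta" "0 < an" "0 \<le> B"
    and nn: "\<And>t. 0 \<le> Mm t" "\<And>t. 0 \<le> D t" "0 \<le> W T"
    and D: "\<And>t. t \<in> {1..T} \<Longrightarrow> D t \<le> 7 / 4 * Mm t + 7 / 3 * B"
    and step: "\<And>t. t \<in> {1..T} \<Longrightarrow> W t \<le> V t - 2 * b t * G t - b t * g t * (Mm t + D t - B) +
      (b t)\<^sup>2 * ((1 + th t) * (g t)\<^sup>2 * lam t * Mm t + (1 + 1 / th t) * lam t * h t)"
    and V: "\<And>t. t \<in> {1..<T} \<Longrightarrow> V (t + 1) / b (t + 1) \<le> W t / b t + g t * D (t + 1)"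
  shows "(\<Sum>t\<in>{1..T}. G t) \<le> V 1 / (2 * beta) +
    (\<Sum>t\<in>{1..T}. 3 * beta / (2 * an) * (h t / sqrt (real t))) + sqrt (real T + 2) * (an * B / beta)"
proof -
  define c where "c = (\<lambda>t. 3 * beta / (2 * an) * (h t / sqrt (real t)))"
  define q where "q = (\<lambda>t::nat. 3 / 2 * real t / (sqrt (real t + 1) * (real t * sqrt (real t) + 3)))"
  have bp: "0 < b t" if "1 \<le> t" for t using that pos by (simp add: b_def)
  have gp: "0 < g t" for t using pos by (simp add: g_def)
  have one: "G t + W t / (2 * b t) \<le> V t / (2 * b t) - g t / 2 * (D t - B) - (1 / 2 - q t) * g t * Mm t + c t"
    if t: "t \<in> {1..T}" for t
  proof -
    have t1: "1 \<le> t" using t by simp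
    define x where "x = sqrt (real t)"
    have x: "0 < x" using t1 by (simp add: x_def)
    have tx: "real t = x\<^sup>2" by (simp add: x_def)
    have tx3: "real t * sqrt (real t) = x ^ 3" by (simp add: x_def power3_eq_cube)
    have xp: "0 < x ^ 3" "0 < x ^ 3 + 3" "0 < 2 * x ^ 3 + 3" using x by (auto intro!: add_pos_pos)
    have th1: "1 + th t = (2 * x ^ 3 + 3) / (x ^ 3 + 3)"
      using xp unfolding th_def tx3 by (simp add: add_divide_eq_if_simps)
    have th2: "1 + 1 / th t = (2 * x ^ 3 + 3) / x ^ 3"
      using xp unfolding th_def tx3 by (simp add: add_divide_eq_if_simps)
    have lamx: "lam t = 3 / (an * (2 * x ^ 3 + 3))"
      using xp pos unfolding lam_def tx3 by (simp add: divide_simps)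
    have k1: "b t / 2 * ((1 + th t) * (g t)\<^sup>2 * lam t) = q t * g t"
    proof -
      have bg: "b t * g t = real t * an / sqrt (real t + 1)"
        using pos unfolding b_def g_def by simp
      have alg: "X * an / Y * (P / Q) * (3 / (an * P)) = 2 * (3 / 2 * X / (Y * Q))"
        if "0 < P" "0 < Q" "0 < Y" for X Y P Q :: real
        using that pos by (simp add: mult.commute)
      have "0 < sqrt (real t + 1)" by (simp add: add_nonneg_pos)
      then have "b t * g t * (1 + th t) * lam t = 2 * q t"
        unfolding th1 lamx q_def tx3 bg by (rule alg[OF xp(3,2)])
      moreover have "b t / 2 * ((1 + th t) * (g t)\<^sup>2 * lam t) = g t / 2 * (b t * g t * (1 + th t) * lam t)"
        by (simp add: power2_eq_square mult_ac)
      ultimately show ?thesis by simp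
    qed
    have k2: "b t / 2 * ((1 + 1 / th t) * lam t * h t) = c t"
    proof -
      have alg: "Y * beta / 2 * (P / (Y * x) * (3 / (an * P)) * H) = 3 * beta / (2 * an) * (H / x)"
        if "0 < P" "0 < Y" for P Y H :: real
        using that pos x by (simp add: mult_ac)
      have "x ^ 3 = real t * x" by (simp add: tx power2_eq_square power3_eq_cube)
      then have th2': "1 + 1 / th t = (2 * x ^ 3 + 3) / (real t * x)" using th2 by simp
      show ?thesis
        unfolding th2' lamx c_def b_def x_def[symmetric] using t1 by (intro alg xp) simp
    qed
    have "W t / (2 * b t) \<le> (V t - 2 * b t * G t - b t * g t * (Mm t + D t - B) +
      (b t)\<^sup>2 * ((1 + th t) * (g t)\<^sup>2 * lam t * Mm t + (1 + 1 / th t) * lam t * h t)) / (2 * b t)"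
      using step[OF t] bp[OF t1] by (intro divide_right_mono) auto
    also have "\<dots> = V t / (2 * b t) - G t - g t / 2 * (Mm t + D t - B) +
        b t / 2 * ((1 + th t) * (g t)\<^sup>2 * lam t) * Mm t + b t / 2 * ((1 + 1 / th t) * lam t * h t)"
      using bp[OF t1] by (simp add: field_simps power2_eq_square)
    also have "\<dots> = V t / (2 * b t) - G t - g t / 2 * (Mm t + D t - B) + q t * g t * Mm t + c t"
      unfolding k1 k2 ..
    finally show ?thesis by (simp add: algebra_simps add_divide_distrib diff_divide_distrib)
  qed
  define e where "e = (\<lambda>t::nat. an / beta * (sqrt (real t + 1) - 1 + 7 / 6 * (1 / sqrt 2 - 1 / sqrt (real t + 1))))"
  have main: "(\<Sum>t\<in>{1..n}. G t) + W n / (2 * b n) \<le> V 1 / (2 * beta) + (\<Sum>t\<in>{1..n}. c t) + e n * B"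
    if "1 \<le> n" "n \<le> T" for n
    using that
  proof (induction n rule: nat_induct_at_least)
    case base
    have s2: "1.4 \<le> sqrt 2" by (rule real_le_rsqrt) (simp add: power2_eq_square)
    have "q 1 = 3 / 8 * (1 / sqrt 2)" by (simp add: q_def)
    also have "\<dots> \<le> 1 / 2" using s2 by (simp add: field_simps)
    finally have q1: "0 \<le> (1 / 2 - q 1) * g 1 * Mm 1" using gp[of 1] nn by simp
    have "sqrt 2 \<le> 1.5" by (rule real_le_lsqrt) (simp_all add: power2_eq_square)
    then have "1 / (2 * sqrt 2) \<le> sqrt 2 - 1" using s2 by (simp add: field_simps)
    then have "g 1 / 2 \<le> e 1"
      unfolding g_def e_def using pos mult_left_mono[of "1 / (2 * sqrt 2)" "sqrt 2 - 1" "an / beta"]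
      by (simp add: field_simps)
    then have "g 1 / 2 * B \<le> e 1 * B" using pos by (intro mult_right_mono) auto
    moreover have "0 \<le> g 1 * D 1" using gp[of 1] nn by simp
    moreover have "b 1 = beta" by (simp add: b_def)
    ultimately show ?case using one[of 1] T q1 by (simp add: algebra_simps add_divide_distrib diff_divide_distrib)
  next
    case (Suc n)
    let ?t = "Suc n"
    have t: "?t \<in> {1..T}" "n \<in> {1..<T}" "2 \<le> ?t" using Suc by auto
    have IH: "(\<Sum>t\<in>{1..n}. G t) + W n / (2 * b n) \<le> V 1 / (2 * beta) + (\<Sum>t\<in>{1..n}. c t) + e n * B"
      using Suc by simp
    have v: "V ?t / (2 * b ?t) \<le> W n / (2 * b n) + g n / 2 * D ?t"
      using V[OF t(2)] by simp
    define G1 where "G1 = g n - g ?t"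
    have gn: "g n = an / beta / sqrt (real n + 1)" "g ?t = an / beta / sqrt (real n + 2)"
      by (auto simp: g_def add.commute)
    have G1: "0 \<le> G1" unfolding G1_def gn using pos by (simp add: divide_left_mono)
    have Dle: "G1 / 2 * D ?t \<le> G1 / 2 * (7 / 4 * Mm ?t + 7 / 3 * B)"
      using D[OF t(1)] G1 by (intro mult_left_mono) auto
    have "7 / 8 * G1 + q ?t * g ?t \<le> g ?t / 2"
    proof -
      have "g n = g ?t * (sqrt (real ?t + 1) / sqrt (real ?t))"
        unfolding gn by (simp add: add.commute)
      then have "7 / 8 * G1 + q ?t * g ?t = g ?t * (7 / 8 * (sqrt (real ?t + 1) / sqrt (real ?t) - 1) + q ?t)"
        unfolding G1_def by (simp add: algebra_simps add_divide_distrib diff_divide_distrib)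
      also have "\<dots> \<le> g ?t * (1 / 2)"
        using descent_weight_bound[OF t(3)] gp[of ?t] unfolding q_def by (intro mult_left_mono) auto
      finally show ?thesis by simp
    qed
    then have m: "(7 / 8 * G1 + q ?t * g ?t) * Mm ?t \<le> g ?t / 2 * Mm ?t" using nn by (intro mult_right_mono) auto
    have "e n + g ?t / 2 + 7 / 6 * G1 \<le> e ?t"
    proof -
      have "1 / (2 * sqrt (real n + 1 + 1)) \<le> sqrt (real n + 1 + 1) - sqrt (real n + 1)"
        by (rule sqrt_Suc_diff_ge) simp
      then have "an / beta * (1 / (2 * sqrt (real n + 2))) \<le> an / beta * (sqrt (real n + 2) - sqrt (real n + 1))"
        using pos by (intro mult_left_mono) (auto simp: add.assoc)
      then show ?thesis unfolding e_def G1_def gn by (simp add: algebra_simps add_divide_distrib diff_divide_distrib)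
    qed
    then have ee: "(e n + g ?t / 2 + 7 / 6 * G1) * B \<le> e ?t * B" using pos by (intro mult_right_mono) auto
    have "(\<Sum>t\<in>{1..?t}. G t) + W ?t / (2 * b ?t) \<le>
      V 1 / (2 * beta) + (\<Sum>t\<in>{1..n}. c t) + e n * B + (G1 / 2 * D ?t + g ?t / 2 * B
        - (1 / 2 - q ?t) * g ?t * Mm ?t + c ?t)"
      using IH v one[OF t(1)] unfolding G1_def by (simp add: algebra_simps add_divide_distrib diff_divide_distrib)
    also have "\<dots> \<le> V 1 / (2 * beta) + (\<Sum>t\<in>{1..?t}. c t) + e ?t * B"
      using Dle m ee by (simp add: algebra_simps add_divide_distrib diff_divide_distrib)
    finally show ?case .
  qed
  have "e T * B \<le> sqrt (real T + 2) * (an * B / beta)"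
  proof -
    have "sqrt 2 \<ge> 1.2" by (rule real_le_rsqrt) (simp add: power2_eq_square)
    then have "7 / 6 * (1 / sqrt 2) \<le> 1" by (simp add: field_simps)
    moreover have "0 \<le> 7 / 6 * (1 / sqrt (real T + 1))" by simp
    moreover have "sqrt (real T + 1) \<le> sqrt (real T + 2)" by simp
    ultimately have "sqrt (real T + 1) - 1 + 7 / 6 * (1 / sqrt 2 - 1 / sqrt (real T + 1)) \<le> sqrt (real T + 2)"
      unfolding right_diff_distrib by linarith
    then have "an / beta * (sqrt (real T + 1) - 1 + 7 / 6 * (1 / sqrt 2 - 1 / sqrt (real T + 1))) * B
      \<le> an / beta * sqrt (real T + 2) * B" using pos by (intro mult_right_mono mult_left_mono) auto
    then show ?thesis by (simp add: e_def mult_ac)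
  qed
  moreover have "0 \<le> W T / (2 * b T)" using nn bp[OF T] by simp
  ultimately show ?thesis using main[OF T order_refl] unfolding c_def by linarith
qed

subsection \<open>One iteration\<close>

lemma sum_triangle_swap:
  fixes F :: "nat \<Rightarrow> nat \<Rightarrow> 'a::comm_monoid_add"
  shows "(\<Sum>k\<in>{1..K}. \<Sum>i\<in>{k..K}. F k i) = (\<Sum>i\<in>{1..K}. \<Sum>k\<in>{1..i}. F k i)"
proof -
  have "(\<Sum>k\<in>{1..K}. \<Sum>i\<in>{k..K}. F k i) = (\<Sum>k\<in>{1..K}. \<Sum>i | i \<in> {1..K} \<and> k \<le> i. F k i)"
    by (intro sum.cong) auto
  also have "\<dots> = (\<Sum>i\<in>{1..K}. \<Sum>k | k \<in> {1..K} \<and> k \<le> i. F k i)"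
    by (rule sum.swap_restrict) auto
  also have "\<dots> = (\<Sum>i\<in>{1..K}. \<Sum>k\<in>{1..i}. F k i)"
    by (intro sum.cong) auto
  finally show ?thesis .
qed

lemma smult_mat_mult_vec:
  fixes A :: "real mat"
  assumes "A \<in> carrier_mat n m" "y \<in> carrier_vec m"
  shows "(c \<cdot>\<^sub>m A) *\<^sub>v y = c \<cdot>\<^sub>v (A *\<^sub>v y)"
  using assms by (intro eq_vecI) (auto simp: scalar_prod_def sum_distrib_left mult_ac)

locale casbo_iterate =
  fixes d K N :: nat and f :: "nat \<Rightarrow> real vec \<Rightarrow> real" and L :: "nat \<Rightarrow> real"
    and mu :: "nat \<Rightarrow> real vec" and Sig :: "nat \<Rightarrow> real mat" and zt :: "nat \<Rightarrow> nat \<Rightarrow> real vec"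
    and p :: real
  assumes N: "1 \<le> N"
    and lip: "\<And>i. i \<in> {1..K} \<Longrightarrow> lipschitz_vec (i * d) (f i) (L i) \<and> 0 \<le> L i"
    and mu: "\<And>k. k \<in> {1..K} \<Longrightarrow> mu k \<in> carrier_vec d"
    and Sig: "\<And>k. k \<in> {1..K} \<Longrightarrow> pd_mat d (Sig k)"
    and p: "0 < p"
    and prec: "\<And>k x. k \<in> {1..K} \<Longrightarrow> x \<in> carrier_vec d \<Longrightarrow> p * (vnorm x)\<^sup>2 \<le> wnorm_sq (inv_mat d (Sig k)) x"
    and zt: "\<And>k j. zt k j \<in> carrier_vec d"
begin

abbreviation "R k \<equiv> inv_mat d (sqrt_mat d (Sig k))"
abbreviation "Dm i \<equiv> bdiag d (\<lambda>k. sqrt_mat d (Sig k)) i"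
abbreviation "zbar i j \<equiv> stack (\<lambda>k. zt k j) i"

definition Del :: "nat \<Rightarrow> nat \<Rightarrow> real" where
  "Del i j = f i (stack mu i + Dm i *\<^sub>v zbar i j) - f i (stack mu i)"

definition u :: "nat \<Rightarrow> real vec" where
  "u k = vec d (\<lambda>l. \<Sum>i\<in>{k..K}. 1 / real N * (\<Sum>j\<in>{1..N}. Del i j * zt k j $ l))"

lemma zt_dim: "dim_vec (zt k j) = d"
  using zt[of k j] by simp

lemma S_carrier: "k \<in> {1..K} \<Longrightarrow> sqrt_mat d (Sig k) \<in> carrier_mat d d"
  and R_carrier: "k \<in> {1..K} \<Longrightarrow> R k \<in> carrier_mat d d"
  using pd_sqrt_inv_props[OF Sig] by blast+

lemma Dm_carrier: "i \<in> {1..K} \<Longrightarrow> Dm i \<in> carrier_mat (i * d) (i * d)"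
  using S_carrier by (intro bdiag_carrier) auto

lemma zbar_carrier: "zbar i j \<in> carrier_vec (i * d)"
  using zt by (intro stack_carrier) auto

lemma stack_mu_carrier: "i \<in> {1..K} \<Longrightarrow> stack mu i \<in> carrier_vec (i * d)"
  using mu by (intro stack_carrier) auto

lemma stack_casbo_x:
  assumes "i \<in> {1..K}"
  shows "stack (\<lambda>m. casbo_x d mu Sig zt m j) i = stack mu i + Dm i *\<^sub>v zbar i j"
proof -
  have k: "k \<in> {1..K}" if "1 \<le> k" "k \<le> i" for k using that assms by auto
  have "stack (\<lambda>m. casbo_x d mu Sig zt m j) i = stack mu i + stack (\<lambda>k. sqrt_mat d (Sig k) *\<^sub>v zt k j) i"
    unfolding casbo_x_def using mu[OF k] S_carrier[OF k] zt
    by (intro stack_add[where d = d]) (auto intro!: mult_mat_vec_carrier[of _ d d])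
  also have "stack (\<lambda>k. sqrt_mat d (Sig k) *\<^sub>v zt k j) i = Dm i *\<^sub>v zbar i j"
    using S_carrier[OF k] zt by (intro bdiag_mult_stack[symmetric]) auto
  finally show ?thesis .
qed

lemma ghat_sum:
  assumes k: "k \<in> {1..K}"
  shows "vsum d (\<lambda>i. casbo_ghat d N f mu Sig zt i k) {k..K} = R k *\<^sub>v u k"
proof (rule eq_vecI)
  show "dim_vec (vsum d (\<lambda>i. casbo_ghat d N f mu Sig zt i k) {k..K}) = dim_vec (R k *\<^sub>v u k)"
    using R_carrier[OF k] by (simp add: vsum_def)
  fix l assume "l < dim_vec (R k *\<^sub>v u k)"
  then have l: "l < d" using R_carrier[OF k] by simp
  have g: "casbo_ghat d N f mu Sig zt i k $ l =
      1 / real N * (\<Sum>j\<in>{1..N}. Del i j * (\<Sum>m<d. R k $$ (l, m) * zt k j $ m))" if i: "i \<in> {k..K}" for i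
  proof -
    have "i \<in> {1..K}" using i k by auto
    then show ?thesis
      using l R_carrier[OF k]
      by (simp add: zt_dim casbo_ghat_def vsum_def stack_casbo_x Del_def scalar_prod_def atLeast0LessThan)
  qed
  have "(R k *\<^sub>v u k) $ l = (\<Sum>m<d. R k $$ (l, m) * (\<Sum>i\<in>{k..K}. 1 / real N * (\<Sum>j\<in>{1..N}. Del i j * zt k j $ m)))"
    using l R_carrier[OF k] by (simp add: u_def scalar_prod_def atLeast0LessThan)
  also have "\<dots> = (\<Sum>m<d. \<Sum>i\<in>{k..K}. \<Sum>j\<in>{1..N}. 1 / real N * (Del i j * (R k $$ (l, m) * zt k j $ m)))"
    by (simp add: sum_distrib_left mult_ac)
  also have "\<dots> = (\<Sum>i\<in>{k..K}. \<Sum>m<d. \<Sum>j\<in>{1..N}. 1 / real N * (Del i j * (R k $$ (l, m) * zt k j $ m)))"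
    by (rule sum.swap)
  also have "\<dots> = (\<Sum>i\<in>{k..K}. \<Sum>j\<in>{1..N}. \<Sum>m<d. 1 / real N * (Del i j * (R k $$ (l, m) * zt k j $ m)))"
    by (intro sum.cong refl sum.swap)
  also have "\<dots> = (\<Sum>i\<in>{k..K}. 1 / real N * (\<Sum>j\<in>{1..N}. Del i j * (\<Sum>m<d. R k $$ (l, m) * zt k j $ m)))"
    by (simp add: sum_distrib_left)
  also have "\<dots> = vsum d (\<lambda>i. casbo_ghat d N f mu Sig zt i k) {k..K} $ l"
    using l g by (simp add: vsum_def)
  finally show "vsum d (\<lambda>i. casbo_ghat d N f mu Sig zt i k) {k..K} $ l = (R k *\<^sub>v u k) $ l" by simp
qed

lemma u_carrier: "u k \<in> carrier_vec d" by (simp add: u_def)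

lemma sum_scalar_prod_u:
  assumes a: "\<And>k. k \<in> {1..K} \<Longrightarrow> a k \<in> carrier_vec d"
  shows "(\<Sum>k\<in>{1..K}. a k \<bullet> u k) =
    (\<Sum>i\<in>{1..K}. 1 / real N * (\<Sum>j\<in>{1..N}. Del i j * (stack a i \<bullet> zbar i j)))"
proof -
  have 1: "a k \<bullet> u k = (\<Sum>i\<in>{k..K}. 1 / real N * (\<Sum>j\<in>{1..N}. Del i j * (a k \<bullet> zt k j)))"
    if k: "k \<in> {1..K}" for k
  proof -
    have "a k \<bullet> u k = (\<Sum>l<d. \<Sum>i\<in>{k..K}. \<Sum>j\<in>{1..N}. 1 / real N * (Del i j * (a k $ l * zt k j $ l)))"
      by (simp add: u_def scalar_prod_def atLeast0LessThan sum_distrib_left mult_ac)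
    also have "\<dots> = (\<Sum>i\<in>{k..K}. \<Sum>l<d. \<Sum>j\<in>{1..N}. 1 / real N * (Del i j * (a k $ l * zt k j $ l)))"
      by (rule sum.swap)
    also have "\<dots> = (\<Sum>i\<in>{k..K}. \<Sum>j\<in>{1..N}. \<Sum>l<d. 1 / real N * (Del i j * (a k $ l * zt k j $ l)))"
      by (intro sum.cong refl sum.swap)
    also have "\<dots> = (\<Sum>i\<in>{k..K}. 1 / real N * (\<Sum>j\<in>{1..N}. Del i j * (a k \<bullet> zt k j)))"
      by (simp add: zt_dim scalar_prod_def atLeast0LessThan sum_distrib_left)
    finally show ?thesis .
  qed
  have "(\<Sum>k\<in>{1..K}. a k \<bullet> u k) =
    (\<Sum>k\<in>{1..K}. \<Sum>i\<in>{k..K}. 1 / real N * (\<Sum>j\<in>{1..N}. Del i j * (a k \<bullet> zt k j)))"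
    by (intro sum.cong refl 1)
  also have "\<dots> = (\<Sum>i\<in>{1..K}. \<Sum>k\<in>{1..i}. 1 / real N * (\<Sum>j\<in>{1..N}. Del i j * (a k \<bullet> zt k j)))"
    by (rule sum_triangle_swap)
  also have "\<dots> = (\<Sum>i\<in>{1..K}. 1 / real N * (\<Sum>j\<in>{1..N}. Del i j * (\<Sum>k\<in>{1..i}. a k \<bullet> zt k j)))"
  proof (rule sum.cong[OF refl])
    fix i
    have "(\<Sum>k\<in>{1..i}. 1 / real N * (\<Sum>j\<in>{1..N}. Del i j * (a k \<bullet> zt k j))) =
       1 / real N * (\<Sum>k\<in>{1..i}. \<Sum>j\<in>{1..N}. Del i j * (a k \<bullet> zt k j))" by (simp add: sum_distrib_left)
    also have "(\<Sum>k\<in>{1..i}. \<Sum>j\<in>{1..N}. Del i j * (a k \<bullet> zt k j)) = (\<Sum>j\<in>{1..N}. \<Sum>k\<in>{1..i}. Del i j * (a k \<bullet> zt k j))"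
      by (rule sum.swap)
    finally show "(\<Sum>k\<in>{1..i}. 1 / real N * (\<Sum>j\<in>{1..N}. Del i j * (a k \<bullet> zt k j))) =
      1 / real N * (\<Sum>j\<in>{1..N}. Del i j * (\<Sum>k\<in>{1..i}. a k \<bullet> zt k j))" by (simp add: sum_distrib_left)
  qed
  also have "\<dots> = (\<Sum>i\<in>{1..K}. 1 / real N * (\<Sum>j\<in>{1..N}. Del i j * (stack a i \<bullet> zbar i j)))"
    using a zt by (intro sum.cong refl arg_cong2[of _ _ _ _ "(*)"] stack_scalar_prod[symmetric, where d = d]) auto
  finally show ?thesis .
qed

lemma vnorm_S_le:
  assumes "k \<in> {1..K}" "x \<in> carrier_vec d"
  shows "vnorm (sqrt_mat d (Sig k) *\<^sub>v x) \<le> 1 / sqrt p * vnorm x"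
proof (rule power2_le_imp_le)
  have "(vnorm (sqrt_mat d (Sig k) *\<^sub>v x))\<^sup>2 \<le> (vnorm x)\<^sup>2 / p"
    using pd_sqrt_inv(4)[OF Sig[OF assms(1)] assms(2)]
      precision_ge_imp_covariance_le[OF Sig[OF assms(1)] p prec[OF assms(1)] assms(2)] by simp
  then show "(vnorm (sqrt_mat d (Sig k) *\<^sub>v x))\<^sup>2 \<le> (1 / sqrt p * vnorm x)\<^sup>2"
    using p by (simp add: power_mult_distrib power_divide)
qed (use p in simp)

lemma vnorm_Dm_le:
  assumes "i \<in> {1..K}" "x \<in> carrier_vec (i * d)"
  shows "vnorm (Dm i *\<^sub>v x) \<le> 1 / sqrt p * vnorm x"
  using assms S_carrier vnorm_S_le p by (intro vnorm_bdiag_le) auto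

lemma Del_le:
  assumes i: "i \<in> {1..K}"
  shows "\<bar>Del i j\<bar> \<le> L i / sqrt p * vnorm (zbar i j)"
proof -
  have "\<bar>Del i j\<bar> \<le> L i * vnorm (stack mu i + Dm i *\<^sub>v zbar i j - stack mu i)"
  proof -
    have "Dm i *\<^sub>v zbar i j \<in> carrier_vec (i * d)"
      by (rule mult_mat_vec_carrier[OF Dm_carrier[OF i] zbar_carrier])
    then have "stack mu i + Dm i *\<^sub>v zbar i j \<in> carrier_vec (i * d)"
      using stack_mu_carrier[OF i] by simp
    then show ?thesis
      using lip[OF i, THEN conjunct1, unfolded lipschitz_vec_def] stack_mu_carrier[OF i]
      unfolding Del_def by blast
  qed
  also have "stack mu i + Dm i *\<^sub>v zbar i j - stack mu i = Dm i *\<^sub>v zbar i j"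
    using stack_mu_carrier[OF i] Dm_carrier[OF i] zbar_carrier[of i j] by auto
  also have "L i * vnorm (Dm i *\<^sub>v zbar i j) \<le> L i * (1 / sqrt p * vnorm (zbar i j))"
    using lip[OF i] by (intro mult_left_mono vnorm_Dm_le[OF i zbar_carrier]) auto
  finally show ?thesis by simp
qed

definition zmoment :: real where
  "zmoment = real K * (\<Sum>i\<in>{1..K}. (L i)\<^sup>2 * (1 / real N * (\<Sum>j\<in>{1..N}. vnorm (zbar i j) ^ 4)))"

lemma sum_vnorm_u_le: "(\<Sum>k\<in>{1..K}. u k \<bullet> u k) \<le> 1 / p * zmoment"
proof -
  have 1: "u k \<bullet> u k \<le> (\<Sum>i\<in>{k..K}. real K * (1 / real N * (\<Sum>j\<in>{1..N}. (Del i j)\<^sup>2 * (vnorm (zt k j))\<^sup>2)))"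
    if k: "k \<in> {1..K}" for k
  proof -
    have sq: "(\<Sum>i\<in>{k..K}. 1 / real N * (\<Sum>j\<in>{1..N}. Del i j * zt k j $ l))\<^sup>2 \<le>
       (\<Sum>i\<in>{k..K}. real K * (1 / real N * (\<Sum>j\<in>{1..N}. (Del i j)\<^sup>2 * (zt k j $ l)\<^sup>2)))" for l
    proof -
      have "(\<Sum>i\<in>{k..K}. 1 / real N * (\<Sum>j\<in>{1..N}. Del i j * zt k j $ l))\<^sup>2 \<le>
        (\<Sum>i\<in>{k..K}. (1 / real N * (\<Sum>j\<in>{1..N}. Del i j * zt k j $ l))\<^sup>2) * real (card {k..K})"
        by (rule sum_squared_le_sum_of_squares)
      also have "\<dots> \<le> (\<Sum>i\<in>{k..K}. (1 / real N * (\<Sum>j\<in>{1..N}. Del i j * zt k j $ l))\<^sup>2) * real K"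
        using k by (intro mult_left_mono sum_nonneg) auto
      also have "\<dots> \<le> (\<Sum>i\<in>{k..K}. 1 / real N * (\<Sum>j\<in>{1..N}. (Del i j)\<^sup>2 * (zt k j $ l)\<^sup>2)) * real K"
      proof (intro mult_right_mono sum_mono)
        fix i
        have "(\<Sum>j\<in>{1..N}. Del i j * zt k j $ l)\<^sup>2 \<le> (\<Sum>j\<in>{1..N}. (Del i j * zt k j $ l)\<^sup>2) * real (card {1..N})"
          by (rule sum_squared_le_sum_of_squares)
        then have "(1 / real N)\<^sup>2 * (\<Sum>j\<in>{1..N}. Del i j * zt k j $ l)\<^sup>2 \<le>
           (1 / real N)\<^sup>2 * ((\<Sum>j\<in>{1..N}. (Del i j * zt k j $ l)\<^sup>2) * real N)" by (intro mult_left_mono) auto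
        then show "(1 / real N * (\<Sum>j\<in>{1..N}. Del i j * zt k j $ l))\<^sup>2 \<le>
            1 / real N * (\<Sum>j\<in>{1..N}. (Del i j)\<^sup>2 * (zt k j $ l)\<^sup>2)"
          using N by (simp add: power_mult_distrib power2_eq_square mult_ac)
      qed simp
      finally show ?thesis by (simp add: sum_distrib_left mult_ac)
    qed
    have "u k \<bullet> u k = (\<Sum>l<d. (\<Sum>i\<in>{k..K}. 1 / real N * (\<Sum>j\<in>{1..N}. Del i j * zt k j $ l))\<^sup>2)"
      by (simp add: scalar_prod_self_eq_sum u_def)
    also have "\<dots> \<le> (\<Sum>l<d. \<Sum>i\<in>{k..K}. real K * (1 / real N * (\<Sum>j\<in>{1..N}. (Del i j)\<^sup>2 * (zt k j $ l)\<^sup>2)))"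
      by (intro sum_mono sq)
    also have "\<dots> = (\<Sum>i\<in>{k..K}. \<Sum>l<d. real K * (1 / real N * (\<Sum>j\<in>{1..N}. (Del i j)\<^sup>2 * (zt k j $ l)\<^sup>2)))"
      by (rule sum.swap)
    also have "\<dots> = (\<Sum>i\<in>{k..K}. real K * (1 / real N * (\<Sum>j\<in>{1..N}. (Del i j)\<^sup>2 * (vnorm (zt k j))\<^sup>2)))"
    proof (rule sum.cong[OF refl])
      fix i
      have "(\<Sum>l<d. \<Sum>j\<in>{1..N}. (Del i j)\<^sup>2 * (zt k j $ l)\<^sup>2) = (\<Sum>j\<in>{1..N}. (Del i j)\<^sup>2 * (vnorm (zt k j))\<^sup>2)"
        by (subst sum.swap) (simp add: zt_dim vnorm_sq scalar_prod_self_eq_sum sum_distrib_left)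
      then show "(\<Sum>l<d. real K * (1 / real N * (\<Sum>j\<in>{1..N}. (Del i j)\<^sup>2 * (zt k j $ l)\<^sup>2))) =
        real K * (1 / real N * (\<Sum>j\<in>{1..N}. (Del i j)\<^sup>2 * (vnorm (zt k j))\<^sup>2))"
        by (simp flip: sum_distrib_left sum_divide_distrib)
    qed
    finally show ?thesis .
  qed
  have "(\<Sum>k\<in>{1..K}. u k \<bullet> u k) \<le>
      (\<Sum>k\<in>{1..K}. \<Sum>i\<in>{k..K}. real K * (1 / real N * (\<Sum>j\<in>{1..N}. (Del i j)\<^sup>2 * (vnorm (zt k j))\<^sup>2)))"
    by (intro sum_mono 1)
  also have "\<dots> = (\<Sum>i\<in>{1..K}. \<Sum>k\<in>{1..i}. real K * (1 / real N * (\<Sum>j\<in>{1..N}. (Del i j)\<^sup>2 * (vnorm (zt k j))\<^sup>2)))"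
    by (rule sum_triangle_swap)
  also have "\<dots> = (\<Sum>i\<in>{1..K}. real K * (1 / real N * (\<Sum>j\<in>{1..N}. (Del i j)\<^sup>2 * (vnorm (zbar i j))\<^sup>2)))"
  proof (rule sum.cong[OF refl])
    fix i
    have "(\<Sum>k\<in>{1..i}. \<Sum>j\<in>{1..N}. (Del i j)\<^sup>2 * (vnorm (zt k j))\<^sup>2) = (\<Sum>j\<in>{1..N}. (Del i j)\<^sup>2 * (vnorm (zbar i j))\<^sup>2)"
      using zt by (subst sum.swap) (simp add: vnorm_sq_stack[where d = d] sum_distrib_left)
    then show "(\<Sum>k\<in>{1..i}. real K * (1 / real N * (\<Sum>j\<in>{1..N}. (Del i j)\<^sup>2 * (vnorm (zt k j))\<^sup>2))) =
      real K * (1 / real N * (\<Sum>j\<in>{1..N}. (Del i j)\<^sup>2 * (vnorm (zbar i j))\<^sup>2))"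
      by (simp flip: sum_distrib_left sum_divide_distrib)
  qed
  also have "\<dots> \<le> (\<Sum>i\<in>{1..K}. real K * (1 / real N * (\<Sum>j\<in>{1..N}. 1 / p * ((L i)\<^sup>2 * vnorm (zbar i j) ^ 4))))"
  proof (intro sum_mono mult_left_mono)
    fix i j assume i: "i \<in> {1..K}"
    have "(Del i j)\<^sup>2 \<le> (L i / sqrt p * vnorm (zbar i j))\<^sup>2"
      using power_mono[OF Del_le[OF i, of j], of 2] by simp
    also have "\<dots> = 1 / p * ((L i)\<^sup>2 * (vnorm (zbar i j))\<^sup>2)"
      using p by (simp add: power_mult_distrib power_divide)
    finally have "(Del i j)\<^sup>2 * (vnorm (zbar i j))\<^sup>2 \<le> 1 / p * ((L i)\<^sup>2 * (vnorm (zbar i j))\<^sup>2) * (vnorm (zbar i j))\<^sup>2"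
      by (intro mult_right_mono) auto
    then show "(Del i j)\<^sup>2 * (vnorm (zbar i j))\<^sup>2 \<le> 1 / p * ((L i)\<^sup>2 * vnorm (zbar i j) ^ 4)"
      by (simp add: power2_eq_square power4_eq_xxxx mult_ac)
  qed auto
  also have "\<dots> = 1 / p * zmoment"
    by (simp add: zmoment_def sum_distrib_left mult_ac sum_divide_distrib)
  finally show ?thesis .
qed

lemma descent_step:
  fixes mus :: "nat \<Rightarrow> real vec" and b g th :: real
  assumes mus: "\<And>k. k \<in> {1..K} \<Longrightarrow> mus k \<in> carrier_vec d" and th: "0 < th"
  defines "mu' \<equiv> \<lambda>k. mu k - b \<cdot>\<^sub>v (Sig k *\<^sub>v (g \<cdot>\<^sub>v mu k + vsum d (\<lambda>i. casbo_ghat d N f mu Sig zt i k) {k..K}))"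
  shows "(\<Sum>k\<in>{1..K}. wnorm_sq (inv_mat d (Sig k)) (mu' k - mus k)) \<le>
    (\<Sum>k\<in>{1..K}. wnorm_sq (inv_mat d (Sig k)) (mu k - mus k))
    - 2 * b * (\<Sum>i\<in>{1..K}. 1 / real N * (\<Sum>j\<in>{1..N}. Del i j * (stack (\<lambda>k. R k *\<^sub>v (mu k - mus k)) i \<bullet> zbar i j)))
    - b * g * ((\<Sum>k\<in>{1..K}. (vnorm (mu k))\<^sup>2) + (\<Sum>k\<in>{1..K}. (vnorm (mu k - mus k))\<^sup>2) - (\<Sum>k\<in>{1..K}. (vnorm (mus k))\<^sup>2))
    + b\<^sup>2 * ((1 + th) * g\<^sup>2 * (1 / p) * (\<Sum>k\<in>{1..K}. (vnorm (mu k))\<^sup>2) + (1 + 1 / th) * (1 / p) * zmoment)"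
proof -
  let ?P = "\<lambda>k. inv_mat d (Sig k)" and ?x = "\<lambda>k. mu k - mus k"
  have one: "wnorm_sq (?P k) (mu' k - mus k) \<le> wnorm_sq (?P k) (?x k) - 2 * b * ((R k *\<^sub>v ?x k) \<bullet> u k)
      - b * g * ((vnorm (mu k))\<^sup>2 + (vnorm (?x k))\<^sup>2 - (vnorm (mus k))\<^sup>2)
      + b\<^sup>2 * ((1 + th) * g\<^sup>2 * (1 / p) * (vnorm (mu k))\<^sup>2 + (1 + 1 / th) * (u k \<bullet> u k))"
    if k: "k \<in> {1..K}" for k
  proof -
    note c = mu[OF k] mus[OF k] R_carrier[OF k] u_carrier[of k]
    let ?h = "R k *\<^sub>v u k" and ?v = "g \<cdot>\<^sub>v mu k + R k *\<^sub>v u k"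
    have h: "?h \<in> carrier_vec d" "?v \<in> carrier_vec d" "?x k \<in> carrier_vec d" using c by auto
    have y: "b \<cdot>\<^sub>v (Sig k *\<^sub>v ?v) \<in> carrier_vec d" using pd_matD(1)[OF Sig[OF k]] h by auto
    have "a - y - e = a - e - y" if "a \<in> carrier_vec d" "y \<in> carrier_vec d" "e \<in> carrier_vec d" for a y e :: "real vec"
      using that by (intro eq_vecI) auto
    from this[OF c(1) y c(2)] have "mu' k - mus k = ?x k - b \<cdot>\<^sub>v (Sig k *\<^sub>v ?v)"
      unfolding mu'_def ghat_sum[OF k] .
    then have 1: "wnorm_sq (?P k) (mu' k - mus k) =
        wnorm_sq (?P k) (?x k) - 2 * b * (?x k \<bullet> ?v) + b\<^sup>2 * wnorm_sq (Sig k) ?v"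
      using covariance_step_expand[OF Sig[OF k] h(3,2)] by simp
    have e1: "?x k \<bullet> ?v = g * (?x k \<bullet> mu k) + ?x k \<bullet> ?h"
      using c h by (simp add: scalar_prod_add_distrib[of _ d])
    have e2: "?x k \<bullet> ?h = (R k *\<^sub>v ?x k) \<bullet> u k"
      using symmetric_scalar_prod_swap[OF R_carrier[OF k] pd_sqrt_inv_props(3)[OF Sig[OF k]] h(3) u_carrier] .
    have e3: "2 * (?x k \<bullet> mu k) = (vnorm (mu k))\<^sup>2 + (vnorm (?x k))\<^sup>2 - (vnorm (mus k))\<^sup>2"
      using vnorm_sq_minus[OF c(1,2)] minus_scalar_prod_distrib[OF c(1,2,1)] comm_scalar_prod[OF c(1,2)]
      by (simp add: vnorm_sq)
    have 2: "2 * b * (?x k \<bullet> ?v) = 2 * b * ((R k *\<^sub>v ?x k) \<bullet> u k) +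
        b * g * ((vnorm (mu k))\<^sup>2 + (vnorm (?x k))\<^sup>2 - (vnorm (mus k))\<^sup>2)"
      unfolding e3[symmetric] e1 e2 by (simp add: algebra_simps)
    have "wnorm_sq (Sig k) ?v \<le> (1 + th) * g\<^sup>2 * wnorm_sq (Sig k) (mu k) + (1 + 1 / th) * wnorm_sq (Sig k) ?h"
      by (rule psd_Young[OF pd_imp_psd[OF Sig[OF k]] c(1) h(1) th])
    also have "wnorm_sq (Sig k) ?h = u k \<bullet> u k" by (rule pd_sqrt_inv(2)[OF Sig[OF k] u_carrier])
    also have "(1 + th) * g\<^sup>2 * wnorm_sq (Sig k) (mu k) \<le> (1 + th) * g\<^sup>2 * ((vnorm (mu k))\<^sup>2 / p)"
      using th by (intro mult_left_mono precision_ge_imp_covariance_le[OF Sig[OF k] p prec[OF k] c(1)]) auto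
    finally have 3: "b\<^sup>2 * wnorm_sq (Sig k) ?v \<le>
        b\<^sup>2 * ((1 + th) * g\<^sup>2 * (1 / p) * (vnorm (mu k))\<^sup>2 + (1 + 1 / th) * (u k \<bullet> u k))"
      by (intro mult_left_mono) auto
    show ?thesis using 1 2 3 by linarith
  qed
  have a: "R k *\<^sub>v ?x k \<in> carrier_vec d" if k: "k \<in> {1..K}" for k
    using R_carrier[OF k] mu[OF k] mus[OF k] by auto
  have "(\<Sum>k\<in>{1..K}. wnorm_sq (?P k) (mu' k - mus k)) \<le> (\<Sum>k\<in>{1..K}. wnorm_sq (?P k) (?x k)
      - 2 * b * ((R k *\<^sub>v ?x k) \<bullet> u k) - b * g * ((vnorm (mu k))\<^sup>2 + (vnorm (?x k))\<^sup>2 - (vnorm (mus k))\<^sup>2)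
      + b\<^sup>2 * ((1 + th) * g\<^sup>2 * (1 / p) * (vnorm (mu k))\<^sup>2 + (1 + 1 / th) * (u k \<bullet> u k)))"
    by (intro sum_mono one)
  also have "\<dots> = (\<Sum>k\<in>{1..K}. wnorm_sq (?P k) (?x k)) - 2 * b * (\<Sum>k\<in>{1..K}. (R k *\<^sub>v ?x k) \<bullet> u k)
      - b * g * ((\<Sum>k\<in>{1..K}. (vnorm (mu k))\<^sup>2) + (\<Sum>k\<in>{1..K}. (vnorm (?x k))\<^sup>2) - (\<Sum>k\<in>{1..K}. (vnorm (mus k))\<^sup>2))
      + b\<^sup>2 * ((1 + th) * g\<^sup>2 * (1 / p) * (\<Sum>k\<in>{1..K}. (vnorm (mu k))\<^sup>2) + (1 + 1 / th) * (\<Sum>k\<in>{1..K}. u k \<bullet> u k))"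
    unfolding sum.distrib sum_subtractf sum_distrib_left[symmetric] ..
  also have "(1 + 1 / th) * (\<Sum>k\<in>{1..K}. u k \<bullet> u k) \<le> (1 + 1 / th) * (1 / p * zmoment)"
    using th by (intro mult_left_mono sum_vnorm_u_le) auto
  also have "(1 + 1 / th) * (1 / p * zmoment) = (1 + 1 / th) * (1 / p) * zmoment" by simp
  finally show ?thesis
    using sum_scalar_prod_u[of "\<lambda>k. R k *\<^sub>v ?x k", OF a] by (simp add: mult_left_mono)
qed

lemma H_carrier: "casbo_H d K N f mu Sig zt a b k \<in> carrier_mat d d"
  and H_transpose: "transpose_mat (casbo_H d K N f mu Sig zt a b k) = casbo_H d K N f mu Sig zt a b k"
  by (auto simp: casbo_H_def Let_def intro!: eq_matI sum.cong)

lemma precision_step: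
  assumes k: "k \<in> {1..K}" and al: "0 < al" and nu: "0 < nu"
    and C1: "loewner_le d (casbo_H d K N f mu Sig zt c1 c2 k) ((1 / al * A) \<cdot>\<^sub>m 1\<^sub>m d + (E / al) \<cdot>\<^sub>m Sig k)"
    and C2: "loewner_le d (nu \<cdot>\<^sub>m 1\<^sub>m d) (casbo_G d K N f mu Sig zt c1 c2 k)"
  defines "Sig' \<equiv> inv_mat d (1 \<cdot>\<^sub>m inv_mat d (Sig k) + al \<cdot>\<^sub>m casbo_G d K N f mu Sig zt c1 c2 k)"
  shows "pd_mat d Sig'"
    "inv_mat d Sig' = 1 \<cdot>\<^sub>m inv_mat d (Sig k) + al \<cdot>\<^sub>m casbo_G d K N f mu Sig zt c1 c2 k"
    "\<And>x. x \<in> carrier_vec d \<Longrightarrow> (p + al * nu) * (vnorm x)\<^sup>2 \<le> wnorm_sq (inv_mat d Sig') x"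
    "\<And>x. x \<in> carrier_vec d \<Longrightarrow>
       wnorm_sq (inv_mat d Sig') x \<le> (1 + A) * wnorm_sq (inv_mat d (Sig k)) x + E * (vnorm x)\<^sup>2"
proof -
  let ?H = "casbo_H d K N f mu Sig zt c1 c2 k" and ?G = "casbo_G d K N f mu Sig zt c1 c2 k"
  let ?P = "inv_mat d (Sig k)"
  define P' where "P' = 1 \<cdot>\<^sub>m ?P + al \<cdot>\<^sub>m ?G"
  note Rc = R_carrier[OF k] and Hc = H_carrier[of c1 c2 k] and Pd = pd_inv_mat_pd[OF Sig[OF k]]
  note Pc = pd_matD(1,2)[OF Pd] and Rt = pd_sqrt_inv_props(3)[OF Sig[OF k]]
  have Gc: "?G \<in> carrier_mat d d" using Rc Hc by (auto simp: casbo_G_def)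
  have Gt: "transpose_mat ?G = ?G"
  proof -
    have "transpose_mat ?G = R k * (?H * R k)"
      using Rc Hc Rt H_transpose unfolding casbo_G_def
      by (simp add: transpose_mult[of _ d d _ d])
    then show ?thesis using Rc Hc by (simp add: casbo_G_def assoc_mult_mat[of _ d d _ d _ d])
  qed
  have Gw: "wnorm_sq ?G x = wnorm_sq ?H (R k *\<^sub>v x)" if x: "x \<in> carrier_vec d" for x
  proof -
    have Rx: "R k *\<^sub>v x \<in> carrier_vec d" using Rc x by auto
    have HRx: "?H *\<^sub>v (R k *\<^sub>v x) \<in> carrier_vec d" using Hc Rx by auto
    have "?G *\<^sub>v x = R k *\<^sub>v (?H *\<^sub>v (R k *\<^sub>v x))"
      using Rc Hc x Rx by (simp add: casbo_G_def assoc_mult_mat_vec[of _ d d _ d])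
    then show ?thesis
      using symmetric_scalar_prod_swap[OF Rc Rt x HRx] by (simp add: wnorm_sq_def)
  qed
  have P'c: "P' \<in> carrier_mat d d" using Pc Gc by (auto simp: P'_def)
  have P't: "transpose_mat P' = P'"
  proof -
    have tsm: "transpose_mat (a \<cdot>\<^sub>m Q) = a \<cdot>\<^sub>m transpose_mat Q" for a and Q :: "real mat" by (auto intro!: eq_matI)
    show ?thesis
      unfolding P'_def using Pc Gc Gt by (simp add: transpose_add[of _ d d] tsm)
  qed
  have P'w: "wnorm_sq P' x = wnorm_sq ?P x + al * wnorm_sq ?G x" if x: "x \<in> carrier_vec d" for x
  proof -
    have "P' *\<^sub>v x = ?P *\<^sub>v x + al \<cdot>\<^sub>v (?G *\<^sub>v x)"
      using Pc Gc x by (auto intro!: eq_vecI simp: P'_def scalar_prod_def sum.distrib sum_distrib_left algebra_simps)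
    then show ?thesis
      using Pc Gc x by (simp add: wnorm_sq_def scalar_prod_add_distrib[of _ d])
  qed
  have low: "nu * (vnorm x)\<^sup>2 \<le> wnorm_sq ?G x" if x: "x \<in> carrier_vec d" for x
  proof -
    have "(?G - nu \<cdot>\<^sub>m 1\<^sub>m d) *\<^sub>v x = ?G *\<^sub>v x - nu \<cdot>\<^sub>v x"
    proof -
      have "(nu \<cdot>\<^sub>m 1\<^sub>m d) *\<^sub>v x = nu \<cdot>\<^sub>v x" using x by (auto intro!: eq_vecI)
      then show ?thesis using Gc x by (simp add: minus_mult_distrib_mat_vec[of _ d d])
    qed
    then show ?thesis
      using C2 x Gc by (auto simp: loewner_le_def wnorm_sq_def vnorm_sq scalar_prod_minus_distrib[of _ d] dest!: bspec[of _ _ x])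
  qed
  have up: "al * wnorm_sq ?G x \<le> A * wnorm_sq ?P x + E * (vnorm x)\<^sup>2" if x: "x \<in> carrier_vec d" for x
  proof -
    let ?y = "R k *\<^sub>v x"
    let ?Q = "(1 / al * A) \<cdot>\<^sub>m 1\<^sub>m d + (E / al) \<cdot>\<^sub>m Sig k"
    note Sc = pd_matD(1)[OF Sig[OF k]]
    have y: "?y \<in> carrier_vec d" using Rc x by auto
    have "?Q *\<^sub>v ?y = (1 / al * A) \<cdot>\<^sub>v ?y + (E / al) \<cdot>\<^sub>v (Sig k *\<^sub>v ?y)"
    proof -
      have "((1 / al * A) \<cdot>\<^sub>m 1\<^sub>m d) *\<^sub>v ?y = (1 / al * A) \<cdot>\<^sub>v ?y"
        using smult_mat_mult_vec[OF one_carrier_mat y] y by simp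
      moreover have "((E / al) \<cdot>\<^sub>m Sig k) *\<^sub>v ?y = (E / al) \<cdot>\<^sub>v (Sig k *\<^sub>v ?y)"
        by (rule smult_mat_mult_vec[OF Sc y])
      ultimately show ?thesis using y Sc by (simp add: add_mult_distrib_mat_vec[of _ d d])
    qed
    then have Qw: "wnorm_sq ?Q ?y = 1 / al * A * (?y \<bullet> ?y) + E / al * wnorm_sq (Sig k) ?y"
      using y Sc by (simp add: wnorm_sq_def scalar_prod_add_distrib[of _ d])
    have "(?Q - ?H) *\<^sub>v ?y = ?Q *\<^sub>v ?y - ?H *\<^sub>v ?y"
      using y Sc Hc by (simp add: minus_mult_distrib_mat_vec[of _ d d])
    moreover have "?Q \<in> carrier_mat d d" using Sc by auto
    then have "?Q *\<^sub>v ?y \<in> carrier_vec d" "?H *\<^sub>v ?y \<in> carrier_vec d"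
      using y Hc by (metis mult_mat_vec_carrier)+
    ultimately have "?y \<bullet> ((?Q - ?H) *\<^sub>v ?y) = wnorm_sq ?Q ?y - wnorm_sq ?H ?y"
      using y by (simp add: wnorm_sq_def scalar_prod_minus_distrib[of _ d])
    then have "wnorm_sq ?H ?y \<le> wnorm_sq ?Q ?y"
      using C1 y by (auto simp: loewner_le_def)
    also have "\<dots> = 1 / al * A * wnorm_sq ?P x + E / al * (vnorm x)\<^sup>2"
      unfolding Qw using pd_sqrt_inv(2,3)[OF Sig[OF k] x] by (simp add: vnorm_sq)
    finally have "al * wnorm_sq ?G x \<le> al * (1 / al * A * wnorm_sq ?P x + E / al * (vnorm x)\<^sup>2)"
      unfolding Gw[OF x] using al by (intro mult_left_mono) auto
    then show ?thesis using al by (simp add: algebra_simps)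
  qed
  have ge: "(p + al * nu) * (vnorm x)\<^sup>2 \<le> wnorm_sq P' x" if x: "x \<in> carrier_vec d" for x
  proof -
    have "al * (nu * (vnorm x)\<^sup>2) \<le> al * wnorm_sq ?G x" using low[OF x] al by (intro mult_left_mono) auto
    then show ?thesis using P'w[OF x] prec[OF k x] unfolding distrib_right mult.assoc by linarith
  qed
  have P'pd: "pd_mat d P'"
    unfolding pd_mat_def
  proof (intro conjI ballI impI P'c P't)
    fix x :: "real vec" assume x: "x \<in> carrier_vec d" "x \<noteq> 0\<^sub>v d"
    have "0 < (p + al * nu) * (vnorm x)\<^sup>2" using p al nu vnorm_pos[OF x] by (intro mult_pos_pos) (auto intro: add_pos_pos)
    then show "0 < x \<bullet> (P' *\<^sub>v x)" using ge[OF x(1)] by (simp add: wnorm_sq_def)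
  qed
  have S': "Sig' = inv_mat d P'" by (simp add: Sig'_def P'_def)
  show "pd_mat d Sig'" unfolding S' by (rule pd_inv_mat_pd[OF P'pd])
  have I: "inv_mat d Sig' = P'" unfolding S' by (rule inv_mat_inv_mat[OF P'pd])
  then show "inv_mat d Sig' = 1 \<cdot>\<^sub>m inv_mat d (Sig k) + al \<cdot>\<^sub>m ?G" by (simp add: P'_def)
  fix x :: "real vec" assume x: "x \<in> carrier_vec d"
  show "(p + al * nu) * (vnorm x)\<^sup>2 \<le> wnorm_sq (inv_mat d Sig') x" unfolding I by (rule ge[OF x])
  show "wnorm_sq (inv_mat d Sig') x \<le> (1 + A) * wnorm_sq ?P x + E * (vnorm x)\<^sup>2"
    unfolding I P'w[OF x] using up[OF x] by (simp add: algebra_simps)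
qed

end

subsection \<open>Measurability of vector- and matrix-valued maps\<close>

definition meas_vec :: "'w measure \<Rightarrow> nat \<Rightarrow> ('w \<Rightarrow> real vec) \<Rightarrow> bool" where
  "meas_vec F n v \<longleftrightarrow> (\<forall>w\<in>space F. v w \<in> carrier_vec n) \<and> (\<forall>l<n. (\<lambda>w. v w $ l) \<in> borel_measurable F)"

definition meas_mat :: "'w measure \<Rightarrow> nat \<Rightarrow> ('w \<Rightarrow> real mat) \<Rightarrow> bool" where
  "meas_mat F n A \<longleftrightarrow> (\<forall>w\<in>space F. A w \<in> carrier_mat n n) \<and>
     (\<forall>i<n. \<forall>j<n. (\<lambda>w. A w $$ (i, j)) \<in> borel_measurable F)"

lemma meas_vecI:
  assumes "\<And>w. w \<in> space F \<Longrightarrow> v w \<in> carrier_vec n"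
    and "\<And>l w. l < n \<Longrightarrow> w \<in> space F \<Longrightarrow> v w $ l = e l w"
    and "\<And>l. l < n \<Longrightarrow> e l \<in> borel_measurable F"
  shows "meas_vec F n v"
  using assms by (auto simp: meas_vec_def cong: measurable_cong)

lemma meas_matI:
  assumes "\<And>w. w \<in> space F \<Longrightarrow> A w \<in> carrier_mat n n"
    and "\<And>i j w. i < n \<Longrightarrow> j < n \<Longrightarrow> w \<in> space F \<Longrightarrow> A w $$ (i, j) = e i j w"
    and "\<And>i j. i < n \<Longrightarrow> j < n \<Longrightarrow> e i j \<in> borel_measurable F"
  shows "meas_mat F n A"
  using assms by (auto simp: meas_mat_def cong: measurable_cong)

lemma meas_vecD:
  assumes "meas_vec F n v"
  shows "w \<in> space F \<Longrightarrow> v w \<in> carrier_vec n" "w \<in> space F \<Longrightarrow> dim_vec (v w) = n"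
    "l < n \<Longrightarrow> (\<lambda>w. v w $ l) \<in> borel_measurable F"
  using assms by (auto simp: meas_vec_def)

lemma meas_matD:
  assumes "meas_mat F n A"
  shows "w \<in> space F \<Longrightarrow> A w \<in> carrier_mat n n" "w \<in> space F \<Longrightarrow> dim_row (A w) = n"
    "w \<in> space F \<Longrightarrow> dim_col (A w) = n"
    "i < n \<Longrightarrow> j < n \<Longrightarrow> (\<lambda>w. A w $$ (i, j)) \<in> borel_measurable F"
  using assms by (auto simp: meas_mat_def)

lemma meas_vec_cong: "(\<And>w. w \<in> space F \<Longrightarrow> v w = v' w) \<Longrightarrow> meas_vec F n v \<longleftrightarrow> meas_vec F n v'"
  unfolding meas_vec_def by (auto cong: measurable_cong)

lemma meas_mat_cong: "(\<And>w. w \<in> space F \<Longrightarrow> A w = A' w) \<Longrightarrow> meas_mat F n A \<longleftrightarrow> meas_mat F n A'"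
  unfolding meas_mat_def by (auto cong: measurable_cong)

lemma meas_vec_compose:
  "meas_vec F n v \<Longrightarrow> h \<in> G \<rightarrow>\<^sub>M F \<Longrightarrow> meas_vec G n (\<lambda>w. v (h w))"
  unfolding meas_vec_def by (auto dest: measurable_space intro: measurable_compose)

lemma meas_mat_compose:
  "meas_mat F n A \<Longrightarrow> h \<in> G \<rightarrow>\<^sub>M F \<Longrightarrow> meas_mat G n (\<lambda>w. A (h w))"
  unfolding meas_mat_def by (auto dest: measurable_space intro: measurable_compose)

lemma meas_vec_const: "v \<in> carrier_vec n \<Longrightarrow> meas_vec F n (\<lambda>_. v)"
  by (auto simp: meas_vec_def)

lemma meas_mat_const: "A \<in> carrier_mat n n \<Longrightarrow> meas_mat F n (\<lambda>_. A)"
  by (auto simp: meas_mat_def)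

lemma meas_vec_add:
  assumes "meas_vec F n v" "meas_vec F n v'"
  shows "meas_vec F n (\<lambda>w. v w + v' w)"
  by (rule meas_vecI[where e = "\<lambda>l w. v w $ l + v' w $ l"])
     (auto simp: meas_vecD(2)[OF assms(1)] meas_vecD(2)[OF assms(2)]
        intro!: add_carrier_vec minus_carrier_vec borel_measurable_add borel_measurable_diff
          meas_vecD(1,3)[OF assms(1)] meas_vecD(1,3)[OF assms(2)])

lemma meas_vec_minus:
  assumes "meas_vec F n v" "meas_vec F n v'"
  shows "meas_vec F n (\<lambda>w. v w - v' w)"
  by (rule meas_vecI[where e = "\<lambda>l w. v w $ l - v' w $ l"])
     (auto simp: meas_vecD(2)[OF assms(1)] meas_vecD(2)[OF assms(2)]
        intro!: add_carrier_vec minus_carrier_vec borel_measurable_add borel_measurable_diff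
          meas_vecD(1,3)[OF assms(1)] meas_vecD(1,3)[OF assms(2)])

lemma meas_vec_smult:
  assumes "c \<in> borel_measurable F" "meas_vec F n v"
  shows "meas_vec F n (\<lambda>w. c w \<cdot>\<^sub>v v w)"
  by (rule meas_vecI[where e = "\<lambda>l w. c w * v w $ l"]) 
     (auto simp: meas_vecD(2)[OF assms(2)] assms(1)
        intro!: borel_measurable_times meas_vecD(1,3)[OF assms(2)])

lemma meas_scalar_prod:
  assumes "meas_vec F n v" "meas_vec F n v'"
  shows "(\<lambda>w. v w \<bullet> v' w) \<in> borel_measurable F"
proof -
  have "(\<lambda>w. \<Sum>l<n. v w $ l * v' w $ l) \<in> borel_measurable F"
    by (intro borel_measurable_sum borel_measurable_times meas_vecD(3)[OF assms(1)] meas_vecD(3)[OF assms(2)]) auto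
  moreover have "v w \<bullet> v' w = (\<Sum>l<n. v w $ l * v' w $ l)" if "w \<in> space F" for w
    using meas_vecD(2)[OF assms(2) that] by (simp add: scalar_prod_def atLeast0LessThan)
  ultimately show ?thesis by (simp cong: measurable_cong)
qed

lemma meas_mat_mult_vec:
  assumes "meas_mat F n A" "meas_vec F n v"
  shows "meas_vec F n (\<lambda>w. A w *\<^sub>v v w)"
proof (rule meas_vecI[where e = "\<lambda>i w. \<Sum>j<n. A w $$ (i, j) * v w $ j"])
  show "A w *\<^sub>v v w \<in> carrier_vec n" if "w \<in> space F" for w
    using meas_matD(1)[OF assms(1) that] meas_vecD(1)[OF assms(2) that] by auto
  show "(A w *\<^sub>v v w) $ l = (\<Sum>j<n. A w $$ (l, j) * v w $ j)" if "l < n" "w \<in> space F" for l w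
    using meas_matD(1)[OF assms(1) that(2)] meas_vecD(1)[OF assms(2) that(2)] that(1)
    by (simp add: scalar_prod_def atLeast0LessThan)
qed (auto intro!: borel_measurable_sum borel_measurable_times meas_vecD(3)[OF assms(2)] meas_matD(4)[OF assms(1)])

lemma meas_mat_add:
  assumes "meas_mat F n A" "meas_mat F n B"
  shows "meas_mat F n (\<lambda>w. A w + B w)"
  by (rule meas_matI[where e = "\<lambda>i j w. A w $$ (i, j) + B w $$ (i, j)"])
     (use meas_matD[OF assms(1)] meas_matD[OF assms(2)] in auto)

lemma meas_mat_minus:
  assumes "meas_mat F n A" "meas_mat F n B"
  shows "meas_mat F n (\<lambda>w. A w - B w)"
  by (rule meas_matI[where e = "\<lambda>i j w. A w $$ (i, j) - B w $$ (i, j)"])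
     (use meas_matD[OF assms(1)] meas_matD[OF assms(2)] in auto)

lemma meas_mat_smult:
  assumes "c \<in> borel_measurable F" "meas_mat F n A"
  shows "meas_mat F n (\<lambda>w. c w \<cdot>\<^sub>m A w)"
  by (rule meas_matI[where e = "\<lambda>i j w. c w * A w $$ (i, j)"]) (use meas_matD[OF assms(2)] assms(1) in auto)

lemma meas_mat_mult:
  assumes "meas_mat F n A" "meas_mat F n B"
  shows "meas_mat F n (\<lambda>w. A w * B w)"
proof (rule meas_matI[where e = "\<lambda>i j w. \<Sum>l<n. A w $$ (i, l) * B w $$ (l, j)"])
  show "A w * B w \<in> carrier_mat n n" if "w \<in> space F" for w
    using meas_matD(1)[OF assms(1) that] meas_matD(1)[OF assms(2) that] by auto
  show "(A w * B w) $$ (i, j) = (\<Sum>l<n. A w $$ (i, l) * B w $$ (l, j))" if "i < n" "j < n" "w \<in> space F" for i j w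
    using meas_matD(1)[OF assms(1) that(3)] meas_matD(1)[OF assms(2) that(3)] that(1,2)
    by (simp add: scalar_prod_def atLeast0LessThan)
qed (auto intro!: borel_measurable_sum borel_measurable_times meas_matD(4)[OF assms(1)] meas_matD(4)[OF assms(2)])

lemma meas_det:
  assumes "meas_mat F n A"
  shows "(\<lambda>w. det (A w)) \<in> borel_measurable F"
proof -
  have "(\<lambda>w. \<Sum>q\<in>{q. q permutes {0..<n}}. signof q * (\<Prod>i = 0..<n. A w $$ (i, q i))) \<in> borel_measurable F"
  proof (intro borel_measurable_sum borel_measurable_times borel_measurable_prod borel_measurable_const)
    fix q i assume q: "q \<in> {q. q permutes {0..<n}}" and i: "i \<in> {0..<n}"
    then have "q i < n" using permutes_in_image[of q "{0..<n}" i] by auto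
    then show "(\<lambda>w. A w $$ (i, q i)) \<in> borel_measurable F" using i by (auto intro!: meas_matD(4)[OF assms])
  qed
  moreover have "det (A w) = (\<Sum>q\<in>{q. q permutes {0..<n}}. signof q * (\<Prod>i = 0..<n. A w $$ (i, q i)))"
    if "w \<in> space F" for w
    by (rule det_def'[OF meas_matD(1)[OF assms that]])
  ultimately show ?thesis by (simp cong: measurable_cong)
qed

lemma meas_mat_delete:
  assumes "meas_mat F n A" "i < n" "j < n"
  shows "meas_mat F (n - 1) (\<lambda>w. mat_delete (A w) i j)"
proof (rule meas_matI[where e = "\<lambda>i' j' w. A w $$ (if i' < i then i' else Suc i', if j' < j then j' else Suc j')"])
  show "mat_delete (A w) i j \<in> carrier_mat (n - 1) (n - 1)" if "w \<in> space F" for w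
    by (rule mat_delete_carrier[OF meas_matD(1)[OF assms(1) that]])
  show "mat_delete (A w) i j $$ (i', j') = A w $$ (if i' < i then i' else Suc i', if j' < j then j' else Suc j')"
    if "i' < n - 1" "j' < n - 1" "w \<in> space F" for i' j' w
    using meas_matD(2,3)[OF assms(1) that(3)] that(1,2) by (simp add: mat_delete_def)
  show "(\<lambda>w. A w $$ (if i' < i then i' else Suc i', if j' < j then j' else Suc j')) \<in> borel_measurable F"
    if "i' < n - 1" "j' < n - 1" for i' j'
    using that by (intro meas_matD(4)[OF assms(1)]) auto
qed

lemma meas_inv_mat:
  assumes A: "meas_mat F n A" and pd: "\<And>w. w \<in> space F \<Longrightarrow> pd_mat n (A w)"
  shows "meas_mat F n (\<lambda>w. inv_mat n (A w))"
proof (rule meas_matI[where e = "\<lambda>i j w. 1 / det (A w) * ((- 1) ^ (j + i) * det (mat_delete (A w) j i))"])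
  show "inv_mat n (A w) \<in> carrier_mat n n" if "w \<in> space F" for w
    by (rule pd_inv_mat(1)[OF pd[OF that]])
  show "inv_mat n (A w) $$ (i, j) = 1 / det (A w) * ((- 1) ^ (j + i) * det (mat_delete (A w) j i))"
    if "i < n" "j < n" "w \<in> space F" for i j w
    using inv_mat_eq_adj_mat[OF meas_matD(1)[OF A that(3)] pd_det_nonzero[OF pd[OF that(3)]]] that(1,2)
      meas_matD(2,3)[OF A that(3)]
    by (simp add: adj_mat_def cofactor_def)
  show "(\<lambda>w. 1 / det (A w) * ((- 1) ^ (j + i) * det (mat_delete (A w) j i))) \<in> borel_measurable F"
    if "i < n" "j < n" for i j
    using meas_det[OF A] meas_det[OF meas_mat_delete[OF A that(2,1)]] by simp
qed

lemma meas_mat_bound: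
  assumes "meas_mat F n A"
  shows "(\<lambda>w. mat_bound (A w)) \<in> borel_measurable F"
proof -
  have "(\<lambda>w. 1 + (\<Sum>i<n. \<Sum>j<n. \<bar>A w $$ (i, j)\<bar>)) \<in> borel_measurable F"
    by (intro borel_measurable_sum borel_measurable_add borel_measurable_abs borel_measurable_const
        meas_matD(4)[OF assms]) auto
  then show ?thesis
    by (simp add: mat_bound_def meas_matD(2,3)[OF assms] cong: measurable_cong)
qed

lemma meas_sqrt_approx:
  assumes A: "meas_mat F n A"
  shows "meas_mat F n (\<lambda>w. sqrt_approx n (A w) k)"
proof -
  define X where "X = (\<lambda>w. 1\<^sub>m n - (1 / mat_bound (A w)) \<cdot>\<^sub>m A w)"
  have X: "meas_mat F n X"
    unfolding X_def using meas_mat_bound[OF A] by (intro meas_mat_minus meas_mat_const meas_mat_smult A) auto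
  have "meas_mat F n (\<lambda>w. sqrt_iter n (X w) k)"
    by (induction k) (auto intro!: meas_mat_const meas_mat_smult meas_mat_add meas_mat_mult X)
  then show ?thesis
    unfolding sqrt_approx_def X_def using meas_mat_bound[OF A]
    by (intro meas_mat_minus meas_mat_const meas_mat_smult) auto
qed

lemma meas_sqrt_mat:
  assumes A: "meas_mat F n A" and pd: "\<And>w. w \<in> space F \<Longrightarrow> pd_mat n (A w)"
  shows "meas_mat F n (\<lambda>w. sqrt_mat n (A w))"
  unfolding meas_mat_def
proof (intro conjI ballI allI impI)
  show "sqrt_mat n (A w) \<in> carrier_mat n n" if "w \<in> space F" for w
    using pd_sqrt_mat(1)[OF pd[OF that]] pd_matD(1) by blast
  show "(\<lambda>w. sqrt_mat n (A w) $$ (i, j)) \<in> borel_measurable F" if "i < n" "j < n" for i j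
    by (rule borel_measurable_LIMSEQ_real[where u = "\<lambda>k w. sqrt_approx n (A w) k $$ (i, j)"])
       (use that pd_sqrt_mat(3)[OF pd] meas_matD(4)[OF meas_sqrt_approx[OF A]] in auto)
qed

lemma meas_vec_stack:
  assumes d: "0 < d" and x: "\<And>k. 1 \<le> k \<Longrightarrow> k \<le> i \<Longrightarrow> meas_vec F d (\<lambda>w. x w k)"
  shows "meas_vec F (i * d) (\<lambda>w. stack (x w) i)"
proof (rule meas_vecI[where e = "\<lambda>m w. x w (m div d + 1) $ (m mod d)"])
  show "stack (x w) i \<in> carrier_vec (i * d)" if "w \<in> space F" for w
    using that by (intro stack_carrier meas_vecD(1)[OF x]) auto
  show "stack (x w) i $ m = x w (m div d + 1) $ (m mod d)" if "m < i * d" "w \<in> space F" for m w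
    using that by (intro stack_index[where d = d] meas_vecD(1)[OF x]) auto
  show "(\<lambda>w. x w (m div d + 1) $ (m mod d)) \<in> borel_measurable F" if "m < i * d" for m
    using d that by (intro meas_vecD(3)[OF x]) (auto simp: less_mult_imp_div_less Suc_le_eq)
qed

lemma meas_vec_vsum:
  assumes "\<And>a. a \<in> A \<Longrightarrow> meas_vec F d (\<lambda>w. g w a)"
  shows "meas_vec F d (\<lambda>w. vsum d (g w) A)"
  by (rule meas_vecI[where e = "\<lambda>l w. \<Sum>a\<in>A. g w a $ l"])
     (auto simp: vsum_def intro!: borel_measurable_sum meas_vecD(3)[OF assms])

lemma lipschitz_meas_vec:
  "lipschitz_vec n g C \<Longrightarrow> meas_vec F n v \<Longrightarrow> (\<lambda>w. g (v w)) \<in> borel_measurable F"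
  by (rule lipschitz_vec_measurable) (auto intro: meas_vecD)

subsection \<open>Conditioning on an independent sub-sigma-algebra\<close>

lemma (in prob_space) integral_freeze:
  fixes Phi :: "'a \<Rightarrow> 'b \<Rightarrow> real"
  assumes rv: "(\<lambda>w. w) \<in> M \<rightarrow>\<^sub>M F" "Y \<in> M \<rightarrow>\<^sub>M Q"
    and ind: "\<And>A B. A \<in> sets F \<Longrightarrow> B \<in> sets Q \<Longrightarrow>
      prob (A \<inter> (Y -` B \<inter> space M)) = prob A * prob (Y -` B \<inter> space M)"
    and m: "(\<lambda>(w, y). Phi w y) \<in> borel_measurable (F \<Otimes>\<^sub>M Q)"
    and i: "integrable M (\<lambda>w. Phi w (Y w))"
  shows "integrable M (\<lambda>w. \<integral>y. Phi w y \<partial>distr M Q Y)"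
    and "(\<integral>w. Phi w (Y w) \<partial>M) = (\<integral>w. (\<integral>y. Phi w y \<partial>distr M Q Y) \<partial>M)"
proof -
  interpret FF: prob_space "distr M F (\<lambda>w. w)" by (rule prob_space_distr[OF rv(1)])
  interpret QQ: prob_space "distr M Q Y" by (rule prob_space_distr[OF rv(2)])
  interpret P: pair_sigma_finite "distr M F (\<lambda>w. w)" "distr M Q Y" ..
  have pm: "(\<lambda>x. (x, Y x)) \<in> M \<rightarrow>\<^sub>M F \<Otimes>\<^sub>M Q" using rv by simp
  have eq: "distr M F (\<lambda>w. w) \<Otimes>\<^sub>M distr M Q Y = distr M (F \<Otimes>\<^sub>M Q) (\<lambda>x. (x, Y x))"
  proof (rule pair_measure_eqI)
    show "sigma_finite_measure (distr M F (\<lambda>w. w))" "sigma_finite_measure (distr M Q Y)"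
      by unfold_locales
    show "sets (distr M F (\<lambda>w. w) \<Otimes>\<^sub>M distr M Q Y) = sets (distr M (F \<Otimes>\<^sub>M Q) (\<lambda>x. (x, Y x)))"
      by (simp cong: sets_pair_measure_cong)
    fix A B assume "A \<in> sets (distr M F (\<lambda>w. w))" "B \<in> sets (distr M Q Y)"
    then have AB: "A \<in> sets F" "B \<in> sets Q" by auto
    have A': "(\<lambda>w. w) -` A \<inter> space M = A \<inter> space M" by auto
    have A: "A \<inter> space M \<in> events" using measurable_sets[OF rv(1) AB(1)] A' by simp
    have "emeasure (distr M F (\<lambda>w. w)) A = prob (A \<inter> space M)"
      using rv(1) AB(1) A' by (simp add: emeasure_distr emeasure_eq_measure)
    moreover have "emeasure (distr M Q Y) B = prob (Y -` B \<inter> space M)"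
      using rv(2) AB(2) by (simp add: emeasure_distr emeasure_eq_measure)
    moreover have "emeasure (distr M (F \<Otimes>\<^sub>M Q) (\<lambda>x. (x, Y x))) (A \<times> B) = prob (A \<inter> (Y -` B \<inter> space M))"
    proof -
      have "(\<lambda>x. (x, Y x)) -` (A \<times> B) \<inter> space M = A \<inter> (Y -` B \<inter> space M)" by auto
      then show ?thesis using pm AB by (simp add: emeasure_distr emeasure_eq_measure)
    qed
    moreover have "prob (A \<inter> space M) = prob A"
    proof -
      have "prob (A \<inter> (Y -` space Q \<inter> space M)) = prob A * prob (Y -` space Q \<inter> space M)"
        by (rule ind[OF AB(1)]) simp
      moreover have "Y -` space Q \<inter> space M = space M" using measurable_space[OF rv(2)] by auto
      ultimately show ?thesis by (simp add: prob_space)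
    qed
    ultimately show "emeasure (distr M F (\<lambda>w. w)) A * emeasure (distr M Q Y) B =
        emeasure (distr M (F \<Otimes>\<^sub>M Q) (\<lambda>x. (x, Y x))) (A \<times> B)"
      using ind[OF AB] by (simp add: ennreal_mult)
  qed
  have int: "integrable (distr M F (\<lambda>w. w) \<Otimes>\<^sub>M distr M Q Y) (\<lambda>(w, y). Phi w y)"
    unfolding eq using integrable_distr_eq[OF pm m] i by simp
  have inner: "(\<lambda>w. \<integral>y. Phi w y \<partial>distr M Q Y) \<in> borel_measurable F"
  proof -
    have "(\<lambda>(w, y). Phi w y) \<in> borel_measurable (F \<Otimes>\<^sub>M distr M Q Y)"
      using m by (simp cong: measurable_cong_sets)
    then show ?thesis by (rule QQ.borel_measurable_lebesgue_integral)
  qed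
  show "integrable M (\<lambda>w. \<integral>y. Phi w y \<partial>distr M Q Y)"
    using P.integrable_fst'[OF int] integrable_distr_eq[OF rv(1) inner] by simp
  have "(\<integral>w. Phi w (Y w) \<partial>M) = (\<integral>x. (case x of (w, y) \<Rightarrow> Phi w y) \<partial>distr M (F \<Otimes>\<^sub>M Q) (\<lambda>x. (x, Y x)))"
    using integral_distr[OF pm m] by simp
  also have "\<dots> = (\<integral>w. (\<integral>y. Phi w y \<partial>distr M Q Y) \<partial>distr M F (\<lambda>w. w))"
    using P.integral_fst'[OF int] eq by simp
  also have "\<dots> = (\<integral>w. (\<integral>y. Phi w y \<partial>distr M Q Y) \<partial>M)"
    by (rule integral_distr[OF rv(1) inner])
  finally show "(\<integral>w. Phi w (Y w) \<partial>M) = (\<integral>w. (\<integral>y. Phi w y \<partial>distr M Q Y) \<partial>M)" .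
qed

subsection \<open>Sample paths\<close>

locale casbo_setting = prob_space M for M :: "'w measure" +
  fixes d K N T :: nat and f :: "nat \<Rightarrow> real vec \<Rightarrow> real" and L :: "nat \<Rightarrow> real"
    and mustar mu1 :: "nat \<Rightarrow> real vec" and Sig1 :: "nat \<Rightarrow> real mat"
    and beta alpha nu :: real
    and Z :: "nat \<times> nat \<times> nat \<times> nat \<Rightarrow> 'w \<Rightarrow> real"
    and c1 c2 :: "nat \<Rightarrow> nat \<Rightarrow> (nat \<times> nat \<times> nat \<times> nat \<Rightarrow> real) \<Rightarrow> real"
    and run :: "'w \<Rightarrow> nat \<Rightarrow> (nat \<Rightarrow> real vec) \<times> (nat \<Rightarrow> real mat)"
  assumes run: "run = casbo_run d K N T f (\<lambda>t. real t * beta) (\<lambda>t. sqrt (real t + 1) * alpha)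
      (\<lambda>t. alpha * nu / (beta * sqrt (real t + 1))) (\<lambda>_. 1) Z c1 c2 mu1 Sig1"
    and dims: "1 \<le> d" "1 \<le> K" "1 \<le> N" "1 \<le> T"
    and conv: "\<And>i. i \<in> {1..K} \<Longrightarrow> convex_on_vec (i * d) (f i)"
    and lip: "\<And>i. i \<in> {1..K} \<Longrightarrow> lipschitz_vec (i * d) (f i) (L i) \<and> 0 \<le> L i"
    and mustar: "\<And>k. k \<in> {1..K} \<Longrightarrow> mustar k \<in> carrier_vec d"
    and init: "\<And>k. k \<in> {1..K} \<Longrightarrow> mu1 k \<in> carrier_vec d \<and> pd_mat d (Sig1 k)"
    and params: "0 < beta" "0 < alpha" "0 < nu"
    and Sig1_norm: "\<And>k. k \<in> {1..K} \<Longrightarrow> 5 / 3 * alpha * nu \<le> 1 / spec_norm d (Sig1 k)"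
    and indep: "indep_vars (\<lambda>_. borel) Z (casbo_index T K N d)"
    and gauss: "\<And>i. i \<in> casbo_index T K N d \<Longrightarrow> distributed M lborel (Z i) std_normal_density"
    and c_meas: "\<And>t k. t \<in> {1..T} \<Longrightarrow> k \<in> {1..K} \<Longrightarrow>
      c1 t k \<in> borel_measurable (PiM UNIV (\<lambda>_. borel)) \<and> c2 t k \<in> borel_measurable (PiM UNIV (\<lambda>_. borel))"
    and C1: "\<And>w t k. w \<in> space M \<Longrightarrow> t \<in> {1..T} \<Longrightarrow> k \<in> {1..K} \<Longrightarrow>
      loewner_le d
        (casbo_H d K N f (fst (run w (t - 1))) (snd (run w (t - 1))) (casbo_z d Z w t)
          (c1 t k (casbo_hist (casbo_index T K N d) Z t w)) (c2 t k (casbo_hist (casbo_index T K N d) Z t w)) k)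
        ((1 / (sqrt (real t + 1) * alpha) * (real (t + 1) * beta / (real t * beta) - 1)) \<cdot>\<^sub>m 1\<^sub>m d
          + (real (t + 1) * beta * (alpha * nu / (beta * sqrt (real t + 1))) / (sqrt (real t + 1) * alpha)) \<cdot>\<^sub>m snd (run w (t - 1)) k)"
    and C2: "\<And>w t k. w \<in> space M \<Longrightarrow> t \<in> {1..T} \<Longrightarrow> k \<in> {1..K} \<Longrightarrow>
      loewner_le d (nu \<cdot>\<^sub>m 1\<^sub>m d)
        (casbo_G d K N f (fst (run w (t - 1))) (snd (run w (t - 1))) (casbo_z d Z w t)
          (c1 t k (casbo_hist (casbo_index T K N d) Z t w)) (c2 t k (casbo_hist (casbo_index T K N d) Z t w)) k)"
begin

text \<open>Indexing: \<open>mu w n\<close> and \<open>Sg w n\<close> are the iterates \<open>\<mu>\<^sup>t\<close>, \<open>\<Sigma>\<^sup>t\<close> with \<open>t = n + 1\<close>, and the samples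
  used to leave them are \<open>zt w (Suc n)\<close>; \<open>bet\<close>, \<open>alph\<close>, \<open>gam\<close> and \<open>pr\<close> take \<open>t\<close>.\<close>

abbreviation "I \<equiv> casbo_index T K N d"
abbreviation "mu w n \<equiv> fst (run w n)"
abbreviation "Sg w n \<equiv> snd (run w n)"
abbreviation "zt \<equiv> casbo_z d Z"
abbreviation "hist \<equiv> casbo_hist I Z"
abbreviation bet :: "nat \<Rightarrow> real" where "bet t \<equiv> real t * beta"
abbreviation alph :: "nat \<Rightarrow> real" where "alph t \<equiv> sqrt (real t + 1) * alpha"
abbreviation gam :: "nat \<Rightarrow> real" where "gam t \<equiv> alpha * nu / (beta * sqrt (real t + 1))"

definition pr :: "nat \<Rightarrow> real" where
  "pr t = alpha * nu * (2 / 3 * (real t * sqrt (real t)) + 1)"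

lemma pr_pos: "0 < pr t"
  using params by (auto simp: pr_def intro!: mult_pos_pos add_nonneg_pos)

lemma pr_Suc: "pr (Suc t) \<le> pr t + alph t * nu"
proof -
  define x where "x = sqrt (real t)"
  define y where "y = sqrt (real t + 1)"
  have xy: "0 \<le> x" "x \<le> y" "0 < y" by (auto simp: x_def y_def)
  have y2: "y\<^sup>2 = x\<^sup>2 + 1" by (simp add: x_def y_def)
  have "y ^ 3 - x ^ 3 = (y - x) * (y\<^sup>2 + x * y + x\<^sup>2)"
    by (simp add: power2_eq_square power3_eq_cube algebra_simps)
  also have "\<dots> \<le> (y - x) * (3 / 2 * y * (y + x))"
  proof (rule mult_left_mono)
    have "x\<^sup>2 \<le> y\<^sup>2" "x\<^sup>2 \<le> x * y" using xy by (auto simp: power2_eq_square intro: mult_mono mult_left_mono)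
    then show "y\<^sup>2 + x * y + x\<^sup>2 \<le> 3 / 2 * y * (y + x)" by (simp add: power2_eq_square algebra_simps)
  qed (use xy in simp)
  also have "\<dots> = 3 / 2 * y * (y\<^sup>2 - x\<^sup>2)" by (simp add: power2_eq_square algebra_simps)
  also have "\<dots> = 3 / 2 * y" unfolding y2 by simp
  finally have "2 / 3 * y ^ 3 \<le> 2 / 3 * x ^ 3 + y" by simp
  moreover have "y ^ 3 = real (Suc t) * sqrt (real (Suc t))" "x ^ 3 = real t * sqrt (real t)"
    by (auto simp: x_def y_def power3_eq_cube add.commute)
  ultimately have "2 / 3 * (real (Suc t) * sqrt (real (Suc t))) + 1 \<le> (2 / 3 * (real t * sqrt (real t)) + 1) + y" by simp
  then have "alpha * nu * (2 / 3 * (real (Suc t) * sqrt (real (Suc t))) + 1) \<le>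
      alpha * nu * ((2 / 3 * (real t * sqrt (real t)) + 1) + y)" using params by (intro mult_left_mono) auto
  then show ?thesis by (simp add: pr_def y_def algebra_simps)
qed

lemma run_0: "mu w 0 = mu1" "Sg w 0 = Sig1"
  by (simp_all add: run casbo_run_def)

lemma mu_Suc: "mu w (Suc n) k = mu w n k - bet (Suc n) \<cdot>\<^sub>v (Sg w n k *\<^sub>v (gam (Suc n) \<cdot>\<^sub>v mu w n k +
    vsum d (\<lambda>i. casbo_ghat d N f (mu w n) (Sg w n) (zt w (Suc n)) i k) {k..K}))"
  and Sg_Suc: "Sg w (Suc n) k = inv_mat d (1 \<cdot>\<^sub>m inv_mat d (Sg w n k) +
    alph (Suc n) \<cdot>\<^sub>m casbo_G d K N f (mu w n) (Sg w n) (zt w (Suc n))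
      (c1 (Suc n) k (hist (Suc n) w)) (c2 (Suc n) k (hist (Suc n) w)) k)"
  by (simp_all add: run casbo_run_def casbo_step_def Let_def)

lemma iterate_0: "casbo_iterate d K N f L (mu w 0) (Sg w 0) (zt w (Suc 0)) (pr (Suc 0))"
proof (unfold_locales, goal_cases)
  case (6 k x)
  then have "5 / 3 * alpha * nu * (vnorm x)\<^sup>2 \<le> wnorm_sq (inv_mat d (Sig1 k)) x"
    using init Sig1_norm params by (intro spec_norm_imp_precision_ge) auto
  then show ?case by (simp add: pr_def run_0)
qed (use dims lip init pr_pos in \<open>auto simp: run_0 casbo_z_def\<close>)

lemma casbo_iterate_Suc:
  assumes w: "w \<in> space M" and n: "n < T"
    and it: "casbo_iterate d K N f L (mu w n) (Sg w n) (zt w (Suc n)) (pr (Suc n))"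
  shows "casbo_iterate d K N f L (mu w (Suc n)) (Sg w (Suc n)) (zt w (Suc (Suc n))) (pr (Suc (Suc n)))"
    and "\<And>k x. k \<in> {1..K} \<Longrightarrow> x \<in> carrier_vec d \<Longrightarrow> wnorm_sq (inv_mat d (Sg w (Suc n) k)) x \<le>
      bet (Suc n + 1) / bet (Suc n) * wnorm_sq (inv_mat d (Sg w n k)) x + bet (Suc n + 1) * gam (Suc n) * (vnorm x)\<^sup>2"
proof -
  interpret it: casbo_iterate d K N f L "mu w n" "Sg w n" "zt w (Suc n)" "pr (Suc n)" by (rule it)
  have t: "Suc n \<in> {1..T}" using n by auto
  have al: "0 < alph (Suc n)" using params by (simp add: add_pos_pos)
  note ps = it.precision_step[OF _ al params(3), OF _ C1[OF w t, simplified diff_Suc_1] C2[OF w t, simplified diff_Suc_1]]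
  have P: "pd_mat d (Sg w (Suc n) k)"
    "\<And>x. x \<in> carrier_vec d \<Longrightarrow> (pr (Suc n) + alph (Suc n) * nu) * (vnorm x)\<^sup>2 \<le> wnorm_sq (inv_mat d (Sg w (Suc n) k)) x"
    "\<And>x. x \<in> carrier_vec d \<Longrightarrow> wnorm_sq (inv_mat d (Sg w (Suc n) k)) x \<le>
      (1 + (bet (Suc n + 1) / bet (Suc n) - 1)) * wnorm_sq (inv_mat d (Sg w n k)) x + bet (Suc n + 1) * gam (Suc n) * (vnorm x)\<^sup>2"
    if k: "k \<in> {1..K}" for k
    unfolding Sg_Suc using ps(1,3,4)[OF k k k] by blast+
  show "casbo_iterate d K N f L (mu w (Suc n)) (Sg w (Suc n)) (zt w (Suc (Suc n))) (pr (Suc (Suc n)))"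
  proof (unfold_locales, goal_cases)
    case (3 k)
    have "gam (Suc n) \<cdot>\<^sub>v mu w n k + vsum d (\<lambda>i. casbo_ghat d N f (mu w n) (Sg w n) (zt w (Suc n)) i k) {k..K} \<in> carrier_vec d"
      using it.mu[OF 3] by (auto simp: vsum_def)
    then show ?case
      unfolding mu_Suc using it.mu[OF 3] pd_matD(1)[OF it.Sig[OF 3]]
      by (auto intro!: minus_carrier_vec smult_carrier_vec mult_mat_vec_carrier[of _ d d])
  next
    case (6 k x)
    have "pr (Suc (Suc n)) * (vnorm x)\<^sup>2 \<le> (pr (Suc n) + alph (Suc n) * nu) * (vnorm x)\<^sup>2"
      by (rule mult_right_mono[OF pr_Suc]) simp
    then show ?case using P(2)[OF 6] by linarith
  qed (use dims lip P(1) pr_pos in \<open>auto simp: casbo_z_def\<close>)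
  show "wnorm_sq (inv_mat d (Sg w (Suc n) k)) x \<le>
      bet (Suc n + 1) / bet (Suc n) * wnorm_sq (inv_mat d (Sg w n k)) x + bet (Suc n + 1) * gam (Suc n) * (vnorm x)\<^sup>2"
    if "k \<in> {1..K}" "x \<in> carrier_vec d" for k x
    using P(3)[OF that] by simp
qed

lemma iterate:
  assumes "w \<in> space M" "n \<le> T"
  shows "casbo_iterate d K N f L (mu w n) (Sg w n) (zt w (Suc n)) (pr (Suc n))"
  using assms(2)
proof (induction n)
  case 0
  show ?case by (rule iterate_0)
next
  case (Suc n)
  then show ?case by (intro casbo_iterate_Suc(1)[OF assms(1)]) auto
qed

definition zb :: "'w \<Rightarrow> nat \<Rightarrow> nat \<Rightarrow> nat \<Rightarrow> real vec" where
  "zb w n i j = stack (\<lambda>k. zt w (Suc n) k j) i"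

definition Dw :: "'w \<Rightarrow> nat \<Rightarrow> nat \<Rightarrow> real mat" where
  "Dw w n i = bdiag d (\<lambda>k. sqrt_mat d (Sg w n k)) i"

definition aw :: "'w \<Rightarrow> nat \<Rightarrow> nat \<Rightarrow> real vec" where
  "aw w n i = stack (\<lambda>k. inv_mat d (sqrt_mat d (Sg w n k)) *\<^sub>v (mu w n k - mustar k)) i"

definition Phi :: "'w \<Rightarrow> nat \<Rightarrow> nat \<Rightarrow> real vec \<Rightarrow> real" where
  "Phi w n i z = (f i (stack (mu w n) i + Dw w n i *\<^sub>v z) - f i (stack (mu w n) i)) * (aw w n i \<bullet> z)"

definition Gw :: "'w \<Rightarrow> nat \<Rightarrow> real" where
  "Gw w n = (\<Sum>i\<in>{1..K}. 1 / real N * (\<Sum>j\<in>{1..N}. Phi w n i (zb w n i j)))"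

definition hw :: "'w \<Rightarrow> nat \<Rightarrow> real" where
  "hw w n = real K * (\<Sum>i\<in>{1..K}. (L i)\<^sup>2 * (1 / real N * (\<Sum>j\<in>{1..N}. vnorm (zb w n i j) ^ 4)))"

definition Vw :: "'w \<Rightarrow> nat \<Rightarrow> real" where
  "Vw w n = (\<Sum>k\<in>{1..K}. wnorm_sq (inv_mat d (Sg w n k)) (mu w n k - mustar k))"

definition Ww :: "'w \<Rightarrow> nat \<Rightarrow> real" where
  "Ww w n = (\<Sum>k\<in>{1..K}. wnorm_sq (inv_mat d (Sg w n k)) (mu w (Suc n) k - mustar k))"

definition Bs :: real where
  "Bs = (\<Sum>k\<in>{1..K}. (vnorm (mustar k))\<^sup>2)"

definition Mw :: "'w \<Rightarrow> nat \<Rightarrow> real" where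
  "Mw w n = (\<Sum>k\<in>{1..K}. (vnorm (mu w n k))\<^sup>2)"

definition Xw :: "'w \<Rightarrow> nat \<Rightarrow> real" where
  "Xw w n = (\<Sum>k\<in>{1..K}. (vnorm (mu w n k - mustar k))\<^sup>2)"

lemma nonneg: "0 \<le> Bs" "0 \<le> Mw w n" "0 \<le> Xw w n" "0 \<le> hw w n"
  by (auto simp: Bs_def Mw_def Xw_def hw_def intro!: sum_nonneg mult_nonneg_nonneg divide_nonneg_nonneg)

lemma path_facts:
  assumes w: "w \<in> space M" and n: "n < T"
  shows path_step: "\<And>th. 0 < th \<Longrightarrow> Ww w n \<le> Vw w n - 2 * bet (Suc n) * Gw w n
      - bet (Suc n) * gam (Suc n) * (Mw w n + Xw w n - Bs)
      + (bet (Suc n))\<^sup>2 * ((1 + th) * (gam (Suc n))\<^sup>2 * (1 / pr (Suc n)) * Mw w n + (1 + 1 / th) * (1 / pr (Suc n)) * hw w n)"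
    and path_V: "Vw w (Suc n) \<le> bet (Suc n + 1) / bet (Suc n) * Ww w n + bet (Suc n + 1) * gam (Suc n) * Xw w (Suc n)"
    and path_X: "pr (Suc n) * Xw w n \<le> Vw w n"
    and path_X': "pr (Suc n) * Xw w (Suc n) \<le> Ww w n"
    and path_G: "- 2 * Gw w n \<le> Vw w n + 1 / pr (Suc n) * hw w n"
    and path_XM: "\<And>c. 0 < c \<Longrightarrow> Xw w n \<le> (1 + c) * Mw w n + (1 + 1 / c) * Bs"
    and path_M: "Mw w n \<le> 2 * Xw w n + 2 * Bs"
proof -
  interpret it: casbo_iterate d K N f L "mu w n" "Sg w n" "zt w (Suc n)" "pr (Suc n)"
    using iterate[OF w] n by simp
  interpret it': casbo_iterate d K N f L "mu w (Suc n)" "Sg w (Suc n)" "zt w (Suc (Suc n))" "pr (Suc (Suc n))"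
    using iterate[OF w] n by simp
  have Geq: "Gw w n = (\<Sum>i\<in>{1..K}. 1 / real N * (\<Sum>j\<in>{1..N}.
      it.Del i j * (stack (\<lambda>k. inv_mat d (sqrt_mat d (Sg w n k)) *\<^sub>v (mu w n k - mustar k)) i \<bullet> stack (\<lambda>k. zt w (Suc n) k j) i)))"
    by (simp add: Gw_def Phi_def it.Del_def zb_def Dw_def aw_def)
  have heq: "hw w n = it.zmoment" by (simp add: hw_def it.zmoment_def zb_def)
  show "Ww w n \<le> Vw w n - 2 * bet (Suc n) * Gw w n
      - bet (Suc n) * gam (Suc n) * (Mw w n + Xw w n - Bs)
      + (bet (Suc n))\<^sup>2 * ((1 + th) * (gam (Suc n))\<^sup>2 * (1 / pr (Suc n)) * Mw w n + (1 + 1 / th) * (1 / pr (Suc n)) * hw w n)"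
    if "0 < th" for th
    using it.descent_step[OF mustar that, where b = "bet (Suc n)" and g = "gam (Suc n)"]
    unfolding Ww_def Vw_def Geq Mw_def Xw_def Bs_def heq mu_Suc .
  have x: "mu w n k - mustar k \<in> carrier_vec d" "mu w (Suc n) k - mustar k \<in> carrier_vec d" if "k \<in> {1..K}" for k
    using it.mu[OF that] it'.mu[OF that] mustar[OF that] by auto
  have "Vw w (Suc n) \<le> (\<Sum>k\<in>{1..K}. bet (Suc n + 1) / bet (Suc n) * wnorm_sq (inv_mat d (Sg w n k)) (mu w (Suc n) k - mustar k)
      + bet (Suc n + 1) * gam (Suc n) * (vnorm (mu w (Suc n) k - mustar k))\<^sup>2)"
    unfolding Vw_def by (intro sum_mono casbo_iterate_Suc(2)[OF w n it.casbo_iterate_axioms] x)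
  also have "\<dots> = bet (Suc n + 1) / bet (Suc n) * Ww w n + bet (Suc n + 1) * gam (Suc n) * Xw w (Suc n)"
    unfolding Ww_def Xw_def sum.distrib sum_distrib_left ..
  finally show "Vw w (Suc n) \<le> bet (Suc n + 1) / bet (Suc n) * Ww w n + bet (Suc n + 1) * gam (Suc n) * Xw w (Suc n)" .
  show "pr (Suc n) * Xw w n \<le> Vw w n" "pr (Suc n) * Xw w (Suc n) \<le> Ww w n"
    unfolding Xw_def Vw_def Ww_def sum_distrib_left by (intro sum_mono it.prec x; assumption)+
  show "- 2 * Gw w n \<le> Vw w n + 1 / pr (Suc n) * hw w n"
  proof -
    let ?a = "\<lambda>k. inv_mat d (sqrt_mat d (Sg w n k)) *\<^sub>v (mu w n k - mustar k)"
    have a: "?a k \<in> carrier_vec d" if "k \<in> {1..K}" for k using it.R_carrier[OF that] x[OF that] by auto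
    have G: "Gw w n = (\<Sum>k\<in>{1..K}. ?a k \<bullet> it.u k)" unfolding Geq using it.sum_scalar_prod_u[of ?a, OF a] by simp
    have "- 2 * Gw w n = (\<Sum>k\<in>{1..K}. - 2 * (?a k \<bullet> it.u k))" unfolding G sum_distrib_left ..
    also have "\<dots> \<le> (\<Sum>k\<in>{1..K}. wnorm_sq (inv_mat d (Sg w n k)) (mu w n k - mustar k) + it.u k \<bullet> it.u k)"
    proof (rule sum_mono)
      fix k assume k: "k \<in> {1..K}"
      have "- (?a k \<bullet> it.u k) \<le> vnorm (?a k) * vnorm (it.u k)"
        using abs_scalar_prod_le_vnorm[OF a[OF k] it.u_carrier[of k]] by linarith
      moreover have "2 * vnorm (?a k) * vnorm (it.u k) \<le> (vnorm (?a k))\<^sup>2 + (vnorm (it.u k))\<^sup>2"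
        by (rule sum_squares_bound)
      moreover have "wnorm_sq (inv_mat d (Sg w n k)) (mu w n k - mustar k) = (vnorm (?a k))\<^sup>2"
        unfolding vnorm_sq by (rule pd_sqrt_inv(3)[OF it.Sig[OF k] x(1)[OF k]])
      ultimately show "- 2 * (?a k \<bullet> it.u k) \<le>
          wnorm_sq (inv_mat d (Sg w n k)) (mu w n k - mustar k) + it.u k \<bullet> it.u k"
        by (simp add: vnorm_sq)
    qed
    also have "\<dots> = Vw w n + (\<Sum>k\<in>{1..K}. it.u k \<bullet> it.u k)" unfolding Vw_def sum.distrib ..
    finally show ?thesis using it.sum_vnorm_u_le unfolding heq by linarith
  qed
  show "Xw w n \<le> (1 + c) * Mw w n + (1 + 1 / c) * Bs" if "0 < c" for c
    unfolding Xw_def Mw_def Bs_def sum_distrib_left sum.distrib[symmetric]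
    by (rule sum_mono) (rule vnorm_sq_minus_le[OF it.mu mustar that])
  have "Mw w n \<le> (\<Sum>k\<in>{1..K}. 2 * (vnorm (mu w n k - mustar k))\<^sup>2 + 2 * (vnorm (mustar k))\<^sup>2)"
    unfolding Mw_def
  proof (rule sum_mono)
    fix k assume k: "k \<in> {1..K}"
    have "mu w n k = mustar k - (mustar k - mu w n k)" using it.mu[OF k] mustar[OF k] by auto
    then have "(vnorm (mu w n k))\<^sup>2 \<le> (1 + 1) * (vnorm (mustar k))\<^sup>2 + (1 + 1 / 1) * (vnorm (mustar k - mu w n k))\<^sup>2"
      using vnorm_sq_minus_le[of "mustar k" d "mustar k - mu w n k" 1] it.mu[OF k] mustar[OF k] by simp
    then show "(vnorm (mu w n k))\<^sup>2 \<le> 2 * (vnorm (mu w n k - mustar k))\<^sup>2 + 2 * (vnorm (mustar k))\<^sup>2"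
      using vnorm_minus_commute[OF mustar[OF k] it.mu[OF k]] by simp
  qed
  then show "Mw w n \<le> 2 * Xw w n + 2 * Bs"
    unfolding Xw_def Bs_def sum_distrib_left sum.distrib .
qed

lemma path_bound:
  assumes w: "w \<in> space M"
  shows "(\<Sum>t\<in>{1..T}. Gw w (t - 1)) \<le> Vw w 0 / (2 * beta) +
    (\<Sum>t\<in>{1..T}. 3 * beta / (2 * (alpha * nu)) * (hw w (t - 1) / sqrt (real t)))
    + sqrt (real T + 2) * (alpha * nu * Bs / beta)"
proof -
  have W: "0 \<le> Ww w n" if "n < T" for n
  proof -
    have "0 \<le> pr (Suc n) * Xw w (Suc n)" using nonneg(3) pr_pos[of "Suc n"] by simp
    also have "\<dots> \<le> Ww w n" using path_X'[OF w that] .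
    finally show ?thesis .
  qed
  have prl: "1 / pr t = 1 / (alpha * nu * (2 / 3 * (real t * sqrt (real t)) + 1))" for t by (simp add: pr_def)
  have "(\<Sum>t\<in>{1..T}. Gw w (t - 1)) \<le> Vw w (1 - 1) / (2 * beta) +
    (\<Sum>t\<in>{1..T}. 3 * beta / (2 * (alpha * nu)) * (hw w (t - 1) / sqrt (real t)))
    + sqrt (real T + 2) * (alpha * nu * Bs / beta)"
  proof (rule descent_telescope[where V = "\<lambda>t. Vw w (t - 1)" and W = "\<lambda>t. Ww w (t - 1)"
        and D = "\<lambda>t. Xw w (t - 1)" and Mm = "\<lambda>t. Mw w (t - 1)" and beta = beta and an = "alpha * nu"])
    show "1 \<le> T" "0 < beta" "0 < alpha * nu" "0 \<le> Bs" using dims params nonneg by auto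
    show "0 \<le> Mw w (t - 1)" "0 \<le> Xw w (t - 1)" for t by (rule nonneg)+
    show "0 \<le> Ww w (T - 1)" using W[of "T - 1"] dims by simp
    fix t assume t: "t \<in> {1..T}"
    then obtain n where n: "t = Suc n" "n < T" by (cases t) auto
    show "Xw w (t - 1) \<le> 7 / 4 * Mw w (t - 1) + 7 / 3 * Bs"
      using path_XM[OF w n(2), of "3 / 4"] by (simp add: n)
    have "0 < real t * sqrt (real t) / (real t * sqrt (real t) + 3)"
      using t by (intro divide_pos_pos add_pos_pos) auto
    from path_step[OF w n(2) this]
    show "Ww w (t - 1) \<le> Vw w (t - 1) - 2 * (real t * beta) * Gw w (t - 1) -
       real t * beta * (alpha * nu / (beta * sqrt (real t + 1))) * (Mw w (t - 1) + Xw w (t - 1) - Bs) +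
       (real t * beta)\<^sup>2 * ((1 + real t * sqrt (real t) / (real t * sqrt (real t) + 3)) *
          (alpha * nu / (beta * sqrt (real t + 1)))\<^sup>2 * (1 / (alpha * nu * (2 / 3 * (real t * sqrt (real t)) + 1))) * Mw w (t - 1) +
         (1 + 1 / (real t * sqrt (real t) / (real t * sqrt (real t) + 3))) *
          (1 / (alpha * nu * (2 / 3 * (real t * sqrt (real t)) + 1))) * hw w (t - 1))"
      unfolding prl n(1) diff_Suc_1 .
  next
    fix t assume t: "t \<in> {1..<T}"
    then obtain n where n: "t = Suc n" "n < T" by (cases t) auto
    have b: "0 < bet (t + 1)" using params by simp
    have "Vw w t / bet (t + 1) \<le> (bet (t + 1) / bet t * Ww w n + bet (t + 1) * gam t * Xw w t) / bet (t + 1)"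
      using path_V[OF w n(2)] b by (intro divide_right_mono) (auto simp: n)
    also have "\<dots> = Ww w n / bet t + gam t * Xw w t"
    proof -
      have "(X / Y * W1 + X * g * D1) / X = W1 / Y + g * D1" if "0 < X" for X Y W1 g D1 :: real
        using that by (simp add: add_divide_distrib)
      from this[OF b] show ?thesis .
    qed
    finally show "Vw w (t + 1 - 1) / (real (t + 1) * beta) \<le>
        Ww w (t - 1) / (real t * beta) + alpha * nu / (beta * sqrt (real t + 1)) * Xw w (t + 1 - 1)"
      by (simp add: n)
  qed
  then show ?thesis by simp
qed

end

subsection \<open>Integrability\<close>

lemma le_one_plus_square: "x \<le> 1 + x\<^sup>2" for x :: real
proof -
  have "2 * x \<le> 1 + x\<^sup>2" using sum_squares_bound[of 1 x] by simp
  then show ?thesis using zero_le_power2[of x] by linarith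
qed

context casbo_setting
begin

lemma finite_I: "finite I"
  by (simp add: casbo_index_def)

lemma Z_meas: "i \<in> I \<Longrightarrow> Z i \<in> borel_measurable M"
  using gauss[of i] by (auto simp: distributed_def)

lemma distr_Z: "i \<in> I \<Longrightarrow> distr M borel (Z i) = std_normal"
proof -
  assume "i \<in> I"
  then have "distr M lborel (Z i) = std_normal" using gauss by (auto simp: distributed_def)
  then show ?thesis by (simp cong: distr_cong)
qed

lemma distr_Z_PiM:
  assumes "J \<subseteq> I" "J \<noteq> {}"
  shows "distr M (PiM J (\<lambda>_. borel)) (\<lambda>w. \<lambda>i\<in>J. Z i w) = gaussian J"
proof -
  have rv: "random_variable borel (Z i)" if "i \<in> J" for i using assms(1) Z_meas that by blast
  have "distr M (PiM J (\<lambda>_. borel)) (\<lambda>w. \<lambda>i\<in>J. Z i w) = PiM J (\<lambda>i. distr M borel (Z i))"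
    using indep_vars_iff_distr_eq_PiM'[where I = J and M' = "\<lambda>_. borel" and X = Z, OF assms(2) rv]
      indep_vars_subset[OF indep assms(1)] by blast
  also have "\<dots> = gaussian J" using assms distr_Z by (intro PiM_cong) auto
  finally show ?thesis .
qed

definition zs :: "'w \<Rightarrow> real" where
  "zs w = (\<Sum>i\<in>I. \<bar>Z i w\<bar>)"

lemma zs_nonneg: "0 \<le> zs w"
  by (simp add: zs_def sum_nonneg)

lemma integrable_exp_zs: "integrable M (\<lambda>w. exp (c * zs w))"
proof -
  have "(1, 1, 1, 0) \<in> I" using dims by (auto simp: casbo_index_def)
  then have "I \<noteq> {}" by blast
  then have D: "distr M (PiM I (\<lambda>_. borel)) (\<lambda>w. \<lambda>i\<in>I. Z i w) = gaussian I" by (intro distr_Z_PiM) auto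
  have m: "(\<lambda>w. \<lambda>i\<in>I. Z i w) \<in> M \<rightarrow>\<^sub>M PiM I (\<lambda>_. borel)"
    by (intro measurable_restrict Z_meas)
  have "integrable (distr M (PiM I (\<lambda>_. borel)) (\<lambda>w. \<lambda>i\<in>I. Z i w)) (\<lambda>y. exp (c * (\<Sum>i\<in>I. \<bar>y i\<bar>)))"
    unfolding D by (rule integrable_gaussian_exp[OF finite_I])
  then have "integrable M (\<lambda>w. exp (c * (\<Sum>i\<in>I. \<bar>(\<lambda>i\<in>I. Z i w) i\<bar>)))"
    by (subst (asm) integrable_distr_eq[OF m]) measurable
  then show ?thesis by (simp add: zs_def cong: sum.cong)
qed

lemma integrable_zs_bound:
  assumes "h \<in> borel_measurable M" "\<And>w. w \<in> space M \<Longrightarrow> \<bar>h w\<bar> \<le> C * exp (c * zs w)"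
  shows "integrable M h"
proof (rule Bochner_Integration.integrable_bound)
  show "integrable M (\<lambda>w. C * exp (c * zs w))" by (intro integrable_mult_right integrable_exp_zs)
  show "AE w in M. norm (h w) \<le> norm (C * exp (c * zs w))"
    unfolding real_norm_def by (intro AE_I2 order_trans[OF assms(2) abs_ge_self])
qed fact

definition idx :: "nat \<Rightarrow> nat \<Rightarrow> nat \<Rightarrow> nat \<times> nat \<times> nat \<times> nat" where
  "idx n j m = (Suc n, m div d + 1, j, m mod d)"

lemma idx_inj: "inj (idx n j)"
  by (rule injI) (auto simp: idx_def, metis div_mult_mod_eq)

lemma idx_in_I:
  assumes "n < T" "i \<in> {1..K}" "j \<in> {1..N}" "m < i * d"
  shows "idx n j m \<in> I"
proof -
  have "m div d < i" using assms(4) by (simp add: less_mult_imp_div_less)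
  then show ?thesis using assms dims by (auto simp: idx_def casbo_index_def)
qed

lemma zb_eq: "zb w n i j = vec (i * d) (\<lambda>m. Z (idx n j m) w)"
proof (rule eq_vecI)
  have c: "zb w n i j \<in> carrier_vec (i * d)"
    unfolding zb_def by (rule stack_carrier) (simp add: casbo_z_def)
  then show "dim_vec (zb w n i j) = dim_vec (vec (i * d) (\<lambda>m. Z (idx n j m) w))" by simp
  fix m assume "m < dim_vec (vec (i * d) (\<lambda>m. Z (idx n j m) w))"
  then have m: "m < i * d" by simp
  then show "zb w n i j $ m = vec (i * d) (\<lambda>m. Z (idx n j m) w) $ m"
    unfolding zb_def using dims by (subst stack_index[where d = d]) (auto simp: casbo_z_def idx_def)
qed

lemma vnorm_zb_le:
  assumes "n < T" "i \<in> {1..K}" "j \<in> {1..N}"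
  shows "vnorm (zb w n i j) \<le> zs w"
proof -
  have "vnorm (zb w n i j) \<le> (\<Sum>m<i * d. \<bar>Z (idx n j m) w\<bar>)"
    unfolding zb_eq by (rule vnorm_le_sum_abs)
  also have "\<dots> = (\<Sum>x\<in>idx n j ` {..<i * d}. \<bar>Z x w\<bar>)"
    using idx_inj[of n j] by (subst sum.reindex) (auto intro: inj_on_subset)
  also have "\<dots> \<le> zs w"
    unfolding zs_def using idx_in_I[OF assms] by (intro sum_mono2 finite_I) auto
  finally show ?thesis .
qed

lemma zs_le_exp: "zs w \<le> exp (zs w)" "1 \<le> exp (zs w)"
  using exp_ge_add_one_self[of "zs w"] zs_nonneg[of w] by linarith+

lemma vnorm_zb_power_le:
  assumes "n < T" "i \<in> {1..K}" "j \<in> {1..N}"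
  shows "vnorm (zb w n i j) ^ m \<le> exp (real m * zs w)"
proof -
  have "vnorm (zb w n i j) ^ m \<le> exp (zs w) ^ m"
    using vnorm_zb_le[OF assms, of w] zs_le_exp[of w] by (intro power_mono) auto
  then show ?thesis by (simp add: exp_of_nat_mult)
qed

lemma hw_le:
  assumes "n < T"
  shows "hw w n \<le> real K * (\<Sum>i\<in>{1..K}. (L i)\<^sup>2) * exp (4 * zs w)"
proof -
  have "hw w n \<le> real K * (\<Sum>i\<in>{1..K}. (L i)\<^sup>2 * (1 / real N * (\<Sum>j\<in>{1..N}. exp (4 * zs w))))"
    unfolding hw_def using vnorm_zb_power_le[OF assms, of _ _ w 4] by (intro mult_left_mono sum_mono) auto
  also have "\<dots> = real K * (\<Sum>i\<in>{1..K}. (L i)\<^sup>2 * exp (4 * zs w))" using dims by simp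
  also have "\<dots> = real K * (\<Sum>i\<in>{1..K}. (L i)\<^sup>2) * exp (4 * zs w)" by (simp add: sum_distrib_right)
  finally show ?thesis .
qed

lemma Vw_nonneg: "w \<in> space M \<Longrightarrow> n < T \<Longrightarrow> 0 \<le> Vw w n"
  using path_X[of w n] nonneg(3)[of w n] pr_pos[of "Suc n"] by (meson mult_nonneg_nonneg order_trans less_imp_le)

lemma Vw_Suc_le:
  assumes n: "n < T"
  shows "\<exists>C\<ge>0. \<forall>w\<in>space M. Vw w (Suc n) \<le> C * (Vw w n + 1 + hw w n)"
proof -
  let ?b = "bet (Suc n)" and ?g = "gam (Suc n)" and ?p = "pr (Suc n)" and ?b' = "bet (Suc n + 1)"
  have bp: "0 < ?b" "0 < ?g" "0 < ?p" "0 < ?b'" using params pr_pos by (auto simp: add_pos_pos)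
  define r1 where "r1 = 1 + ?b + 4 * ?b\<^sup>2 * ?g\<^sup>2 / ?p\<^sup>2"
  define r2 where "r2 = ?b * ?g * Bs + 4 * ?b\<^sup>2 * ?g\<^sup>2 * Bs / ?p"
  define r3 where "r3 = ?b / ?p + 2 * ?b\<^sup>2 / ?p"
  have r: "0 \<le> r1" "0 \<le> r2" "0 \<le> r3"
  proof -
    have "0 \<le> 1 + b + 4 * b\<^sup>2 * g\<^sup>2 / p\<^sup>2" "0 \<le> b * g * B + 4 * b\<^sup>2 * g\<^sup>2 * B / p" "0 \<le> b / p + 2 * b\<^sup>2 / p"
      if "0 < b" "0 < g" "0 < p" "0 \<le> B" for b g p B :: real
      using that by (auto intro!: add_nonneg_nonneg)
    from this[OF bp(1,2,3) nonneg(1)] show "0 \<le> r1" "0 \<le> r2" "0 \<le> r3"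
      unfolding r1_def r2_def r3_def by blast+
  qed
  define s where "s = ?b' / ?b + ?b' * ?g / ?p"
  have s: "0 \<le> s"
  proof -
    have "0 \<le> b' / b + b' * g / p" if "0 < b" "0 < g" "0 < p" "0 < b'" for b g p b' :: real
      using that by (auto intro!: add_nonneg_nonneg)
    from this[OF bp] show ?thesis unfolding s_def .
  qed
  have "Vw w (Suc n) \<le> s * (r1 + r2 + r3) * (Vw w n + 1 + hw w n)" if w: "w \<in> space M" for w
  proof -
    note V = Vw_nonneg[OF w n] and h = nonneg(4)[of w n] and X = nonneg(3)[of w n] and Mn = nonneg(2)[of w n]
    have XV: "Xw w n \<le> Vw w n / ?p" using path_X[OF w n] bp by (simp add: field_simps)
    have MV: "Mw w n \<le> 2 * Vw w n / ?p + 2 * Bs" using path_M[OF w n] XV by simp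
    have e1: "- 2 * ?b * Gw w n \<le> ?b * (Vw w n + hw w n / ?p)"
      using mult_left_mono[OF path_G[OF w n], of ?b] bp by (simp add: algebra_simps)
    have e2: "- (?b * ?g * (Mw w n + Xw w n - Bs)) \<le> ?b * ?g * Bs"
    proof -
      have "0 \<le> ?b * ?g * (Mw w n + Xw w n)"
        by (rule mult_nonneg_nonneg[OF less_imp_le[OF mult_pos_pos[OF bp(1,2)]] add_nonneg_nonneg[OF Mn X]])
      then show ?thesis unfolding right_diff_distrib by linarith
    qed
    have e3: "?b\<^sup>2 * ((1 + 1) * ?g\<^sup>2 * (1 / ?p) * Mw w n) \<le> ?b\<^sup>2 * ((1 + 1) * ?g\<^sup>2 * (1 / ?p) * (2 * Vw w n / ?p + 2 * Bs))"
      using bp MV by (intro mult_left_mono) auto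
    have "Ww w n \<le> Vw w n - 2 * ?b * Gw w n - ?b * ?g * (Mw w n + Xw w n - Bs)
        + ?b\<^sup>2 * ((1 + 1) * ?g\<^sup>2 * (1 / ?p) * Mw w n + (1 + 1 / 1) * (1 / ?p) * hw w n)"
      by (rule path_step[OF w n]) simp
    also have "\<dots> \<le> Vw w n + ?b * (Vw w n + hw w n / ?p) + ?b * ?g * Bs +
        (?b\<^sup>2 * ((1 + 1) * ?g\<^sup>2 * (1 / ?p) * (2 * Vw w n / ?p + 2 * Bs)) + ?b\<^sup>2 * ((1 + 1 / 1) * (1 / ?p) * hw w n))"
      using e1 e2 e3 unfolding distrib_left[of "?b\<^sup>2"] by linarith
    also have "\<dots> = r1 * Vw w n + r2 * 1 + r3 * hw w n"
    proof -
      have "v + b * (v + h / p) + b * g * B + (b\<^sup>2 * ((1 + 1) * g\<^sup>2 * (1 / p) * (2 * v / p + 2 * B)) + b\<^sup>2 * ((1 + 1 / 1) * (1 / p) * h))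
        = (1 + b + 4 * b\<^sup>2 * g\<^sup>2 / p\<^sup>2) * v + (b * g * B + 4 * b\<^sup>2 * g\<^sup>2 * B / p) * 1 + (b / p + 2 * b\<^sup>2 / p) * h"
        if "0 < p" for v b g h B p :: real
        using that by (simp add: field_simps power2_eq_square)
      from this[OF bp(3)] show ?thesis unfolding r1_def r2_def r3_def .
    qed
    also have "\<dots> \<le> (r1 + r2 + r3) * Vw w n + (r1 + r2 + r3) * 1 + (r1 + r2 + r3) * hw w n"
      using r V h by (intro add_mono mult_right_mono) auto
    also have "\<dots> = (r1 + r2 + r3) * (Vw w n + 1 + hw w n)" by (simp add: algebra_simps)
    finally have W: "Ww w n \<le> (r1 + r2 + r3) * (Vw w n + 1 + hw w n)" .
    have X': "Xw w (Suc n) \<le> Ww w n / ?p" using path_X'[OF w n] bp by (simp add: field_simps)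
    have "Vw w (Suc n) \<le> ?b' / ?b * Ww w n + ?b' * ?g * Xw w (Suc n)" by (rule path_V[OF w n])
    also have "\<dots> \<le> ?b' / ?b * Ww w n + ?b' * ?g * (Ww w n / ?p)"
      by (rule add_left_mono[OF mult_left_mono[OF X' less_imp_le[OF mult_pos_pos[OF bp(4,2)]]]])
    also have "\<dots> = s * Ww w n"
      unfolding s_def distrib_right by simp
    also have "\<dots> \<le> s * ((r1 + r2 + r3) * (Vw w n + 1 + hw w n))" by (rule mult_left_mono[OF W s])
    finally show ?thesis by (simp add: mult.assoc)
  qed
  then show ?thesis using r s by (intro exI[of _ "s * (r1 + r2 + r3)"]) auto
qed

lemma Vw_le: "n < T \<Longrightarrow> \<exists>C\<ge>0. \<forall>w\<in>space M. Vw w n \<le> C * exp (4 * zs w)"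
proof (induction n)
  case 0
  define C where "C = \<bar>(\<Sum>k\<in>{1..K}. wnorm_sq (inv_mat d (Sig1 k)) (mu1 k - mustar k))\<bar>"
  have "Vw w 0 \<le> C * exp (4 * zs w)" for w
  proof -
    have "Vw w 0 \<le> C * 1" by (simp add: Vw_def run_0 C_def)
    also have "\<dots> \<le> C * exp (4 * zs w)" using zs_nonneg[of w] by (intro mult_left_mono) (auto simp: C_def)
    finally show ?thesis .
  qed
  then show ?case by (intro exI[of _ C]) (auto simp: C_def)
next
  case (Suc n)
  then obtain C where C: "0 \<le> C" "\<And>w. w \<in> space M \<Longrightarrow> Vw w n \<le> C * exp (4 * zs w)" by auto
  obtain C' where C': "0 \<le> C'" "\<And>w. w \<in> space M \<Longrightarrow> Vw w (Suc n) \<le> C' * (Vw w n + 1 + hw w n)"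
    using Vw_Suc_le[of n] Suc.prems by auto
  define H where "H = real K * (\<Sum>i\<in>{1..K}. (L i)\<^sup>2)"
  have "Vw w (Suc n) \<le> C' * (C + 1 + H) * exp (4 * zs w)" if w: "w \<in> space M" for w
  proof -
    have "1 \<le> exp (4 * zs w)" using zs_nonneg[of w] by simp
    moreover have "hw w n \<le> H * exp (4 * zs w)" using hw_le[of n w] Suc.prems by (simp add: H_def)
    ultimately have "Vw w n + 1 + hw w n \<le> (C + 1 + H) * exp (4 * zs w)"
      using C(2)[OF w] unfolding distrib_right by linarith
    then have "C' * (Vw w n + 1 + hw w n) \<le> C' * ((C + 1 + H) * exp (4 * zs w))" using C' by (intro mult_left_mono)
    then show ?thesis using C'(2)[OF w] by (simp add: mult.assoc)
  qed
  moreover have "0 \<le> C' * (C + 1 + H)" using C C' by (auto simp: H_def intro!: mult_nonneg_nonneg add_nonneg_nonneg sum_nonneg)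
  ultimately show ?case by blast
qed

lemma stack_diff_le:
  assumes w: "w \<in> space M" and n: "n < T" and i: "i \<in> {1..K}"
  shows "\<bar>f i (stack (mu w n) i) - f i (stack mustar i)\<bar> \<le> L i * (1 + Vw w n / pr (Suc n))"
proof -
  interpret it: casbo_iterate d K N f L "mu w n" "Sg w n" "zt w (Suc n)" "pr (Suc n)"
    using iterate[OF w] n by simp
  have k: "k \<in> {1..K}" if "1 \<le> k" "k \<le> i" for k using that i by auto
  have c: "stack (mu w n) i \<in> carrier_vec (i * d)" "stack mustar i \<in> carrier_vec (i * d)"
    using it.mu mustar k by (auto intro!: stack_carrier)
  have "\<bar>f i (stack (mu w n) i) - f i (stack mustar i)\<bar> \<le> L i * vnorm (stack (mu w n) i - stack mustar i)"
    using lip[OF i] c by (auto simp: lipschitz_vec_def)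
  also have "vnorm (stack (mu w n) i - stack mustar i) \<le> 1 + Vw w n / pr (Suc n)"
  proof -
    have "stack (mu w n) i - stack mustar i = stack (\<lambda>k. mu w n k - mustar k) i"
      using it.mu mustar k by (intro stack_minus[symmetric, where d = d]) auto
    then have "(vnorm (stack (mu w n) i - stack mustar i))\<^sup>2 = (\<Sum>k\<in>{1..i}. (vnorm (mu w n k - mustar k))\<^sup>2)"
      using it.mu mustar k by (auto intro!: vnorm_sq_stack[where d = d] simp del: One_nat_def)
    also have "\<dots> \<le> Xw w n" unfolding Xw_def using i by (intro sum_mono2) auto
    also have "\<dots> \<le> Vw w n / pr (Suc n)" using path_X[OF w n] pr_pos[of "Suc n"] by (simp add: field_simps)
    finally have "(vnorm (stack (mu w n) i - stack mustar i))\<^sup>2 \<le> Vw w n / pr (Suc n)" .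
    then show ?thesis using le_one_plus_square[of "vnorm (stack (mu w n) i - stack mustar i)"] by linarith
  qed
  then have "L i * vnorm (stack (mu w n) i - stack mustar i) \<le> L i * (1 + Vw w n / pr (Suc n))"
    using lip[OF i] by (intro mult_left_mono) auto
  finally show ?thesis .
qed

lemma Phi_le:
  assumes w: "w \<in> space M" and n: "n < T" and i: "i \<in> {1..K}"
    and z: "z \<in> carrier_vec (i * d)"
  shows "\<bar>Phi w n i z\<bar> \<le> L i / sqrt (pr (Suc n)) * (1 + Vw w n) * (vnorm z)\<^sup>2"
proof -
  interpret it: casbo_iterate d K N f L "mu w n" "Sg w n" "zt w (Suc n)" "pr (Suc n)"
    using iterate[OF w] n by simp
  have k: "k \<in> {1..K}" if "1 \<le> k" "k \<le> i" for k using that i by auto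
  have Dc: "Dw w n i \<in> carrier_mat (i * d) (i * d)" unfolding Dw_def by (rule it.Dm_carrier[OF i])
  have Dz: "Dw w n i *\<^sub>v z \<in> carrier_vec (i * d)" using Dc z by auto
  have mc: "stack (mu w n) i \<in> carrier_vec (i * d)" by (rule it.stack_mu_carrier[OF i])
  have "\<bar>f i (stack (mu w n) i + Dw w n i *\<^sub>v z) - f i (stack (mu w n) i)\<bar> \<le>
      L i * vnorm (stack (mu w n) i + Dw w n i *\<^sub>v z - stack (mu w n) i)"
    using lip[OF i] mc Dz by (auto simp: lipschitz_vec_def)
  also have "stack (mu w n) i + Dw w n i *\<^sub>v z - stack (mu w n) i = Dw w n i *\<^sub>v z"
    using mc Dc z by (intro eq_vecI) auto
  also have "L i * vnorm (Dw w n i *\<^sub>v z) \<le> L i * (1 / sqrt (pr (Suc n)) * vnorm z)"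
    unfolding Dw_def using lip[OF i] by (intro mult_left_mono it.vnorm_Dm_le[OF i z]) auto
  finally have 1: "\<bar>f i (stack (mu w n) i + Dw w n i *\<^sub>v z) - f i (stack (mu w n) i)\<bar> \<le> L i / sqrt (pr (Suc n)) * vnorm z"
    by simp
  have a: "inv_mat d (sqrt_mat d (Sg w n k)) *\<^sub>v (mu w n k - mustar k) \<in> carrier_vec d" if "k \<in> {1..K}" for k
    using it.R_carrier[OF that] it.mu[OF that] mustar[OF that] by auto
  have ac: "aw w n i \<in> carrier_vec (i * d)" unfolding aw_def using a k by (intro stack_carrier) auto
  have "(vnorm (aw w n i))\<^sup>2 = (\<Sum>k\<in>{1..i}. (vnorm (inv_mat d (sqrt_mat d (Sg w n k)) *\<^sub>v (mu w n k - mustar k)))\<^sup>2)"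
    unfolding aw_def using a k by (intro vnorm_sq_stack[where d = d]) auto
  also have "\<dots> \<le> (\<Sum>k\<in>{1..K}. (vnorm (inv_mat d (sqrt_mat d (Sg w n k)) *\<^sub>v (mu w n k - mustar k)))\<^sup>2)"
    using i by (intro sum_mono2) auto
  also have "\<dots> = Vw w n"
    unfolding Vw_def vnorm_sq using it.mu mustar it.Sig
    by (intro sum.cong refl pd_sqrt_inv(3)[symmetric]) auto
  finally have "(vnorm (aw w n i))\<^sup>2 \<le> Vw w n" .
  then have av: "vnorm (aw w n i) \<le> 1 + Vw w n"
    using le_one_plus_square[of "vnorm (aw w n i)"] by linarith
  have "\<bar>aw w n i \<bullet> z\<bar> \<le> vnorm (aw w n i) * vnorm z" by (rule abs_scalar_prod_le_vnorm[OF ac z])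
  also have "\<dots> \<le> (1 + Vw w n) * vnorm z" using av by (intro mult_right_mono) auto
  finally have 2: "\<bar>aw w n i \<bullet> z\<bar> \<le> (1 + Vw w n) * vnorm z" .
  have "\<bar>Phi w n i z\<bar> \<le> (L i / sqrt (pr (Suc n)) * vnorm z) * ((1 + Vw w n) * vnorm z)"
    unfolding Phi_def abs_mult using lip[OF i] pr_pos[of "Suc n"] by (intro mult_mono 1 2) auto
  then show ?thesis by (simp add: power2_eq_square mult_ac)
qed

end

subsection \<open>Measurability of the iterates with respect to the history\<close>

context casbo_setting
begin

definition In :: "nat \<Rightarrow> (nat \<times> nat \<times> nat \<times> nat) set" where
  "In n = {i \<in> I. fst i \<le> n}"

text \<open>The history is kept as a sigma-algebra on the sample space itself: there (C1) and (C2) hold at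
  every point, so all inverses and square roots are genuine, whereas on the space of all conceivable
  sample paths they could be junk values.\<close>

definition F :: "nat \<Rightarrow> 'w measure" where
  "F n = vimage_algebra (space M) (\<lambda>w. \<lambda>i\<in>In n. Z i w) (PiM (In n) (\<lambda>_. borel))"

lemma space_F [simp]: "space (F n) = space M"
  by (simp add: F_def)

lemma restrict_Z_meas: "J \<subseteq> I \<Longrightarrow> (\<lambda>w. \<lambda>i\<in>J. Z i w) \<in> M \<rightarrow>\<^sub>M PiM J (\<lambda>_. borel)"
  using Z_meas by (intro measurable_restrict) auto

lemma id_meas_F: "(\<lambda>w. w) \<in> M \<rightarrow>\<^sub>M F n"
  unfolding F_def by (rule measurable_vimage_algebra2) (auto intro!: restrict_Z_meas simp: In_def)

lemma Z_meas_F: "i \<in> In n \<Longrightarrow> Z i \<in> borel_measurable (F n)"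
proof -
  assume i: "i \<in> In n"
  have "(\<lambda>w. \<lambda>i\<in>In n. Z i w) \<in> F n \<rightarrow>\<^sub>M PiM (In n) (\<lambda>_. borel)"
    unfolding F_def by (rule measurable_vimage_algebra1) (auto simp: space_PiM)
  from measurable_compose[OF this measurable_component_singleton[OF i]]
  show ?thesis using i by simp
qed

lemma F_mono: "m \<le> n \<Longrightarrow> (\<lambda>w. w) \<in> F n \<rightarrow>\<^sub>M F m"
  unfolding F_def[of m]
  by (rule measurable_vimage_algebra2) (auto intro!: measurable_restrict Z_meas_F simp: In_def)

lemma hist_meas: "hist n \<in> F n \<rightarrow>\<^sub>M PiM UNIV (\<lambda>_. borel)"
proof (rule measurable_PiM_single')
  show "(\<lambda>w. hist n w i) \<in> borel_measurable (F n)" for i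
    using Z_meas_F[of i n] by (cases "i \<in> I \<and> fst i \<le> n") (auto simp: casbo_hist_def In_def)
qed auto

lemma zt_meas:
  assumes "n < T" "k \<in> {1..K}" "j \<in> {1..N}"
  shows "meas_vec (F (Suc n)) d (\<lambda>w. zt w (Suc n) k j)"
proof (rule meas_vecI[where e = "\<lambda>l. Z (Suc n, k, j, l)"])
  show "Z (Suc n, k, j, l) \<in> borel_measurable (F (Suc n))" if "l < d" for l
    using assms that by (intro Z_meas_F) (auto simp: In_def casbo_index_def)
qed (auto simp: casbo_z_def)

lemma Sg_pd: "w \<in> space M \<Longrightarrow> n \<le> T \<Longrightarrow> k \<in> {1..K} \<Longrightarrow> pd_mat d (Sg w n k)"
  using iterate[of w n] by (blast intro: casbo_iterate.Sig)

lemma state_meas_Suc: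
  fixes n :: nat
  defines "G \<equiv> F (Suc n)"
  assumes n: "n < T"
    and mu: "\<And>k. k \<in> {1..K} \<Longrightarrow> meas_vec G d (\<lambda>w. mu w n k)"
    and Sg: "\<And>k. k \<in> {1..K} \<Longrightarrow> meas_mat G d (\<lambda>w. Sg w n k)"
    and k: "k \<in> {1..K}"
  shows "meas_vec G d (\<lambda>w. mu w (Suc n) k)" "meas_mat G d (\<lambda>w. Sg w (Suc n) k)"
proof -
  have zm: "meas_vec G d (\<lambda>w. zt w (Suc n) k j)" if "k \<in> {1..K}" "j \<in> {1..N}" for k j
    unfolding G_def by (rule zt_meas[OF n that])
  have pd: "pd_mat d (Sg w n k)" if "w \<in> space G" "k \<in> {1..K}" for w k
    using Sg_pd[of w n k] that n by (simp add: G_def)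
  have S: "meas_mat G d (\<lambda>w. sqrt_mat d (Sg w n k))" if "k \<in> {1..K}" for k
    by (rule meas_sqrt_mat[OF Sg[OF that] pd[OF _ that]])
  have R: "meas_mat G d (\<lambda>w. inv_mat d (sqrt_mat d (Sg w n k)))" if "k \<in> {1..K}" for k
    by (rule meas_inv_mat[OF S[OF that] pd_sqrt_mat(1)[OF pd[OF _ that]]])
  have x: "meas_vec G d (\<lambda>w. casbo_x d (mu w n) (Sg w n) (zt w (Suc n)) k j)" if "k \<in> {1..K}" "j \<in> {1..N}" for k j
    unfolding casbo_x_def using that by (intro meas_vec_add meas_mat_mult_vec mu S zm)
  have fx: "(\<lambda>w. f i (stack (\<lambda>m. casbo_x d (mu w n) (Sg w n) (zt w (Suc n)) m j) i)) \<in> borel_measurable G"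
    if "i \<in> {1..K}" "j \<in> {1..N}" for i j
    using that dims lip[OF that(1)] by (intro lipschitz_meas_vec[where n = "i * d"] meas_vec_stack x) auto
  have fm: "(\<lambda>w. f i (stack (mu w n) i)) \<in> borel_measurable G" if "i \<in> {1..K}" for i
    using that dims lip[OF that(1)] by (intro lipschitz_meas_vec[where n = "i * d"] meas_vec_stack mu) auto
  have gh: "meas_vec G d (\<lambda>w. casbo_ghat d N f (mu w n) (Sg w n) (zt w (Suc n)) i k)" if "i \<in> {k..K}" for i
    unfolding casbo_ghat_def using that k
    by (intro meas_vec_smult meas_vec_vsum meas_mat_mult_vec borel_measurable_diff borel_measurable_const fx fm R zm) auto
  show "meas_vec G d (\<lambda>w. mu w (Suc n) k)"
    unfolding mu_Suc
    by (intro meas_vec_minus meas_vec_smult meas_mat_mult_vec meas_vec_add meas_vec_vsum borel_measurable_const mu Sg gh k)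
  have s: "(\<lambda>w. casbo_s d K f (mu w n) (Sg w n) (zt w (Suc n)) k j) \<in> borel_measurable G" if "j \<in> {1..N}" for j
    unfolding casbo_s_def using that k by (intro borel_measurable_sum fx) auto
  have zc: "(\<lambda>w. zt w (Suc n) k j $ l) \<in> borel_measurable G" if "j \<in> {1..N}" "l < d" for j l
    by (rule meas_vecD(3)[OF zm[OF k that(1)] that(2)])
  have cm: "(\<lambda>w. c1 (Suc n) k (hist (Suc n) w)) \<in> borel_measurable G"
    "(\<lambda>w. c2 (Suc n) k (hist (Suc n) w)) \<in> borel_measurable G"
    unfolding G_def using c_meas[of "Suc n" k] n k
    by (auto intro!: measurable_compose[OF hist_meas])
  have H: "meas_mat G d (\<lambda>w. casbo_H d K N f (mu w n) (Sg w n) (zt w (Suc n))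
      (c1 (Suc n) k (hist (Suc n) w)) (c2 (Suc n) k (hist (Suc n) w)) k)"
    unfolding casbo_H_def Let_def
  proof (intro meas_mat_add meas_mat_smult cm meas_mat_const one_carrier_mat)
    show "meas_mat G d (\<lambda>w. mat d d (\<lambda>(a, b). 1 / real N * (\<Sum>j\<in>{1..N}. zt w (Suc n) k j $ a * zt w (Suc n) k j $ b *
       ((casbo_s d K f (mu w n) (Sg w n) (zt w (Suc n)) k j - Min (casbo_s d K f (mu w n) (Sg w n) (zt w (Suc n)) k ` {1..N})) /
        (Max (casbo_s d K f (mu w n) (Sg w n) (zt w (Suc n)) k ` {1..N}) - Min (casbo_s d K f (mu w n) (Sg w n) (zt w (Suc n)) k ` {1..N}))))))"
    proof (rule meas_matI)
      fix a b w assume "a < d" "b < d"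
      then show "mat d d (\<lambda>(a, b). 1 / real N * (\<Sum>j\<in>{1..N}. zt w (Suc n) k j $ a * zt w (Suc n) k j $ b *
       ((casbo_s d K f (mu w n) (Sg w n) (zt w (Suc n)) k j - Min (casbo_s d K f (mu w n) (Sg w n) (zt w (Suc n)) k ` {1..N})) /
        (Max (casbo_s d K f (mu w n) (Sg w n) (zt w (Suc n)) k ` {1..N}) - Min (casbo_s d K f (mu w n) (Sg w n) (zt w (Suc n)) k ` {1..N}))))) $$ (a, b)
        = 1 / real N * (\<Sum>j\<in>{1..N}. zt w (Suc n) k j $ a * zt w (Suc n) k j $ b *
       ((casbo_s d K f (mu w n) (Sg w n) (zt w (Suc n)) k j - Min (casbo_s d K f (mu w n) (Sg w n) (zt w (Suc n)) k ` {1..N})) /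
        (Max (casbo_s d K f (mu w n) (Sg w n) (zt w (Suc n)) k ` {1..N}) - Min (casbo_s d K f (mu w n) (Sg w n) (zt w (Suc n)) k ` {1..N}))))"
        by simp
    next
      fix a b assume "a < d" "b < d"
      then show "(\<lambda>w. 1 / real N * (\<Sum>j\<in>{1..N}. zt w (Suc n) k j $ a * zt w (Suc n) k j $ b *
       ((casbo_s d K f (mu w n) (Sg w n) (zt w (Suc n)) k j - Min (casbo_s d K f (mu w n) (Sg w n) (zt w (Suc n)) k ` {1..N})) /
        (Max (casbo_s d K f (mu w n) (Sg w n) (zt w (Suc n)) k ` {1..N}) - Min (casbo_s d K f (mu w n) (Sg w n) (zt w (Suc n)) k ` {1..N}))))) \<in> borel_measurable G"
        by (intro borel_measurable_times borel_measurable_sum borel_measurable_divide borel_measurable_diff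
            borel_measurable_const borel_measurable_Min borel_measurable_Max s zc) auto
    qed simp
  qed
  have Gm: "meas_mat G d (\<lambda>w. casbo_G d K N f (mu w n) (Sg w n) (zt w (Suc n))
      (c1 (Suc n) k (hist (Suc n) w)) (c2 (Suc n) k (hist (Suc n) w)) k)"
    unfolding casbo_G_def by (intro meas_mat_mult R H k)
  have Pm: "meas_mat G d (\<lambda>w. 1 \<cdot>\<^sub>m inv_mat d (Sg w n k) + alph (Suc n) \<cdot>\<^sub>m casbo_G d K N f (mu w n) (Sg w n) (zt w (Suc n))
      (c1 (Suc n) k (hist (Suc n) w)) (c2 (Suc n) k (hist (Suc n) w)) k)"
    by (intro meas_mat_add meas_mat_smult Gm borel_measurable_const meas_inv_mat[OF Sg[OF k] pd[OF _ k]])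
  have P: "inv_mat d (Sg w (Suc n) k) = 1 \<cdot>\<^sub>m inv_mat d (Sg w n k) + alph (Suc n) \<cdot>\<^sub>m casbo_G d K N f (mu w n) (Sg w n) (zt w (Suc n))
      (c1 (Suc n) k (hist (Suc n) w)) (c2 (Suc n) k (hist (Suc n) w)) k" if "w \<in> space M" for w
  proof -
    interpret it: casbo_iterate d K N f L "mu w n" "Sg w n" "zt w (Suc n)" "pr (Suc n)"
      using iterate[OF that] n by simp
    have t: "Suc n \<in> {1..T}" using n by auto
    have al: "0 < alph (Suc n)" using params by (simp add: add_pos_pos)
    show ?thesis
      unfolding Sg_Suc
      using it.precision_step(2)[OF k al params(3) C1[OF that t k, simplified diff_Suc_1] C2[OF that t k, simplified diff_Suc_1]] .
  qed
  have "meas_mat G d (\<lambda>w. inv_mat d (inv_mat d (Sg w (Suc n) k)))"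
  proof (rule meas_inv_mat)
    show "meas_mat G d (\<lambda>w. inv_mat d (Sg w (Suc n) k))"
      using Pm P by (subst meas_mat_cong) (auto simp: G_def)
    show "pd_mat d (inv_mat d (Sg w (Suc n) k))" if "w \<in> space G" for w
      using Sg_pd[of w "Suc n" k] that n k by (intro pd_inv_mat_pd) (auto simp: G_def)
  qed
  then show "meas_mat G d (\<lambda>w. Sg w (Suc n) k)"
  proof (subst (asm) meas_mat_cong)
    show "inv_mat d (inv_mat d (Sg w (Suc n) k)) = Sg w (Suc n) k" if "w \<in> space G" for w
      using Sg_pd[of w "Suc n" k] that n k by (intro inv_mat_inv_mat) (auto simp: G_def)
  qed
qed

lemma state_meas:
  assumes "n \<le> T"
  shows "\<forall>k\<in>{1..K}. meas_vec (F n) d (\<lambda>w. mu w n k) \<and> meas_mat (F n) d (\<lambda>w. Sg w n k)"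
  using assms
proof (induction n)
  case 0
  show ?case using init by (auto simp: run_0 intro!: meas_vec_const meas_mat_const pd_matD(1))
next
  case (Suc n)
  have "meas_vec (F (Suc n)) d (\<lambda>w. mu w n k)" "meas_mat (F (Suc n)) d (\<lambda>w. Sg w n k)" if "k \<in> {1..K}" for k
  proof -
    have IH: "meas_vec (F n) d (\<lambda>w. mu w n k)" "meas_mat (F n) d (\<lambda>w. Sg w n k)" using Suc that by auto
    have m: "(\<lambda>w. w) \<in> F (Suc n) \<rightarrow>\<^sub>M F n" by (rule F_mono) simp
    show "meas_vec (F (Suc n)) d (\<lambda>w. mu w n k)" "meas_mat (F (Suc n)) d (\<lambda>w. Sg w n k)"
      by (rule meas_vec_compose[OF IH(1) m], rule meas_mat_compose[OF IH(2) m])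
  qed
  then show ?case using Suc.prems state_meas_Suc[of n] by auto
qed

subsection \<open>Expectations\<close>

definition Y :: "nat \<Rightarrow> nat \<Rightarrow> nat \<Rightarrow> 'w \<Rightarrow> nat \<Rightarrow> real" where
  "Y n i j w = (\<lambda>m\<in>{..<i * d}. Z (idx n j m) w)"

lemma zb_eq_Y: "zb w n i j = vec (i * d) (Y n i j w)"
  unfolding zb_eq by (intro eq_vecI) (auto simp: Y_def)

context
  fixes n i j :: nat
  assumes n: "n < T" and i: "i \<in> {1..K}" and j: "j \<in> {1..N}"
begin

lemma id_pos: "1 \<le> i * d"
  using i dims by simp

lemma Y_meas: "Y n i j \<in> M \<rightarrow>\<^sub>M PiM {..<i * d} (\<lambda>_. borel)"
  unfolding Y_def using idx_in_I[OF n i j] by (intro measurable_restrict Z_meas) auto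

lemma Y_factor:
  defines "B \<equiv> idx n j ` {..<i * d}"
  shows "Y n i j w = (\<lambda>m\<in>{..<i * d}. (\<lambda>x\<in>B. Z x w) (idx n j m))"
  by (auto simp: Y_def B_def)

lemma reindex_meas:
  "(\<lambda>y. \<lambda>m\<in>{..<i * d}. y (idx n j m)) \<in> PiM (idx n j ` {..<i * d}) (\<lambda>_. borel) \<rightarrow>\<^sub>M PiM {..<i * d} (\<lambda>_. borel :: real measure)"
  by (intro measurable_restrict measurable_component_singleton) auto

lemma B_sub: "idx n j ` {..<i * d} \<subseteq> I"
  using idx_in_I[OF n i j] by auto

lemma Y_distr: "distr M (PiM {..<i * d} (\<lambda>_. borel)) (Y n i j) = gaussian {..<i * d}"
proof -
  let ?B = "idx n j ` {..<i * d}" and ?r = "\<lambda>y. \<lambda>m\<in>{..<i * d}. y (idx n j m)"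
  interpret pp: product_prob_space "\<lambda>_. std_normal" "UNIV :: (nat \<times> nat \<times> nat \<times> nat) set"
    by (rule product_prob_spaceI) (rule prob_space_std_normal)
  have "?B \<noteq> {}" using id_pos by (auto simp: lessThan_empty_iff)
  then have Bd: "distr M (PiM ?B (\<lambda>_. borel)) (\<lambda>w. \<lambda>x\<in>?B. Z x w) = gaussian ?B"
    by (intro distr_Z_PiM B_sub)
  have "distr M (PiM {..<i * d} (\<lambda>_. borel)) (Y n i j) =
      distr (distr M (PiM ?B (\<lambda>_. borel)) (\<lambda>w. \<lambda>x\<in>?B. Z x w)) (PiM {..<i * d} (\<lambda>_. borel)) ?r"
    by (subst distr_distr[OF reindex_meas restrict_Z_meas[OF B_sub]])
       (intro distr_cong refl, simp add: Y_factor)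
  also have "\<dots> = distr (gaussian ?B) (gaussian {..<i * d}) ?r"
    unfolding Bd by (intro distr_cong refl sets_PiM_cong) auto
  also have "\<dots> = gaussian {..<i * d}"
    using pp.distr_reorder[of "idx n j" "{..<i * d}" ?B] idx_inj[of n j] by (auto intro: inj_on_subset)
  finally show ?thesis .
qed

lemma Y_indep:
  assumes A: "A \<in> sets (F n)" and B: "B \<in> sets (PiM {..<i * d} (\<lambda>_. borel))"
  shows "prob (A \<inter> (Y n i j -` B \<inter> space M)) = prob A * prob (Y n i j -` B \<inter> space M)"
proof -
  let ?B = "idx n j ` {..<i * d}" and ?r = "\<lambda>y. \<lambda>m\<in>{..<i * d}. y (idx n j m)"
  let ?PB = "PiM ?B (\<lambda>_. borel) :: (nat \<times> nat \<times> nat \<times> nat \<Rightarrow> real) measure"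
  have "indep_var (PiM (In n) (\<lambda>_. borel)) (\<lambda>w. restrict (\<lambda>i. Z i w) (In n)) ?PB (\<lambda>w. restrict (\<lambda>i. Z i w) ?B)"
    by (rule indep_var_restrict[OF indep _ _ B_sub]) (auto simp: In_def idx_def)
  then have ind: "indep_set
      (sigma_sets (space M) {(\<lambda>w. restrict (\<lambda>i. Z i w) (In n)) -` A \<inter> space M | A. A \<in> sets (PiM (In n) (\<lambda>_. borel))})
      (sigma_sets (space M) {(\<lambda>w. restrict (\<lambda>i. Z i w) ?B) -` A \<inter> space M | A. A \<in> sets ?PB})"
    unfolding indep_var_eq by blast
  have A': "A \<in> sigma_sets (space M) {(\<lambda>w. restrict (\<lambda>i. Z i w) (In n)) -` A \<inter> space M | A. A \<in> sets (PiM (In n) (\<lambda>_. borel))}"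
    using A unfolding F_def sets_vimage_algebra .
  have "Y n i j -` B \<inter> space M = (\<lambda>w. restrict (\<lambda>i. Z i w) ?B) -` (?r -` B \<inter> space ?PB) \<inter> space M"
    by (auto simp: Y_factor space_PiM)
  moreover have "?r -` B \<inter> space ?PB \<in> sets ?PB" by (rule measurable_sets[OF reindex_meas B])
  ultimately have "Y n i j -` B \<inter> space M \<in> sigma_sets (space M) {(\<lambda>w. restrict (\<lambda>i. Z i w) ?B) -` A \<inter> space M | A. A \<in> sets ?PB}"
    by (intro sigma_sets.Basic) blast
  with A' ind show ?thesis unfolding indep_sets2_eq by blast
qed

lemma Phi_meas: "(\<lambda>(w, y). Phi w n i (vec (i * d) y)) \<in> borel_measurable (F n \<Otimes>\<^sub>M PiM {..<i * d} (\<lambda>_. borel))"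
proof -
  let ?Q = "PiM {..<i * d} (\<lambda>_. borel) :: (nat \<Rightarrow> real) measure"
  let ?P = "F n \<Otimes>\<^sub>M ?Q"
  have kK: "k \<in> {1..K}" if "1 \<le> k" "k \<le> i" for k using that i by auto
  have d0: "0 < d" using dims by simp
  have pd: "pd_mat d (Sg w n k)" if "w \<in> space (F n)" "k \<in> {1..K}" for w k
    using Sg_pd[of w n k] that n by simp
  have mum: "meas_vec (F n) d (\<lambda>w. mu w n k)" and Sgm: "meas_mat (F n) d (\<lambda>w. Sg w n k)" if "k \<in> {1..K}" for k
    using state_meas[of n] n that by auto
  have S: "meas_mat (F n) d (\<lambda>w. sqrt_mat d (Sg w n k))" if "k \<in> {1..K}" for k
    by (rule meas_sqrt_mat[OF Sgm[OF that] pd[OF _ that]])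
  have R: "meas_mat (F n) d (\<lambda>w. inv_mat d (sqrt_mat d (Sg w n k)))" if "k \<in> {1..K}" for k
    by (rule meas_inv_mat[OF S[OF that] pd_sqrt_mat(1)[OF pd[OF _ that]]])
  have m: "meas_vec (F n) (i * d) (\<lambda>w. stack (mu w n) i)"
    by (intro meas_vec_stack d0 mum kK)
  have a: "meas_vec (F n) (i * d) (\<lambda>w. aw w n i)"
    unfolding aw_def
    by (intro meas_vec_stack d0 meas_mat_mult_vec meas_vec_minus meas_vec_const R mum mustar kK)
  have c: "(\<lambda>p. snd p m) \<in> borel_measurable ?P" if "m < i * d" for m
    using that by (intro measurable_compose[OF measurable_snd] measurable_component_singleton) auto
  have z: "meas_vec ?P (i * d) (\<lambda>p. vec (i * d) (snd p))"
    by (rule meas_vecI[where e = "\<lambda>m p. snd p m"]) (auto intro: c)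
  have Dz: "meas_vec ?P (i * d) (\<lambda>p. Dw (fst p) n i *\<^sub>v vec (i * d) (snd p))"
  proof -
    define zk where "zk = (\<lambda>(p :: 'w \<times> (nat \<Rightarrow> real)) k. vec d (\<lambda>l. snd p ((k - 1) * d + l)))"
    have zk: "meas_vec ?P d (\<lambda>p. zk p k)" if k: "1 \<le> k" "k \<le> i" for k
    proof (rule meas_vecI[where e = "\<lambda>l p. snd p ((k - 1) * d + l)"])
      fix l assume l: "l < d"
      have "(k - 1) * d + l < (k - 1) * d + d" using l by simp
      also have "\<dots> = k * d" using k(1) by (cases k) auto
      also have "\<dots> \<le> i * d" using k(2) by simp
      finally show "(\<lambda>p. snd p ((k - 1) * d + l)) \<in> borel_measurable ?P" by (rule c)
    qed (auto simp: zk_def)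
    have "meas_vec ?P (i * d) (\<lambda>p. stack (\<lambda>k. sqrt_mat d (Sg (fst p) n k) *\<^sub>v zk p k) i)"
      by (intro meas_vec_stack d0 meas_mat_mult_vec zk meas_mat_compose[OF S measurable_fst] kK)
    moreover have "Dw (fst p) n i *\<^sub>v vec (i * d) (snd p) = stack (\<lambda>k. sqrt_mat d (Sg (fst p) n k) *\<^sub>v zk p k) i"
      if "p \<in> space ?P" for p
    proof -
      have w: "fst p \<in> space (F n)" using that by (auto simp: space_pair_measure)
      have "vec (i * d) (snd p) = stack (zk p) i"
      proof -
        have "vec (i * d) (snd p) = stack (\<lambda>k. vec d (\<lambda>l. vec (i * d) (snd p) $ ((k - 1) * d + l))) i"
          by (rule stack_of_vec) simp
        also have "\<dots> = stack (zk p) i"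
        proof (rule stack_cong)
          fix k assume k: "1 \<le> k" "k \<le> i"
          have "(k - 1) * d + l < i * d" if "l < d" for l
          proof -
            have "(k - 1) * d + l < (k - 1) * d + d" using that by simp
            also have "\<dots> = k * d" using k(1) by (cases k) auto
            also have "\<dots> \<le> i * d" using k(2) by simp
            finally show ?thesis .
          qed
          then show "vec d (\<lambda>l. vec (i * d) (snd p) $ ((k - 1) * d + l)) = zk p k"
            by (intro eq_vecI) (auto simp: zk_def)
        qed
        finally show ?thesis .
      qed
      then show ?thesis
        unfolding Dw_def using meas_matD(1)[OF S[OF kK] w]
        by (auto intro!: bdiag_mult_stack simp: zk_def)
    qed
    ultimately show ?thesis by (subst meas_vec_cong) auto
  qed
  have "(\<lambda>p. (f i (stack (mu (fst p) n) i + Dw (fst p) n i *\<^sub>v vec (i * d) (snd p)) - f i (stack (mu (fst p) n) i)) *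
      (aw (fst p) n i \<bullet> vec (i * d) (snd p))) \<in> borel_measurable ?P"
    using lip[OF i]
    by (intro borel_measurable_times borel_measurable_diff lipschitz_meas_vec[where n = "i * d"]
        meas_vec_add meas_scalar_prod[where n = "i * d"] Dz z meas_vec_compose[OF m measurable_fst] meas_vec_compose[OF a measurable_fst]) auto
  then show ?thesis by (simp add: Phi_def case_prod_beta')
qed

lemma id_Y_meas: "(\<lambda>w. (w, Y n i j w)) \<in> M \<rightarrow>\<^sub>M F n \<Otimes>\<^sub>M PiM {..<i * d} (\<lambda>_. borel)"
  using id_meas_F Y_meas by (rule measurable_Pair)

lemma Phi_integrable: "integrable M (\<lambda>w. Phi w n i (zb w n i j))"
proof -
  obtain C where C: "0 \<le> C" "\<And>w. w \<in> space M \<Longrightarrow> Vw w n \<le> C * exp (4 * zs w)"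
    using Vw_le[OF n] by auto
  show ?thesis
  proof (rule integrable_zs_bound)
    show "(\<lambda>w. Phi w n i (zb w n i j)) \<in> borel_measurable M"
      using measurable_compose[OF id_Y_meas Phi_meas] by (simp add: zb_eq_Y)
    fix w assume w: "w \<in> space M"
    have zc: "zb w n i j \<in> carrier_vec (i * d)" by (simp add: zb_eq)
    have V: "1 + Vw w n \<le> (1 + C) * exp (4 * zs w)"
    proof -
      have "1 \<le> exp (4 * zs w)" using zs_nonneg[of w] by simp
      then show ?thesis using C(2)[OF w] unfolding distrib_right by linarith
    qed
    have L0: "0 \<le> L i / sqrt (pr (Suc n))" using lip[OF i] pr_pos[of "Suc n"] by simp
    have "\<bar>Phi w n i (zb w n i j)\<bar> \<le> L i / sqrt (pr (Suc n)) * (1 + Vw w n) * (vnorm (zb w n i j))\<^sup>2"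
      by (rule Phi_le[OF w n i zc])
    also have "\<dots> \<le> L i / sqrt (pr (Suc n)) * ((1 + C) * exp (4 * zs w)) * exp (real 2 * zs w)"
      using V L0 C Vw_nonneg[OF w n] vnorm_zb_power_le[OF n i j, of w 2]
      by (intro mult_mono mult_left_mono mult_nonneg_nonneg) auto
    also have "\<dots> = L i / sqrt (pr (Suc n)) * (1 + C) * (exp (4 * zs w) * exp (real 2 * zs w))" by simp
    also have "exp (4 * zs w) * exp (real 2 * zs w) = exp (6 * zs w)" by (simp flip: exp_add)
    finally show "\<bar>Phi w n i (zb w n i j)\<bar> \<le> L i / sqrt (pr (Suc n)) * (1 + C) * exp (6 * zs w)" .
  qed
qed

lemma f_mu_meas: "(\<lambda>w. f i (stack (mu w n) i)) \<in> borel_measurable M"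
proof -
  have kK: "k \<in> {1..K}" if "1 \<le> k" "k \<le> i" for k using that i by auto
  have "meas_vec (F n) (i * d) (\<lambda>w. stack (mu w n) i)"
    using dims state_meas[of n] n kK by (intro meas_vec_stack) auto
  then have "meas_vec M (i * d) (\<lambda>w. stack (mu w n) i)" by (rule meas_vec_compose[OF _ id_meas_F])
  then show ?thesis by (rule lipschitz_meas_vec[OF conjunct1[OF lip[OF i]]])
qed

lemma f_mu_integrable: "integrable M (\<lambda>w. f i (stack (mu w n) i))"
proof -
  obtain C where C: "0 \<le> C" "\<And>w. w \<in> space M \<Longrightarrow> Vw w n \<le> C * exp (4 * zs w)"
    using Vw_le[OF n] by auto
  have p: "0 < pr (Suc n)" by (rule pr_pos)
  define c where "c = \<bar>f i (stack mustar i)\<bar> + L i * (1 + C / pr (Suc n))"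
  show ?thesis
  proof (rule integrable_zs_bound[OF f_mu_meas])
    fix w assume w: "w \<in> space M"
    have e: "1 \<le> exp (4 * zs w)" using zs_nonneg[of w] by simp
    have "Vw w n / pr (Suc n) \<le> C / pr (Suc n) * exp (4 * zs w)"
      using divide_right_mono[OF C(2)[OF w], of "pr (Suc n)"] p by simp
    then have "1 + Vw w n / pr (Suc n) \<le> (1 + C / pr (Suc n)) * exp (4 * zs w)"
      using e unfolding distrib_right by linarith
    then have "L i * (1 + Vw w n / pr (Suc n)) \<le> L i * ((1 + C / pr (Suc n)) * exp (4 * zs w))"
      using lip[OF i] by (intro mult_left_mono) auto
    moreover have "\<bar>f i (stack mustar i)\<bar> * 1 \<le> \<bar>f i (stack mustar i)\<bar> * exp (4 * zs w)"
      by (rule mult_left_mono[OF e]) simp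
    ultimately show "\<bar>f i (stack (mu w n) i)\<bar> \<le> c * exp (4 * zs w)"
      using stack_diff_le[OF w n i] unfolding c_def distrib_right mult.assoc by linarith
  qed
qed

lemma Phi_expectation:
  "expectation (\<lambda>w. f i (stack (mu w n) i)) - f i (stack mustar i) - L i * (1 / sqrt (pr (Suc n))) * real (i * d)
    \<le> expectation (\<lambda>w. Phi w n i (zb w n i j))"
proof -
  let ?Q = "PiM {..<i * d} (\<lambda>_. borel) :: (nat \<Rightarrow> real) measure"
  let ?J = "\<lambda>w. \<integral>y. Phi w n i (vec (i * d) y) \<partial>gaussian {..<i * d}"
  have int: "integrable M (\<lambda>w. Phi w n i (vec (i * d) (Y n i j w)))"
    using Phi_integrable by (simp add: zb_eq_Y)
  note fr = integral_freeze[where Phi = "\<lambda>w y. Phi w n i (vec (i * d) y)",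
      OF id_meas_F Y_meas Y_indep Phi_meas int, unfolded Y_distr]
  have low: "f i (stack (mu w n) i) - f i (stack mustar i) - L i * (1 / sqrt (pr (Suc n))) * real (i * d) \<le> ?J w"
    if w: "w \<in> space M" for w
  proof -
    interpret it: casbo_iterate d K N f L "mu w n" "Sg w n" "zt w (Suc n)" "pr (Suc n)"
      using iterate[OF w] n by simp
    have kK: "k \<in> {1..K}" if "1 \<le> k" "k \<le> i" for k using that i by auto
    have x: "mu w n k - mustar k \<in> carrier_vec d" if "k \<in> {1..K}" for k
      using it.mu[OF that] mustar[OF that] by auto
    have a: "inv_mat d (sqrt_mat d (Sg w n k)) *\<^sub>v (mu w n k - mustar k) \<in> carrier_vec d" if "k \<in> {1..K}" for k
      by (rule mult_mat_vec_carrier[OF it.R_carrier[OF that] x[OF that]])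
    have ms: "stack mustar i \<in> carrier_vec (i * d)" using mustar kK by (intro stack_carrier) auto
    have "Dw w n i *\<^sub>v aw w n i = stack (\<lambda>k. sqrt_mat d (Sg w n k) *\<^sub>v
        (inv_mat d (sqrt_mat d (Sg w n k)) *\<^sub>v (mu w n k - mustar k))) i"
      unfolding Dw_def aw_def using it.S_carrier a kK by (intro bdiag_mult_stack) auto
    also have "\<dots> = stack (\<lambda>k. mu w n k - mustar k) i"
      using pd_sqrt_inv(1)[OF it.Sig x] kK by (intro stack_cong) auto
    also have "\<dots> = stack (mu w n) i - stack mustar i"
      using it.mu mustar kK by (intro stack_minus[where d = d]) auto
    finally have Da: "Dw w n i *\<^sub>v aw w n i = stack (mu w n) i - stack mustar i" .
    show ?thesis
      unfolding Phi_def
    proof (rule gaussian_smoothed_gradient[OF id_pos conv[OF i] _ _ it.stack_mu_carrier[OF i] ms _ _ Da])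
      show "lipschitz_vec (i * d) (f i) (L i)" "0 \<le> L i" using lip[OF i] by auto
      show "aw w n i \<in> carrier_vec (i * d)" unfolding aw_def using a kK by (intro stack_carrier) auto
      show "Dw w n i \<in> carrier_mat (i * d) (i * d)" unfolding Dw_def by (rule it.Dm_carrier[OF i])
      show "vnorm (Dw w n i *\<^sub>v z) \<le> 1 / sqrt (pr (Suc n)) * vnorm z" if "z \<in> carrier_vec (i * d)" for z
        unfolding Dw_def by (rule it.vnorm_Dm_le[OF i that])
    qed
  qed
  have "expectation (\<lambda>w. f i (stack (mu w n) i)) - f i (stack mustar i) - L i * (1 / sqrt (pr (Suc n))) * real (i * d) =
      expectation (\<lambda>w. f i (stack (mu w n) i) - f i (stack mustar i) - L i * (1 / sqrt (pr (Suc n))) * real (i * d))"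
  proof -
    have "expectation (\<lambda>w. X w - a - b) = expectation X - a - b" if "integrable M X" for a b and X :: "'w \<Rightarrow> real"
      using that by (simp add: prob_space)
    from this[OF f_mu_integrable] show ?thesis by (rule sym)
  qed
  also have "\<dots> \<le> expectation ?J"
    by (intro integral_mono fr(1) low Bochner_Integration.integrable_diff f_mu_integrable integrable_const)
  also have "\<dots> = expectation (\<lambda>w. Phi w n i (zb w n i j))"
    unfolding zb_eq_Y by (rule fr(2)[symmetric])
  finally show ?thesis .
qed

lemma zb_moment:
  "integrable M (\<lambda>w. vnorm (zb w n i j) ^ 4)" "expectation (\<lambda>w. vnorm (zb w n i j) ^ 4) \<le> (real i * real d + 1)\<^sup>2"
proof -
  let ?Q = "PiM {..<i * d} (\<lambda>_. borel) :: (nat \<Rightarrow> real) measure"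
  note g = gaussian_vnorm_fourth[of "i * d"]
  have "(\<lambda>y. vnorm (vec (i * d) y) ^ 4) \<in> borel_measurable (gaussian {..<i * d})"
    using g(1) by (rule borel_measurable_integrable)
  moreover have "sets (gaussian {..<i * d}) = sets ?Q" by (intro sets_PiM_cong) auto
  ultimately have m: "(\<lambda>y. vnorm (vec (i * d) y) ^ 4) \<in> borel_measurable ?Q"
    by (simp cong: measurable_cong_sets)
  show "integrable M (\<lambda>w. vnorm (zb w n i j) ^ 4)"
    using integrable_distr_eq[OF Y_meas m] g(1) by (simp add: Y_distr zb_eq_Y)
  show "expectation (\<lambda>w. vnorm (zb w n i j) ^ 4) \<le> (real i * real d + 1)\<^sup>2"
    using integral_distr[OF Y_meas m] g(2) by (simp add: Y_distr zb_eq_Y)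
qed

end

end

subsection \<open>The rate\<close>

lemma sum_inverse_sqrt_le: "(\<Sum>t\<in>{1..T}. 1 / sqrt (real t)) \<le> 2 * sqrt (real T)"
proof (induction T)
  case (Suc T)
  have "1 / sqrt (real T + 1) \<le> 2 * (sqrt (real T + 1) - sqrt (real T))"
    using sqrt_Suc_diff_ge[of "real T"] by simp
  then show ?case using Suc by (simp add: add.commute)
qed simp

lemma sum_inverse_root4_cubed_le: "(\<Sum>t\<in>{1..T}. 1 / root 4 (real t) ^ 3) \<le> 4 * root 4 (real T)"
proof (induction T)
  case (Suc T)
  define a where "a = root 4 (real (Suc T))"
  define b where "b = root 4 (real T)"
  have ab: "0 \<le> b" "b \<le> a" "0 < a" by (auto simp: a_def b_def)
  have "1 = a ^ 4 - b ^ 4" by (simp add: a_def b_def)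
  also have "\<dots> = (a - b) * (a ^ 3 + a\<^sup>2 * b + a * b\<^sup>2 + b ^ 3)"
    by (simp add: power2_eq_square power3_eq_cube power4_eq_xxxx algebra_simps)
  also have "\<dots> \<le> (a - b) * (4 * a ^ 3)"
  proof (rule mult_left_mono)
    have "a\<^sup>2 * b \<le> a\<^sup>2 * a" "a * b\<^sup>2 \<le> a * a\<^sup>2" "b ^ 3 \<le> a ^ 3"
      using ab by (auto intro!: mult_left_mono power_mono)
    then show "a ^ 3 + a\<^sup>2 * b + a * b\<^sup>2 + b ^ 3 \<le> 4 * a ^ 3"
      by (simp add: power2_eq_square power3_eq_cube mult_ac)
  qed (use ab in simp)
  finally have "1 / a ^ 3 \<le> (a - b) * (4 * a ^ 3) / a ^ 3" using ab by (intro divide_right_mono) auto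
  also have "\<dots> = 4 * (a - b)" using ab by simp
  finally have "1 / a ^ 3 \<le> 4 * (a - b)" .
  then show ?case using Suc by (simp add: a_def b_def)
qed simp

lemma casbo_bound_rate:
  assumes pos: "0 < beta" "0 < alpha" "0 < nu" "0 \<le> B"
  shows "\<exists>C. \<forall>(d'::nat) (K'::nat) (T'::nat) (L'::nat \<Rightarrow> real) (Q::real).
     1 \<le> d' \<longrightarrow> 1 \<le> K' \<longrightarrow> 1 \<le> T' \<longrightarrow> (\<forall>i\<in>{1..K'}. 0 \<le> L' i \<and> L' i \<le> Lmax) \<longrightarrow> 0 \<le> Q \<longrightarrow> Q \<le> R \<longrightarrow>
     casbo_bound beta alpha nu B d' K' T' L' Q \<le> C * real d' ^ 2 * real K' ^ 4 / sqrt (real T')"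
proof (intro exI allI impI)
  define A1 where "A1 = 3 * beta * (4 * Lmax\<^sup>2) / (2 * alpha * nu)"
  define A2 where "A2 = sqrt 3 * Lmax / sqrt (alpha * nu)"
  define A3 where "A3 = alpha * nu * B / beta"
  fix d K T :: nat and L :: "nat \<Rightarrow> real" and Q :: real
  assume dK: "1 \<le> d" "1 \<le> K" and T: "1 \<le> T" and L: "\<forall>i\<in>{1..K}. 0 \<le> L i \<and> L i \<le> Lmax" and Q: "0 \<le> Q" "Q \<le> R"
  define P where "P = real d ^ 2 * real K ^ 4"
  have d1: "1 \<le> real d" and K1: "1 \<le> real K" and T1: "1 \<le> real T" using dK T by auto
  have "1 * 1 \<le> real d ^ 2 * real K ^ 4" using d1 K1 by (intro mult_mono one_le_power) auto
  then have P1: "1 \<le> P" by (simp add: P_def)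
  have "1 \<in> {1..K}" using dK by simp
  then have Lm: "0 \<le> Lmax" using L by force
  have A: "0 \<le> A1" "0 \<le> A2" "0 \<le> A3" using pos Lm by (auto simp: A1_def A2_def A3_def)
  define S1 where "S1 = (\<Sum>i\<in>{1..K}. real K * (L i)\<^sup>2 * (real i * real d + 1)\<^sup>2)"
  define S2 where "S2 = (\<Sum>i\<in>{1..K}. sqrt 3 * real i * real d * L i)"
  have "S1 \<le> (\<Sum>i\<in>{1..K}. real K * Lmax\<^sup>2 * (2 * (real K * real d))\<^sup>2)"
    unfolding S1_def
  proof (intro sum_mono mult_mono power_mono)
    fix i assume i: "i \<in> {1..K}"
    have "real i * real d \<le> real K * real d" using i by (intro mult_right_mono) auto
    moreover have "1 * 1 \<le> real K * real d" using d1 K1 by (intro mult_mono) auto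
    ultimately show "real i * real d + 1 \<le> 2 * (real K * real d)" by simp
  qed (use L in auto)
  also have "\<dots> = 4 * Lmax\<^sup>2 * P"
    by (simp add: P_def power2_eq_square power4_eq_xxxx)
  finally have S1: "S1 \<le> 4 * Lmax\<^sup>2 * P" .
  have c1: "3 * beta * S1 / (2 * alpha * nu) \<le> A1 * P"
  proof -
    have "3 * beta * S1 / (2 * alpha * nu) \<le> 3 * beta * (4 * Lmax\<^sup>2 * P) / (2 * alpha * nu)"
      using S1 pos by (intro divide_right_mono mult_left_mono) auto
    then show ?thesis by (simp add: A1_def mult_ac)
  qed
  have "S2 \<le> (\<Sum>i\<in>{1..K}. sqrt 3 * real K * real d * Lmax)"
    unfolding S2_def using L by (intro sum_mono mult_mono) auto
  also have "\<dots> = sqrt 3 * Lmax * (real K ^ 2 * real d)" by (simp add: power2_eq_square)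
  also have "\<dots> \<le> sqrt 3 * Lmax * P"
  proof (rule mult_left_mono)
    have "real K ^ 2 * real d \<le> real K ^ 4 * real d ^ 2"
      using K1 d1 by (intro mult_mono power_increasing self_le_power) auto
    then show "real K ^ 2 * real d \<le> P" by (simp add: P_def mult.commute)
  qed (use Lm in auto)
  finally have S2: "S2 \<le> sqrt 3 * Lmax * P" .
  have c2: "S2 / sqrt (alpha * nu) \<le> A2 * P"
    using divide_right_mono[OF S2, of "sqrt (alpha * nu)"] pos by (simp add: A2_def)
  have c3: "A3 \<le> A3 * P" using A P1 by (simp add: mult_le_cancel_left1)
  define q where "q = 1 / sqrt (real T)"
  have q: "0 < q" using T1 by (simp add: q_def)
  have sT: "sqrt (real T) * sqrt (real T) = real T" by simp
  have inv: "x / real T \<le> c * q" if "x \<le> c * sqrt (real T)" for x c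
  proof -
    have "x / real T \<le> c * sqrt (real T) / real T" using that T1 by (intro divide_right_mono) auto
    also have "\<dots> = c * sqrt (real T) / (sqrt (real T) * sqrt (real T))" by simp
    also have "\<dots> = c * q" unfolding q_def using T1 by (simp del: real_sqrt_mult_self)
    finally show ?thesis .
  qed
  have s1: "1 \<le> sqrt (real T)" using T1 by simp
  have "sqrt (real T + 1) \<le> sqrt (4 * real T)" "sqrt (real T + 2) \<le> sqrt (4 * real T)" using T1 by auto
  then have s2: "sqrt (real T + 1) \<le> 2 * sqrt (real T)" "sqrt (real T + 2) \<le> 2 * sqrt (real T)"
    by (auto simp: real_sqrt_mult)
  have "root 4 (real T + 1) \<le> sqrt (real T + 1)"
    unfolding sqrt_def by (rule real_root_decreasing) auto
  then have s3: "root 4 (real T + 1) \<le> 2 * sqrt (real T)" using s2 by linarith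
  have t0: "Q / (2 * beta * real T) \<le> R / (2 * beta) * P * q"
  proof -
    have "Q / (2 * beta) \<le> R / (2 * beta) * P * sqrt (real T)"
    proof -
      have "Q / (2 * beta) \<le> R / (2 * beta)" using Q pos by (intro divide_right_mono) auto
      also have "\<dots> * 1 * 1 \<le> R / (2 * beta) * P * sqrt (real T)"
        using Q pos P1 s1 by (intro mult_mono mult_nonneg_nonneg) auto
      finally show ?thesis by simp
    qed
    from inv[OF this] show ?thesis by simp
  qed
  have t1: "2 * sqrt (real T + 1) * (3 * beta * S1 / (2 * alpha * nu)) / real T \<le> 4 * A1 * P * q"
  proof (rule inv)
    have "2 * sqrt (real T + 1) * (3 * beta * S1 / (2 * alpha * nu)) \<le> 2 * (2 * sqrt (real T)) * (A1 * P)"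
    proof (rule mult_mono)
      have "0 \<le> S1" by (auto simp: S1_def intro!: sum_nonneg)
      then show "0 \<le> 3 * beta * S1 / (2 * alpha * nu)" using pos by simp
    qed (use s2 c1 in auto)
    then show "2 * sqrt (real T + 1) * (3 * beta * S1 / (2 * alpha * nu)) \<le> 4 * A1 * P * sqrt (real T)"
      by (simp add: mult_ac)
  qed
  have t2: "4 * root 4 (real T + 1) * (S2 / sqrt (alpha * nu)) / real T \<le> 8 * A2 * P * q"
  proof (rule inv)
    have "4 * root 4 (real T + 1) * (S2 / sqrt (alpha * nu)) \<le> 4 * (2 * sqrt (real T)) * (A2 * P)"
    proof (rule mult_mono)
      show "0 \<le> S2 / sqrt (alpha * nu)" using pos L by (auto simp: S2_def intro!: sum_nonneg divide_nonneg_nonneg)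
    qed (use s3 c2 in auto)
    then show "4 * root 4 (real T + 1) * (S2 / sqrt (alpha * nu)) \<le> 8 * A2 * P * sqrt (real T)"
      by (simp add: mult_ac)
  qed
  have t3: "sqrt (real T + 2) * A3 / real T \<le> 2 * A3 * P * q"
  proof (rule inv)
    have "sqrt (real T + 2) * A3 \<le> (2 * sqrt (real T)) * (A3 * P)"
      by (rule mult_mono) (use s2 c3 A in auto)
    then show "sqrt (real T + 2) * A3 \<le> 2 * A3 * P * sqrt (real T)" by (simp add: mult_ac)
  qed
  have "casbo_bound beta alpha nu B d K T L Q = Q / (2 * beta * real T) +
      2 * sqrt (real T + 1) * (3 * beta * S1 / (2 * alpha * nu)) / real T +
      4 * root 4 (real T + 1) * (S2 / sqrt (alpha * nu)) / real T + sqrt (real T + 2) * A3 / real T"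
    by (simp add: casbo_bound_def Let_def S1_def S2_def A3_def)
  also have "\<dots> \<le> R / (2 * beta) * P * q + 4 * A1 * P * q + 8 * A2 * P * q + 2 * A3 * P * q"
    using t0 t1 t2 t3 by linarith
  also have "\<dots> = (R / (2 * beta) + 4 * A1 + 8 * A2 + 2 * A3) * real d ^ 2 * real K ^ 4 / sqrt (real T)"
    by (simp add: P_def q_def algebra_simps add_divide_distrib)
  finally show "casbo_bound beta alpha nu B d K T L Q \<le>
     (R / (2 * beta) + 4 * (3 * beta * (4 * Lmax\<^sup>2) / (2 * alpha * nu)) + 8 * (sqrt 3 * Lmax / sqrt (alpha * nu))
       + 2 * (alpha * nu * B / beta)) * real d ^ 2 * real K ^ 4 / sqrt (real T)"
    unfolding A1_def A2_def A3_def .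
qed

context casbo_setting
begin

lemma inverse_sqrt_pr_le:
  assumes "1 \<le> t"
  shows "1 / sqrt (pr t) \<le> sqrt 3 / sqrt (alpha * nu) * (1 / root 4 (real t) ^ 3)"
proof -
  define r where "r = root 4 (real t)"
  have r: "0 < r" using assms by (simp add: r_def)
  have r4: "r ^ 4 = real t" by (simp add: r_def)
  have "sqrt (real t) = sqrt ((r\<^sup>2)\<^sup>2)" unfolding r4[symmetric] by (simp flip: power_mult)
  also have "\<dots> = r\<^sup>2" by (rule real_sqrt_unique) auto
  finally have "real t * sqrt (real t) = r ^ 4 * r\<^sup>2" by (simp add: r4)
  also have "\<dots> = (r ^ 3)\<^sup>2" by (simp flip: power_add power_mult)
  finally have r6: "real t * sqrt (real t) = (r ^ 3)\<^sup>2" .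
  have "alpha * nu / 3 * (r ^ 3)\<^sup>2 \<le> pr t"
    unfolding pr_def r6 using params by (simp add: algebra_simps)
  then have le: "sqrt (alpha * nu / 3 * (r ^ 3)\<^sup>2) \<le> sqrt (pr t)" by (rule real_sqrt_le_mono)
  have "sqrt (alpha * nu / 3 * c\<^sup>2) = sqrt (alpha * nu) / sqrt 3 * c" if "0 \<le> c" for c
    using that by (simp add: real_sqrt_mult real_sqrt_divide)
  from this[of "r ^ 3"] have eq: "sqrt (alpha * nu / 3 * (r ^ 3)\<^sup>2) = sqrt (alpha * nu) / sqrt 3 * r ^ 3"
    using r by simp
  have "1 / sqrt (pr t) \<le> 1 / (sqrt (alpha * nu) / sqrt 3 * r ^ 3)"
    using le[unfolded eq] r params pr_pos[of t] by (intro divide_left_mono) auto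
  then show ?thesis by (simp add: r_def)
qed

lemma expected_regret:
  assumes B: "Bs \<le> B"
  shows "(\<Sum>t\<in>{1..T}. \<Sum>k\<in>{1..K}. expectation (\<lambda>w. f k (stack (mu w (t - 1)) k)))
      - real T * (\<Sum>k\<in>{1..K}. f k (stack mustar k)) \<le>
    (\<Sum>k\<in>{1..K}. wnorm_sq (inv_mat d (Sig1 k)) (mu1 k - mustar k)) / (2 * beta)
    + 2 * sqrt (real T + 1) * (3 * beta * (\<Sum>i\<in>{1..K}. real K * (L i)\<^sup>2 * (real i * real d + 1)\<^sup>2) / (2 * alpha * nu))
    + 4 * root 4 (real T + 1) * ((\<Sum>i\<in>{1..K}. sqrt 3 * real i * real d * L i) / sqrt (alpha * nu))
    + sqrt (real T + 2) * (alpha * nu * B / beta)"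
proof -
  define V0 where "V0 = (\<Sum>k\<in>{1..K}. wnorm_sq (inv_mat d (Sig1 k)) (mu1 k - mustar k))"
  define S1 where "S1 = (\<Sum>i\<in>{1..K}. real K * (L i)\<^sup>2 * (real i * real d + 1)\<^sup>2)"
  define S2 where "S2 = (\<Sum>i\<in>{1..K}. sqrt 3 * real i * real d * L i)"
  define Fs where "Fs = (\<Sum>k\<in>{1..K}. f k (stack mustar k))"
  define Ef where "Ef = (\<lambda>t. \<Sum>k\<in>{1..K}. expectation (\<lambda>w. f k (stack (mu w (t - 1)) k)))"
  have tn: "t - 1 < T" if "t \<in> {1..T}" for t using that by auto
  have Gi: "integrable M (\<lambda>w. Gw w n)" if "n < T" for n
    unfolding Gw_def using Phi_integrable[OF that]
    by (intro Bochner_Integration.integrable_sum integrable_mult_right) auto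
  have hi: "integrable M (\<lambda>w. hw w n)" if "n < T" for n
    unfolding hw_def using zb_moment(1)[OF that]
    by (intro Bochner_Integration.integrable_sum integrable_mult_right) auto
  have EG: "Ef t - Fs - (\<Sum>i\<in>{1..K}. L i * (1 / sqrt (pr t)) * real (i * d)) \<le> expectation (\<lambda>w. Gw w (t - 1))"
    if t: "t \<in> {1..T}" for t
  proof -
    note n = tn[OF t]
    have St: "Suc (t - 1) = t" using t by simp
    have "Ef t - Fs - (\<Sum>i\<in>{1..K}. L i * (1 / sqrt (pr t)) * real (i * d)) =
      (\<Sum>i\<in>{1..K}. expectation (\<lambda>w. f i (stack (mu w (t - 1)) i)) - f i (stack mustar i) - L i * (1 / sqrt (pr t)) * real (i * d))"
      unfolding Ef_def Fs_def sum_subtractf ..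
    also have "\<dots> \<le> (\<Sum>i\<in>{1..K}. 1 / real N * (\<Sum>j\<in>{1..N}. expectation (\<lambda>w. Phi w (t - 1) i (zb w (t - 1) i j))))"
    proof (rule sum_mono)
      fix i assume i: "i \<in> {1..K}"
      let ?c = "expectation (\<lambda>w. f i (stack (mu w (t - 1)) i)) - f i (stack mustar i) - L i * (1 / sqrt (pr t)) * real (i * d)"
      have "(\<Sum>j\<in>{1..N}. ?c) \<le> (\<Sum>j\<in>{1..N}. expectation (\<lambda>w. Phi w (t - 1) i (zb w (t - 1) i j)))"
        using Phi_expectation[OF n i, unfolded St] by (intro sum_mono) auto
      then have "1 / real N * (\<Sum>j\<in>{1..N}. ?c) \<le> 1 / real N * (\<Sum>j\<in>{1..N}. expectation (\<lambda>w. Phi w (t - 1) i (zb w (t - 1) i j)))"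
        by (intro mult_left_mono) auto
      moreover have "1 / real N * (\<Sum>j\<in>{1..N}. ?c) = ?c" using dims by simp
      ultimately show "?c \<le> 1 / real N * (\<Sum>j\<in>{1..N}. expectation (\<lambda>w. Phi w (t - 1) i (zb w (t - 1) i j)))" by simp
    qed
    also have "\<dots> = expectation (\<lambda>w. Gw w (t - 1))"
    proof -
      have "expectation (\<lambda>w. Gw w (t - 1)) = (\<Sum>i\<in>{1..K}. expectation (\<lambda>w. 1 / real N * (\<Sum>j\<in>{1..N}. Phi w (t - 1) i (zb w (t - 1) i j))))"
        unfolding Gw_def using Phi_integrable[OF n]
        by (intro Bochner_Integration.integral_sum Bochner_Integration.integrable_sum integrable_mult_right) auto
      also have "\<dots> = (\<Sum>i\<in>{1..K}. 1 / real N * (\<Sum>j\<in>{1..N}. expectation (\<lambda>w. Phi w (t - 1) i (zb w (t - 1) i j))))"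
      proof (rule sum.cong[OF refl])
        fix i assume i: "i \<in> {1..K}"
        have "expectation (\<lambda>w. \<Sum>j\<in>{1..N}. Phi w (t - 1) i (zb w (t - 1) i j)) = (\<Sum>j\<in>{1..N}. expectation (\<lambda>w. Phi w (t - 1) i (zb w (t - 1) i j)))"
          using Phi_integrable[OF n i] by (intro Bochner_Integration.integral_sum) auto
        then show "expectation (\<lambda>w. 1 / real N * (\<Sum>j\<in>{1..N}. Phi w (t - 1) i (zb w (t - 1) i j))) =
          1 / real N * (\<Sum>j\<in>{1..N}. expectation (\<lambda>w. Phi w (t - 1) i (zb w (t - 1) i j)))"
          by (simp only: integral_mult_right_zero)
      qed
      finally show ?thesis by simp
    qed
    finally show ?thesis .
  qed
  have Eh: "expectation (\<lambda>w. hw w n) \<le> S1" if n: "n < T" for n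
  proof -
    have "expectation (\<lambda>w. hw w n) = real K * (\<Sum>i\<in>{1..K}. (L i)\<^sup>2 * (1 / real N * (\<Sum>j\<in>{1..N}. expectation (\<lambda>w. vnorm (zb w n i j) ^ 4))))"
    proof -
      have "expectation (\<lambda>w. hw w n) = real K * expectation (\<lambda>w. \<Sum>i\<in>{1..K}. (L i)\<^sup>2 * (1 / real N * (\<Sum>j\<in>{1..N}. vnorm (zb w n i j) ^ 4)))"
        unfolding hw_def by (rule integral_mult_right_zero)
      also have "expectation (\<lambda>w. \<Sum>i\<in>{1..K}. (L i)\<^sup>2 * (1 / real N * (\<Sum>j\<in>{1..N}. vnorm (zb w n i j) ^ 4))) =
        (\<Sum>i\<in>{1..K}. expectation (\<lambda>w. (L i)\<^sup>2 * (1 / real N * (\<Sum>j\<in>{1..N}. vnorm (zb w n i j) ^ 4))))"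
        using zb_moment(1)[OF n]
        by (intro Bochner_Integration.integral_sum Bochner_Integration.integrable_sum integrable_mult_right) auto
      also have "\<dots> = (\<Sum>i\<in>{1..K}. (L i)\<^sup>2 * (1 / real N * (\<Sum>j\<in>{1..N}. expectation (\<lambda>w. vnorm (zb w n i j) ^ 4))))"
      proof (rule sum.cong[OF refl])
        fix i assume i: "i \<in> {1..K}"
        have "expectation (\<lambda>w. \<Sum>j\<in>{1..N}. vnorm (zb w n i j) ^ 4) = (\<Sum>j\<in>{1..N}. expectation (\<lambda>w. vnorm (zb w n i j) ^ 4))"
          using zb_moment(1)[OF n i] by (intro Bochner_Integration.integral_sum) auto
        then show "expectation (\<lambda>w. (L i)\<^sup>2 * (1 / real N * (\<Sum>j\<in>{1..N}. vnorm (zb w n i j) ^ 4))) =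
          (L i)\<^sup>2 * (1 / real N * (\<Sum>j\<in>{1..N}. expectation (\<lambda>w. vnorm (zb w n i j) ^ 4)))"
          by (simp only: integral_mult_right_zero)
      qed
      finally show ?thesis .
    qed
    also have "\<dots> \<le> real K * (\<Sum>i\<in>{1..K}. (L i)\<^sup>2 * (1 / real N * (\<Sum>j\<in>{1..N}. (real i * real d + 1)\<^sup>2)))"
      using zb_moment(2)[OF n] by (intro mult_left_mono sum_mono) auto
    also have "\<dots> = S1" using dims by (simp add: S1_def sum_distrib_left mult.assoc)
    finally show ?thesis .
  qed
  have an: "0 < alpha * nu" using params by simp
  have S1n: "0 \<le> S1" by (auto simp: S1_def intro!: sum_nonneg)
  have "(\<Sum>t\<in>{1..T}. Ef t - Fs - (\<Sum>i\<in>{1..K}. L i * (1 / sqrt (pr t)) * real (i * d))) \<le>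
      (\<Sum>t\<in>{1..T}. expectation (\<lambda>w. Gw w (t - 1)))"
    by (intro sum_mono EG)
  also have "\<dots> = expectation (\<lambda>w. \<Sum>t\<in>{1..T}. Gw w (t - 1))"
    using Gi tn by (intro Bochner_Integration.integral_sum[symmetric]) auto
  also have "\<dots> \<le> expectation (\<lambda>w. V0 / (2 * beta) +
    (\<Sum>t\<in>{1..T}. 3 * beta / (2 * (alpha * nu)) * (hw w (t - 1) / sqrt (real t)))
    + sqrt (real T + 2) * (alpha * nu * Bs / beta))"
  proof (rule integral_mono)
    show "integrable M (\<lambda>w. \<Sum>t\<in>{1..T}. Gw w (t - 1))"
      using Gi tn by (intro Bochner_Integration.integrable_sum) auto
    show "integrable M (\<lambda>w. V0 / (2 * beta) + (\<Sum>t\<in>{1..T}. 3 * beta / (2 * (alpha * nu)) * (hw w (t - 1) / sqrt (real t)))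
        + sqrt (real T + 2) * (alpha * nu * Bs / beta))"
      using hi tn by (intro Bochner_Integration.integrable_add Bochner_Integration.integrable_sum
          integrable_mult_right integrable_divide integrable_const) auto
    show "(\<Sum>t\<in>{1..T}. Gw w (t - 1)) \<le> V0 / (2 * beta) + (\<Sum>t\<in>{1..T}. 3 * beta / (2 * (alpha * nu)) * (hw w (t - 1) / sqrt (real t)))
        + sqrt (real T + 2) * (alpha * nu * Bs / beta)" if "w \<in> space M" for w
      using path_bound[OF that] by (simp only: Vw_def run_0 V0_def)
  qed
  also have "\<dots> = V0 / (2 * beta) +
    (\<Sum>t\<in>{1..T}. 3 * beta / (2 * (alpha * nu)) * (expectation (\<lambda>w. hw w (t - 1)) / sqrt (real t)))
    + sqrt (real T + 2) * (alpha * nu * Bs / beta)"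
  proof -
    have hi': "integrable M (\<lambda>w. 3 * beta / (2 * (alpha * nu)) * (hw w (t - 1) / sqrt (real t)))" if "t \<in> {1..T}" for t
      using hi[OF tn[OF that]] by (intro integrable_mult_right integrable_divide) auto
    have "expectation (\<lambda>w. \<Sum>t\<in>{1..T}. 3 * beta / (2 * (alpha * nu)) * (hw w (t - 1) / sqrt (real t))) =
      (\<Sum>t\<in>{1..T}. expectation (\<lambda>w. 3 * beta / (2 * (alpha * nu)) * (hw w (t - 1) / sqrt (real t))))"
      by (rule Bochner_Integration.integral_sum[OF hi'])
    also have "\<dots> = (\<Sum>t\<in>{1..T}. 3 * beta / (2 * (alpha * nu)) * (expectation (\<lambda>w. hw w (t - 1)) / sqrt (real t)))"
      by (simp only: integral_mult_right_zero integral_divide_zero)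
    finally have e: "expectation (\<lambda>w. \<Sum>t\<in>{1..T}. 3 * beta / (2 * (alpha * nu)) * (hw w (t - 1) / sqrt (real t))) =
      (\<Sum>t\<in>{1..T}. 3 * beta / (2 * (alpha * nu)) * (expectation (\<lambda>w. hw w (t - 1)) / sqrt (real t)))" .
    have si: "integrable M (\<lambda>w. \<Sum>t\<in>{1..T}. 3 * beta / (2 * (alpha * nu)) * (hw w (t - 1) / sqrt (real t)))"
      by (rule Bochner_Integration.integrable_sum[OF hi'])
    have "expectation (\<lambda>w. a + X w + b) = a + expectation X + b" if "integrable M X" for a b and X :: "'w \<Rightarrow> real"
      using that by (simp add: prob_space)
    from this[OF si] show ?thesis unfolding e .
  qed
  also have "\<dots> \<le> V0 / (2 * beta) + (\<Sum>t\<in>{1..T}. 3 * beta / (2 * (alpha * nu)) * (S1 / sqrt (real t)))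
    + sqrt (real T + 2) * (alpha * nu * B / beta)"
    using Eh tn params an B
    by (intro add_mono order_refl sum_mono mult_left_mono divide_right_mono) auto
  also have "(\<Sum>t\<in>{1..T}. 3 * beta / (2 * (alpha * nu)) * (S1 / sqrt (real t))) =
      3 * beta * S1 / (2 * alpha * nu) * (\<Sum>t\<in>{1..T}. 1 / sqrt (real t))"
    unfolding sum_distrib_left by (intro sum.cong refl) (simp add: mult_ac)
  also have "\<dots> \<le> 3 * beta * S1 / (2 * alpha * nu) * (2 * sqrt (real T + 1))"
  proof (rule mult_left_mono)
    have "sqrt (real T) \<le> sqrt (real T + 1)" by simp
    then show "(\<Sum>t\<in>{1..T}. 1 / sqrt (real t)) \<le> 2 * sqrt (real T + 1)"
      using sum_inverse_sqrt_le[of T] by linarith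
    show "0 \<le> 3 * beta * S1 / (2 * alpha * nu)" using params S1n by simp
  qed
  finally have main: "(\<Sum>t\<in>{1..T}. Ef t - Fs - (\<Sum>i\<in>{1..K}. L i * (1 / sqrt (pr t)) * real (i * d))) \<le>
    V0 / (2 * beta) + 3 * beta * S1 / (2 * alpha * nu) * (2 * sqrt (real T + 1)) + sqrt (real T + 2) * (alpha * nu * B / beta)"
    by simp
  have "(\<Sum>t\<in>{1..T}. \<Sum>i\<in>{1..K}. L i * (1 / sqrt (pr t)) * real (i * d)) \<le>
    (\<Sum>t\<in>{1..T}. \<Sum>i\<in>{1..K}. L i * (sqrt 3 / sqrt (alpha * nu) * (1 / root 4 (real t) ^ 3)) * real (i * d))"
    using inverse_sqrt_pr_le lip by (intro sum_mono mult_right_mono mult_left_mono) auto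
  also have "\<dots> = (\<Sum>t\<in>{1..T}. S2 / sqrt (alpha * nu) * (1 / root 4 (real t) ^ 3))"
    by (intro sum.cong refl) (simp add: S2_def sum_distrib_left sum_distrib_right sum_divide_distrib mult_ac)
  also have "\<dots> = S2 / sqrt (alpha * nu) * (\<Sum>t\<in>{1..T}. 1 / root 4 (real t) ^ 3)"
    by (simp only: sum_distrib_left)
  also have "\<dots> \<le> S2 / sqrt (alpha * nu) * (4 * root 4 (real T + 1))"
  proof (rule mult_left_mono)
    have "root 4 (real T) \<le> root 4 (real T + 1)" by simp
    then show "(\<Sum>t\<in>{1..T}. 1 / root 4 (real t) ^ 3) \<le> 4 * root 4 (real T + 1)"
      using sum_inverse_root4_cubed_le[of T] by linarith
    show "0 \<le> S2 / sqrt (alpha * nu)"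
      using lip an by (intro divide_nonneg_nonneg) (auto simp: S2_def intro!: sum_nonneg)
  qed
  finally have bias: "(\<Sum>t\<in>{1..T}. \<Sum>i\<in>{1..K}. L i * (1 / sqrt (pr t)) * real (i * d)) \<le> S2 / sqrt (alpha * nu) * (4 * root 4 (real T + 1))" .
  have "(\<Sum>t\<in>{1..T}. Ef t - Fs - (\<Sum>i\<in>{1..K}. L i * (1 / sqrt (pr t)) * real (i * d))) =
     (\<Sum>t\<in>{1..T}. Ef t) - real T * Fs - (\<Sum>t\<in>{1..T}. \<Sum>i\<in>{1..K}. L i * (1 / sqrt (pr t)) * real (i * d))"
    by (simp add: sum_subtractf)
  with main bias have "(\<Sum>t\<in>{1..T}. Ef t) - real T * Fs \<le> V0 / (2 * beta) + 2 * sqrt (real T + 1) * (3 * beta * S1 / (2 * alpha * nu)) +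
    4 * root 4 (real T + 1) * (S2 / sqrt (alpha * nu)) + sqrt (real T + 2) * (alpha * nu * B / beta)"
    by (simp add: mult_ac)
  then show ?thesis unfolding Ef_def Fs_def V0_def S1_def S2_def .
qed

end

theorem theorem1:
  fixes d K N T :: nat
    and f :: "nat \<Rightarrow> real vec \<Rightarrow> real" and L :: "nat \<Rightarrow> real"
    and mustar mu1 :: "nat \<Rightarrow> real vec" and Sig1 :: "nat \<Rightarrow> real mat"
    and R B nul nuu beta alpha nu :: real
    and M :: "'w measure" and Z :: "nat \<times> nat \<times> nat \<times> nat \<Rightarrow> 'w \<Rightarrow> real"
    and c1 c2 :: "nat \<Rightarrow> nat \<Rightarrow> (nat \<times> nat \<times> nat \<times> nat \<Rightarrow> real) \<Rightarrow> real"
  defines "bet \<equiv> (\<lambda>t. real t * beta)"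
    and "alph \<equiv> (\<lambda>t. sqrt (real t + 1) * alpha)"
    and "gam \<equiv> (\<lambda>t. alpha * nu / (beta * sqrt (real t + 1)))"
    and "run \<equiv> casbo_run d K N T f (\<lambda>t. real t * beta)
             (\<lambda>t. sqrt (real t + 1) * alpha) (\<lambda>t. alpha * nu / (beta * sqrt (real t + 1))) (\<lambda>_. 1) Z c1 c2 mu1 Sig1"
  assumes dims: "1 \<le> d" "1 \<le> K" "1 \<le> N" "1 \<le> T"
    and A1: "\<forall>k\<in>{1..K}. convex_on_vec (k * d) (f k)"
    and A2: "\<forall>i\<in>{1..K}. \<forall>x\<in>carrier_vec (i * d). \<forall>y\<in>carrier_vec (i * d).
               \<bar>f i x - f i y\<bar> \<le> L i * vnorm (x - y)"
    and mustar_dim: "\<forall>k\<in>{1..K}. mustar k \<in> carrier_vec d"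
    and mustar_min: "\<forall>x. (\<forall>k\<in>{1..K}. x k \<in> carrier_vec d) \<longrightarrow>
               (\<Sum>k\<in>{1..K}. f k (stack mustar k)) \<le> (\<Sum>k\<in>{1..K}. f k (stack x k))"
    and init: "\<forall>k\<in>{1..K}. mu1 k \<in> carrier_vec d \<and> pd_mat d (Sig1 k)"
    and A3R: "(\<Sum>k\<in>{1..K}. wnorm_sq (inv_mat d (Sig1 k)) (mu1 k - mustar k)) \<le> R"
    and A3nu: "0 < nul" "nul \<le> nuu"
      "loewner_le (K * d) (nul \<cdot>\<^sub>m 1\<^sub>m (K * d)) (bdiag d Sig1 K)"
      "loewner_le (K * d) (bdiag d Sig1 K) (nuu \<cdot>\<^sub>m 1\<^sub>m (K * d))"
    and A3B: "(\<Sum>k\<in>{1..K}. (vnorm (mustar k))\<^sup>2) \<le> B"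
    and params: "0 < beta" "0 < alpha" "0 < nu"
    and Sig1_norm: "\<forall>k\<in>{1..K}. 1 / spec_norm d (Sig1 k) \<ge> 5 / 3 * alpha * nu"
    and prob: "prob_space M"
    and indep: "prob_space.indep_vars M (\<lambda>_. borel) Z (casbo_index T K N d)"
    and gauss: "\<forall>i\<in>casbo_index T K N d. distributed M lborel (Z i) std_normal_density"
    and c_meas: "\<forall>t\<in>{1..T}. \<forall>k\<in>{1..K}.
               c1 t k \<in> borel_measurable (PiM UNIV (\<lambda>_. borel)) \<and>
               c2 t k \<in> borel_measurable (PiM UNIV (\<lambda>_. borel))"
    and c_pos: "\<forall>t\<in>{1..T}. \<forall>k\<in>{1..K}. \<forall>h. 0 < c1 t k h \<and> 0 < c2 t k h"
    and C1: "\<forall>w\<in>space M. \<forall>t\<in>{1..T}. \<forall>k\<in>{1..K}.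
               loewner_le d
                 (casbo_H d K N f (fst (run w (t - 1))) (snd (run w (t - 1))) (casbo_z d Z w t)
                    (c1 t k (casbo_hist (casbo_index T K N d) Z t w))
                    (c2 t k (casbo_hist (casbo_index T K N d) Z t w)) k)
                 ((1 / alph t) * (bet (t + 1) / bet t - 1) \<cdot>\<^sub>m 1\<^sub>m d
                    + (bet (t + 1) * gam t / alph t) \<cdot>\<^sub>m snd (run w (t - 1)) k)"
    and C2: "\<forall>w\<in>space M. \<forall>t\<in>{1..T}. \<forall>k\<in>{1..K}.
               loewner_le d (nu \<cdot>\<^sub>m 1\<^sub>m d)
                 (casbo_G d K N f (fst (run w (t - 1))) (snd (run w (t - 1))) (casbo_z d Z w t)
                    (c1 t k (casbo_hist (casbo_index T K N d) Z t w))
                    (c2 t k (casbo_hist (casbo_index T K N d) Z t w)) k)"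
  shows "(1 / real T) * (\<Sum>t\<in>{1..T}. \<Sum>k\<in>{1..K}.
             integral\<^sup>L M (\<lambda>w. f k (stack (fst (run w (t - 1))) k)))
           - (\<Sum>k\<in>{1..K}. f k (stack mustar k))
         \<le> casbo_bound beta alpha nu B d K T L
              (\<Sum>k\<in>{1..K}. wnorm_sq (inv_mat d (Sig1 k)) (mu1 k - mustar k))
       \<and> (\<forall>Lmax::real. \<exists>C::real. \<forall>(d'::nat) (K'::nat) (T'::nat) (L'::nat \<Rightarrow> real) (Q::real).
             1 \<le> d' \<longrightarrow> 1 \<le> K' \<longrightarrow> 1 \<le> T' \<longrightarrow>
             (\<forall>i\<in>{1..K'}. 0 \<le> L' i \<and> L' i \<le> Lmax) \<longrightarrow> 0 \<le> Q \<longrightarrow> Q \<le> R \<longrightarrow>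
             casbo_bound beta alpha nu B d' K' T' L' Q
               \<le> C * real d' ^ 2 * real K' ^ 4 / sqrt (real T'))"
proof
  have L: "0 \<le> L i" if i: "i \<in> {1..K}" for i
  proof -
    have id: "0 < i * d" using i dims by simp
    have "unit_vec (i * d) 0 - 0\<^sub>v (i * d) = (unit_vec (i * d) 0 :: real vec)" by (intro eq_vecI) auto
    moreover have "vnorm (unit_vec (i * d) 0) = 1" using id by (simp add: vnorm_def)
    moreover have "\<bar>f i (unit_vec (i * d) 0) - f i (0\<^sub>v (i * d))\<bar> \<le> L i * vnorm (unit_vec (i * d) 0 - 0\<^sub>v (i * d))"
      by (rule A2[rule_format, OF i]) simp_all
    ultimately show ?thesis by (metis abs_ge_zero mult.right_neutral order_trans)
  qed
  interpret casbo_setting M d K N T f L mustar mu1 Sig1 beta alpha nu Z c1 c2 run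
  proof (intro casbo_setting.intro prob casbo_setting_axioms.intro)
    show "prob_space.indep_vars M (\<lambda>_. borel) Z (casbo_index T K N d)" by (rule indep)
    show "lipschitz_vec (i * d) (f i) (L i) \<and> 0 \<le> L i" if "i \<in> {1..K}" for i
      using A2 L that by (auto simp: lipschitz_vec_def)
    show "loewner_le d
        (casbo_H d K N f (fst (run w (t - 1))) (snd (run w (t - 1))) (casbo_z d Z w t)
          (c1 t k (casbo_hist (casbo_index T K N d) Z t w)) (c2 t k (casbo_hist (casbo_index T K N d) Z t w)) k)
        ((1 / (sqrt (real t + 1) * alpha) * (real (t + 1) * beta / (real t * beta) - 1)) \<cdot>\<^sub>m 1\<^sub>m d
          + (real (t + 1) * beta * (alpha * nu / (beta * sqrt (real t + 1))) / (sqrt (real t + 1) * alpha)) \<cdot>\<^sub>m snd (run w (t - 1)) k)"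
      if "w \<in> space M" "t \<in> {1..T}" "k \<in> {1..K}" for w t k
      using C1[rule_format, OF that] unfolding alph_def bet_def gam_def .
  qed (use dims A1 mustar_dim init params Sig1_norm gauss c_meas C2 in \<open>auto simp: run_def\<close>)
  have Bs: "Bs \<le> B" using A3B by (simp add: Bs_def)
  then have B: "0 \<le> B" using nonneg(1) by linarith
  let ?Q = "\<Sum>k\<in>{1..K}. wnorm_sq (inv_mat d (Sig1 k)) (mu1 k - mustar k)"
  let ?E = "\<Sum>t\<in>{1..T}. \<Sum>k\<in>{1..K}. integral\<^sup>L M (\<lambda>w. f k (stack (fst (run w (t - 1))) k))"
  let ?F = "\<Sum>k\<in>{1..K}. f k (stack mustar k)"
  let ?C1 = "3 * beta * (\<Sum>i\<in>{1..K}. real K * (L i)\<^sup>2 * (real i * real d + 1)\<^sup>2) / (2 * alpha * nu)"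
  let ?C2 = "(\<Sum>i\<in>{1..K}. sqrt 3 * real i * real d * L i) / sqrt (alpha * nu)"
  have T: "0 < real T" using dims by simp
  have "(?E - real T * ?F) / real T \<le> (?Q / (2 * beta) + 2 * sqrt (real T + 1) * ?C1 + 4 * root 4 (real T + 1) * ?C2
      + sqrt (real T + 2) * (alpha * nu * B / beta)) / real T"
    using expected_regret[OF Bs] T by (intro divide_right_mono) auto
  moreover have "(?E - real T * ?F) / real T = 1 / real T * ?E - ?F" using T by (simp add: diff_divide_distrib)
  ultimately show "1 / real T * ?E - ?F \<le> casbo_bound beta alpha nu B d K T L ?Q"
    unfolding casbo_bound_def Let_def add_divide_distrib by simp
  show "\<forall>Lmax::real. \<exists>C::real. \<forall>(d'::nat) (K'::nat) (T'::nat) (L'::nat \<Rightarrow> real) (Q::real).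
             1 \<le> d' \<longrightarrow> 1 \<le> K' \<longrightarrow> 1 \<le> T' \<longrightarrow>
             (\<forall>i\<in>{1..K'}. 0 \<le> L' i \<and> L' i \<le> Lmax) \<longrightarrow> 0 \<le> Q \<longrightarrow> Q \<le> R \<longrightarrow>
             casbo_bound beta alpha nu B d' K' T' L' Q
               \<le> C * real d' ^ 2 * real K' ^ 4 / sqrt (real T')"
    by (intro allI casbo_bound_rate params B)
qed

end
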